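(* Let $H$ be a finite-dimensional Hopf algebra, $X$ an algebra, $\alpha:X\to H\otimes X$ a left coaction of $H$ on $X$ and $\beta:X\to X\otimes\widehat H$ a right coaction of the dual Hopf algebra $\widehat H$ on $X$. Then $(X,\alpha,\beta)$ is a left-right $(H,\widehat H)$-Yetter--Drinfeld algebra if and only if $(X,\rhd_\beta,\alpha)$ is a (left-left) Yetter--Drinfeld algebra over $H$, where $\rhd_\beta:H\otimes X\to X$, $h\rhd_\beta x=(\mathrm{id}_X\otimes \mathbf p(h,\cdot))(\beta(x))$, is the left action of $H$ on $X$ induced by the coaction $\beta$.
   Context: $\Bbbk$ is a field, algebras are unital $\Bbbk$-algebras. $H$ has comultiplication $\Delta$, counit $\varepsilon$, antipode $S$ (bijective), with Sweedler notation $\Delta(h)=h_{(1)}\otimes h_{(2)}$. $\widehat H$ is the dual Hopf algebra and $\mathbf p:H\times\widehat H\to\Bbbk$, $\mathbf p(h,\theta)=\theta(h)$, so that $\mathbf p(h,\theta\theta')=\mathbf p(h_{(1)},\theta)\mathbf p(h_{(2)},\theta')$ and $\mathbf p(hh',\theta)=\mathbf p(h,\theta_{(1)})\mathbf p(h',\theta_{(2)})$. The canonical element is $U=\sum_i h_i\otimes\widehat h_i\in H\otimes\widehat H$ for a basis $(h_i)$ of $H$ with dual basis $(\widehat h_i)$; it is invertible with $U^{-1}=(S\otimes\mathrm{id})(U)$. For an invertible $W$ in an algebra, $\mathrm{Ad}(W)(z)=WzW^{-1}$. $U_{13}\in H\otimes X\otimes\widehat H$ is $U$ placed in legs 1 and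 3, with $1_X$ in leg 2. A left coaction of a Hopf algebra $K$ on an algebra $X$ is an algebra homomorphism $\alpha:X\to K\otimes X$ with $(\mathrm{id}\otimes\alpha)\alpha=(\Delta_K\otimes\mathrm{id})\alpha$ and $(\varepsilon_K\otimes\mathrm{id})\alpha=\mathrm{id}$; right coactions $X\to X\otimes K$ are defined similarly. A left action of $H$ on $X$ is a left module structure $\rhd$ with $h\rhd(xy)=(h_{(1)}\rhd x)(h_{(2)}\rhd y)$, $h\rhd 1_X=\varepsilon(h)1_X$. $(X,\alpha,\beta)$ is a left-right $(H,\widehat H)$-Yetter--Drinfeld algebra if $(\alpha\otimes\mathrm{id}_{\widehat H})\beta=\mathrm{Ad}(U_{13})(\mathrm{id}_H\otimes\beta)\alpha$. For a left action $\rhd$ and a left coaction $\delta(x)=x_{[-1]}\otimes x_{[0]}$ of $H$ on $X$, $(X,\rhd,\delta)$ is a (left-left) Yetter--Drinfeld algebra over $H$ if $h_{(1)}x_{[-1]}\otimes(h_{(2)}\rhd x_{[0]})=(h_{(1)}\rhd x)_{[-1]}h_{(2)}\otimes(h_{(1)}\rhd x)_{[0]}$ for all $h\in H$, $x\in X$. *)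

theory Defs
  imports "Jordan_Normal_Form.Missing_VectorSpace"
begin

section \<open>Algebras over a field\<close>

text \<open>The locale \<open>algebra\<close> of HOL-Algebra is restricted to commutative algebras. The zero algebra
  is allowed here.\<close>

locale unital_algebra = vectorspace K A + A_ring?: ring A for K and A +
  assumes smult_mult_left: "\<lbrakk>a \<in> carrier K; x \<in> carrier A; y \<in> carrier A\<rbrakk> \<Longrightarrow>
      (a \<odot>\<^bsub>A\<^esub> x) \<otimes>\<^bsub>A\<^esub> y = a \<odot>\<^bsub>A\<^esub> (x \<otimes>\<^bsub>A\<^esub> y)"
    and smult_mult_right: "\<lbrakk>a \<in> carrier K; x \<in> carrier A; y \<in> carrier A\<rbrakk> \<Longrightarrow>
      x \<otimes>\<^bsub>A\<^esub> (a \<odot>\<^bsub>A\<^esub> y) = a \<odot>\<^bsub>A\<^esub> (x \<otimes>\<^bsub>A\<^esub> y)"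

definition algebra_hom ::
    "'k ring \<Rightarrow> ('k, 'a, 'm) module_scheme \<Rightarrow> ('k, 'b, 'n) module_scheme \<Rightarrow> ('a \<Rightarrow> 'b) set" where
  "algebra_hom K A B = ring_hom A B \<inter> module_hom K A B"

text \<open>The field \<open>K\<close> as an algebra over itself.\<close>

definition base_algebra :: "'k ring \<Rightarrow> ('k, 'k) module" where
  "base_algebra K = \<lparr>carrier = carrier K, mult = mult K, one = one K, zero = zero K, add = add K,
     smult = mult K\<rparr>"


section \<open>Tensor products\<close>

text \<open>A list \<open>[(v\<^sub>1, w\<^sub>1), \<dots>, (v\<^sub>n, w\<^sub>n)]\<close> stands for the formal sum of the
  \<open>v\<^sub>i \<otimes> w\<^sub>i\<close>. The tensor product of \<open>V\<close> and \<open>W\<close> over \<open>K\<close> is the quotient of the formal sums by the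
  smallest congruence that makes the sum commutative and \<open>(v, w) \<mapsto> v \<otimes> w\<close> bilinear and
  \<open>K\<close>-balanced.\<close>

inductive tensor_eq ::
    "'k ring \<Rightarrow> ('k, 'v, 'm) module_scheme \<Rightarrow> ('k, 'w, 'n) module_scheme \<Rightarrow>
     ('v \<times> 'w) list \<Rightarrow> ('v \<times> 'w) list \<Rightarrow> bool"
  for K V W where
  refl: "set s \<subseteq> carrier V \<times> carrier W \<Longrightarrow> tensor_eq K V W s s"
| sym: "tensor_eq K V W s t \<Longrightarrow> tensor_eq K V W t s"
| trans: "tensor_eq K V W s t \<Longrightarrow> tensor_eq K V W t u \<Longrightarrow> tensor_eq K V W s u"
| append: "tensor_eq K V W s t \<Longrightarrow> tensor_eq K V W s' t' \<Longrightarrow> tensor_eq K V W (s @ s') (t @ t')"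
| commute: "\<lbrakk>set s \<subseteq> carrier V \<times> carrier W; set t \<subseteq> carrier V \<times> carrier W\<rbrakk> \<Longrightarrow>
    tensor_eq K V W (s @ t) (t @ s)"
| zero: "w \<in> carrier W \<Longrightarrow> tensor_eq K V W [(\<zero>\<^bsub>V\<^esub>, w)] []"
| add_left: "\<lbrakk>v \<in> carrier V; v' \<in> carrier V; w \<in> carrier W\<rbrakk> \<Longrightarrow>
    tensor_eq K V W [(v \<oplus>\<^bsub>V\<^esub> v', w)] [(v, w), (v', w)]"
| add_right: "\<lbrakk>v \<in> carrier V; w \<in> carrier W; w' \<in> carrier W\<rbrakk> \<Longrightarrow>
    tensor_eq K V W [(v, w \<oplus>\<^bsub>W\<^esub> w')] [(v, w), (v, w')]"
| smult: "\<lbrakk>a \<in> carrier K; v \<in> carrier V; w \<in> carrier W\<rbrakk> \<Longrightarrow>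
    tensor_eq K V W [(a \<odot>\<^bsub>V\<^esub> v, w)] [(v, a \<odot>\<^bsub>W\<^esub> w)]"

definition tensor_class ::
    "'k ring \<Rightarrow> ('k, 'v, 'm) module_scheme \<Rightarrow> ('k, 'w, 'n) module_scheme \<Rightarrow>
     ('v \<times> 'w) list \<Rightarrow> ('v \<times> 'w) list set" where
  "tensor_class K V W s = {t. tensor_eq K V W s t}"

definition tensor_elem ::
    "'k ring \<Rightarrow> ('k, 'v, 'm) module_scheme \<Rightarrow> ('k, 'w, 'n) module_scheme \<Rightarrow>
     'v \<Rightarrow> 'w \<Rightarrow> ('v \<times> 'w) list set" where
  "tensor_elem K V W v w = tensor_class K V W [(v, w)]"

definition tensor_rep :: "('v \<times> 'w) list set \<Rightarrow> ('v \<times> 'w) list" where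
  "tensor_rep t = (SOME s. s \<in> t)"

text \<open>Multiplication and unit are those of the tensor product algebra; they are meaningful only when
  \<open>V\<close> and \<open>W\<close> are algebras.\<close>

definition tensor ::
    "'k ring \<Rightarrow> ('k, 'v, 'm) module_scheme \<Rightarrow> ('k, 'w, 'n) module_scheme \<Rightarrow>
     ('k, ('v \<times> 'w) list set) module" where
  "tensor K V W = \<lparr>
     carrier = tensor_class K V W ` lists (carrier V \<times> carrier W),
     mult = (\<lambda>s t. tensor_class K V W
       [(v \<otimes>\<^bsub>V\<^esub> v', w \<otimes>\<^bsub>W\<^esub> w'). (v, w) \<leftarrow> tensor_rep s, (v', w') \<leftarrow> tensor_rep t]),
     one = tensor_elem K V W \<one>\<^bsub>V\<^esub> \<one>\<^bsub>W\<^esub>,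
     zero = tensor_class K V W [],
     add = (\<lambda>s t. tensor_class K V W (tensor_rep s @ tensor_rep t)),
     smult = (\<lambda>a t. tensor_class K V W [(a \<odot>\<^bsub>V\<^esub> v, w). (v, w) \<leftarrow> tensor_rep t])\<rparr>"

text \<open>For a bilinear map \<open>f\<close> into \<open>Z\<close>, \<open>tensor_lift Z f\<close> is the induced linear map on the tensor
  product, mapping \<open>v \<otimes> w\<close> to \<open>f v w\<close>. It also renders Sweedler notation: an expression
  \<open>f h\<^sub>(\<^sub>1\<^sub>) h\<^sub>(\<^sub>2\<^sub>)\<close> is \<open>tensor_lift Z f (comult H h)\<close>.\<close>

definition tensor_lift ::
    "('k, 'z, 'm) module_scheme \<Rightarrow> ('v \<Rightarrow> 'w \<Rightarrow> 'z) \<Rightarrow> ('v \<times> 'w) list set \<Rightarrow> 'z" where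
  "tensor_lift Z f t = foldr (\<lambda>(v, w) z. f v w \<oplus>\<^bsub>Z\<^esub> z) (tensor_rep t) \<zero>\<^bsub>Z\<^esub>"

text \<open>The map \<open>f \<otimes> g\<close> with codomain the tensor product of \<open>V\<close> and \<open>W\<close>.\<close>

definition tensor_map ::
    "'k ring \<Rightarrow> ('k, 'v, 'm) module_scheme \<Rightarrow> ('k, 'w, 'n) module_scheme \<Rightarrow>
     ('a \<Rightarrow> 'v) \<Rightarrow> ('b \<Rightarrow> 'w) \<Rightarrow> ('a \<times> 'b) list set \<Rightarrow> ('v \<times> 'w) list set" where
  "tensor_map K V W f g = tensor_lift (tensor K V W) (\<lambda>a b. tensor_elem K V W (f a) (g b))"

text \<open>The canonical isomorphism \<open>(U \<otimes> V) \<otimes> W \<rightarrow> U \<otimes> (V \<otimes> W)\<close>. Threefold tensor products are always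
  bracketed to the right.\<close>

definition tensor_assoc ::
    "'k ring \<Rightarrow> ('k, 'u, 'l) module_scheme \<Rightarrow> ('k, 'v, 'm) module_scheme \<Rightarrow>
     ('k, 'w, 'n) module_scheme \<Rightarrow>
     (('u \<times> 'v) list set \<times> 'w) list set \<Rightarrow> ('u \<times> ('v \<times> 'w) list set) list set" where
  "tensor_assoc K U V W =
     (let T = tensor K U (tensor K V W)
      in tensor_lift T (\<lambda>t w. tensor_lift T
           (\<lambda>u v. tensor_elem K U (tensor K V W) u (tensor_elem K V W v w)) t))"


section \<open>Hopf algebras\<close>

record ('k, 'h) hopf = "('k, 'h) module" +
  comult :: "'h \<Rightarrow> ('h \<times> 'h) list set"
  counit :: "'h \<Rightarrow> 'k"
  antipode :: "'h \<Rightarrow> 'h"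

locale hopf_algebra = unital_algebra K H for K :: "'k ring" and H :: "('k, 'h) hopf" +
  assumes comult_hom: "comult H \<in> algebra_hom K H (tensor K H H)"
    and counit_hom: "counit H \<in> algebra_hom K H (base_algebra K)"
    and coassoc: "h \<in> carrier H \<Longrightarrow>
      tensor_map K H (tensor K H H) id (comult H) (comult H h) =
      tensor_assoc K H H H (tensor_map K (tensor K H H) H (comult H) id (comult H h))"
    and counit_left: "h \<in> carrier H \<Longrightarrow>
      tensor_lift H (\<lambda>a b. counit H a \<odot>\<^bsub>H\<^esub> b) (comult H h) = h"
    and counit_right: "h \<in> carrier H \<Longrightarrow>
      tensor_lift H (\<lambda>a b. counit H b \<odot>\<^bsub>H\<^esub> a) (comult H h) = h"
    and antipode_linear: "antipode H \<in> module_hom K H H"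
    and antipode_left: "h \<in> carrier H \<Longrightarrow>
      tensor_lift H (\<lambda>a b. antipode H a \<otimes>\<^bsub>H\<^esub> b) (comult H h) = counit H h \<odot>\<^bsub>H\<^esub> \<one>\<^bsub>H\<^esub>"
    and antipode_right: "h \<in> carrier H \<Longrightarrow>
      tensor_lift H (\<lambda>a b. a \<otimes>\<^bsub>H\<^esub> antipode H b) (comult H h) = counit H h \<odot>\<^bsub>H\<^esub> \<one>\<^bsub>H\<^esub>"
    and antipode_bij: "bij_betw (antipode H) (carrier H) (carrier H)"

definition pairing :: "'h \<Rightarrow> ('h \<Rightarrow> 'k) \<Rightarrow> 'k" where
  "pairing h \<theta> = \<theta> h"

text \<open>Functionals are made extensional so that equality of functions is equality of functionals.\<close>

definition dual_algebra :: "'k ring \<Rightarrow> ('k, 'h) hopf \<Rightarrow> ('k, 'h \<Rightarrow> 'k) module" where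
  "dual_algebra K H = \<lparr>
     carrier = module_hom K H (base_algebra K) \<inter> extensional (carrier H),
     mult = (\<lambda>\<theta> \<theta>'. \<lambda>h\<in>carrier H.
       tensor_lift (base_algebra K) (\<lambda>a b. pairing a \<theta> \<otimes>\<^bsub>K\<^esub> pairing b \<theta>') (comult H h)),
     one = (\<lambda>h\<in>carrier H. counit H h),
     zero = (\<lambda>h\<in>carrier H. \<zero>\<^bsub>K\<^esub>),
     add = (\<lambda>\<theta> \<theta>'. \<lambda>h\<in>carrier H. \<theta> h \<oplus>\<^bsub>K\<^esub> \<theta>' h),
     smult = (\<lambda>a \<theta>. \<lambda>h\<in>carrier H. a \<otimes>\<^bsub>K\<^esub> \<theta> h)\<rparr>"

text \<open>The comultiplication of the dual is determined by the multiplication of \<open>H\<close> via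
  \<open>\<langle>h h', \<theta>\<rangle> = \<langle>h, \<theta>\<^sub>(\<^sub>1\<^sub>)\<rangle> \<langle>h', \<theta>\<^sub>(\<^sub>2\<^sub>)\<rangle>\<close>;
  the description is proper only for finite-dimensional \<open>H\<close>.\<close>

definition dual_comult ::
    "'k ring \<Rightarrow> ('k, 'h) hopf \<Rightarrow> ('h \<Rightarrow> 'k) \<Rightarrow> (('h \<Rightarrow> 'k) \<times> ('h \<Rightarrow> 'k)) list set" where
  "dual_comult K H \<theta> =
     (THE t. t \<in> carrier (tensor K (dual_algebra K H) (dual_algebra K H)) \<and>
        (\<forall>h\<in>carrier H. \<forall>h'\<in>carrier H.
           pairing (h \<otimes>\<^bsub>H\<^esub> h') \<theta> =
           tensor_lift (base_algebra K) (\<lambda>\<phi> \<psi>. pairing h \<phi> \<otimes>\<^bsub>K\<^esub> pairing h' \<psi>) t))"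

definition dual_hopf :: "'k ring \<Rightarrow> ('k, 'h) hopf \<Rightarrow> ('k, 'h \<Rightarrow> 'k) hopf" where
  "dual_hopf K H = module.extend (dual_algebra K H) (hopf.fields
     (dual_comult K H) (\<lambda>\<theta>. \<theta> \<one>\<^bsub>H\<^esub>) (\<lambda>\<theta>. \<lambda>h\<in>carrier H. \<theta> (antipode H h)))"

definition dual_vector :: "'k ring \<Rightarrow> ('k, 'h) hopf \<Rightarrow> 'h set \<Rightarrow> 'h \<Rightarrow> ('h \<Rightarrow> 'k)" where
  "dual_vector K H B b = (THE \<theta>. \<theta> \<in> carrier (dual_hopf K H) \<and>
     (\<forall>c\<in>B. \<theta> c = (if c = b then \<one>\<^bsub>K\<^esub> else \<zero>\<^bsub>K\<^esub>)))"

text \<open>The canonical element does not depend on the basis.\<close>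

definition canonical_element ::
    "'k ring \<Rightarrow> ('k, 'h) hopf \<Rightarrow> ('h \<times> ('h \<Rightarrow> 'k)) list set" where
  "canonical_element K H =
     (let B = (SOME B. vectorspace.basis K H B)
      in \<Oplus>\<^bsub>tensor K H (dual_hopf K H)\<^esub> b\<in>B.
           tensor_elem K H (dual_hopf K H) b (dual_vector K H B b))"


section \<open>Actions, coactions and Yetter--Drinfeld algebras\<close>

definition left_coaction ::
    "'k ring \<Rightarrow> ('k, 'h) hopf \<Rightarrow> ('k, 'x) module \<Rightarrow> ('x \<Rightarrow> ('h \<times> 'x) list set) \<Rightarrow> bool" where
  "left_coaction K H X \<alpha> \<longleftrightarrow>
     \<alpha> \<in> algebra_hom K X (tensor K H X) \<and>
     (\<forall>x\<in>carrier X.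
        tensor_map K H (tensor K H X) id \<alpha> (\<alpha> x) =
        tensor_assoc K H H X (tensor_map K (tensor K H H) X (comult H) id (\<alpha> x))) \<and>
     (\<forall>x\<in>carrier X. tensor_lift X (\<lambda>h y. counit H h \<odot>\<^bsub>X\<^esub> y) (\<alpha> x) = x)"

definition right_coaction ::
    "'k ring \<Rightarrow> ('k, 'h) hopf \<Rightarrow> ('k, 'x) module \<Rightarrow> ('x \<Rightarrow> ('x \<times> 'h) list set) \<Rightarrow> bool" where
  "right_coaction K H X \<beta> \<longleftrightarrow>
     \<beta> \<in> algebra_hom K X (tensor K X H) \<and>
     (\<forall>x\<in>carrier X.
        tensor_assoc K X H H (tensor_map K (tensor K X H) H \<beta> id (\<beta> x)) =
        tensor_map K X (tensor K H H) id (comult H) (\<beta> x)) \<and>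
     (\<forall>x\<in>carrier X. tensor_lift X (\<lambda>y h. counit H h \<odot>\<^bsub>X\<^esub> y) (\<beta> x) = x)"

definition left_action ::
    "'k ring \<Rightarrow> ('k, 'h) hopf \<Rightarrow> ('k, 'x) module \<Rightarrow> ('h \<Rightarrow> 'x \<Rightarrow> 'x) \<Rightarrow> bool" where
  "left_action K H X act \<longleftrightarrow>
     (\<forall>h\<in>carrier H. act h \<in> module_hom K X X) \<and>
     (\<forall>x\<in>carrier X. (\<lambda>h. act h x) \<in> module_hom K H X) \<and>
     (\<forall>x\<in>carrier X. act \<one>\<^bsub>H\<^esub> x = x) \<and>
     (\<forall>h\<in>carrier H. \<forall>h'\<in>carrier H. \<forall>x\<in>carrier X. act (h \<otimes>\<^bsub>H\<^esub> h') x = act h (act h' x)) \<and>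
     (\<forall>h\<in>carrier H. \<forall>x\<in>carrier X. \<forall>y\<in>carrier X.
        act h (x \<otimes>\<^bsub>X\<^esub> y) = tensor_lift X (\<lambda>h1 h2. act h1 x \<otimes>\<^bsub>X\<^esub> act h2 y) (comult H h)) \<and>
     (\<forall>h\<in>carrier H. act h \<one>\<^bsub>X\<^esub> = counit H h \<odot>\<^bsub>X\<^esub> \<one>\<^bsub>X\<^esub>)"

definition Ad :: "('a, 'm) monoid_scheme \<Rightarrow> 'a \<Rightarrow> 'a \<Rightarrow> 'a" where
  "Ad A w z = w \<otimes>\<^bsub>A\<^esub> z \<otimes>\<^bsub>A\<^esub> inv\<^bsub>A\<^esub> w"

definition canonical_element_13 ::
    "'k ring \<Rightarrow> ('k, 'h) hopf \<Rightarrow> ('k, 'x) module \<Rightarrow>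
     ('h \<times> ('x \<times> ('h \<Rightarrow> 'k)) list set) list set" where
  "canonical_element_13 K H X =
     (let D = dual_hopf K H; XD = tensor K X D
      in tensor_lift (tensor K H XD)
           (\<lambda>h \<theta>. tensor_elem K H XD h (tensor_elem K X D \<one>\<^bsub>X\<^esub> \<theta>)) (canonical_element K H))"

definition left_right_yetter_drinfeld_algebra ::
    "'k ring \<Rightarrow> ('k, 'h) hopf \<Rightarrow> ('k, 'x) module \<Rightarrow>
     ('x \<Rightarrow> ('h \<times> 'x) list set) \<Rightarrow> ('x \<Rightarrow> ('x \<times> ('h \<Rightarrow> 'k)) list set) \<Rightarrow> bool" where
  "left_right_yetter_drinfeld_algebra K H X \<alpha> \<beta> \<longleftrightarrow>
     (let D = dual_hopf K H; XD = tensor K X D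
      in unital_algebra K X \<and> left_coaction K H X \<alpha> \<and> right_coaction K D X \<beta> \<and>
        (\<forall>x\<in>carrier X.
           tensor_assoc K H X D (tensor_map K (tensor K H X) D \<alpha> id (\<beta> x)) =
           Ad (tensor K H XD) (canonical_element_13 K H X) (tensor_map K H XD id \<beta> (\<alpha> x))))"

definition yetter_drinfeld_algebra ::
    "'k ring \<Rightarrow> ('k, 'h) hopf \<Rightarrow> ('k, 'x) module \<Rightarrow>
     ('h \<Rightarrow> 'x \<Rightarrow> 'x) \<Rightarrow> ('x \<Rightarrow> ('h \<times> 'x) list set) \<Rightarrow> bool" where
  "yetter_drinfeld_algebra K H X act \<delta> \<longleftrightarrow>
     unital_algebra K X \<and> left_action K H X act \<and> left_coaction K H X \<delta> \<and>
     (\<forall>h\<in>carrier H. \<forall>x\<in>carrier X.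
        tensor_lift (tensor K H X)
          (\<lambda>h1 h2. tensor_lift (tensor K H X)
             (\<lambda>a y. tensor_elem K H X (h1 \<otimes>\<^bsub>H\<^esub> a) (act h2 y)) (\<delta> x))
          (comult H h) =
        tensor_lift (tensor K H X)
          (\<lambda>h1 h2. tensor_lift (tensor K H X)
             (\<lambda>a y. tensor_elem K H X (a \<otimes>\<^bsub>H\<^esub> h2) y) (\<delta> (act h1 x)))
          (comult H h))"

definition induced_action ::
    "('k, 'x) module \<Rightarrow> ('x \<Rightarrow> ('x \<times> ('h \<Rightarrow> 'k)) list set) \<Rightarrow> 'h \<Rightarrow> 'x \<Rightarrow> 'x" where
  "induced_action X \<beta> h x = tensor_lift X (\<lambda>y \<theta>. pairing h \<theta> \<odot>\<^bsub>X\<^esub> y) (\<beta> x)"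

end

theory Submission
  imports Defs
begin

text \<open>Let \<open>D\<close> be the dual of \<open>H\<close>. Every \<open>t \<in> V \<otimes> D\<close> can be evaluated at \<open>h \<in> H\<close> in its second
  leg, giving \<open>ev\<^sub>h(t) \<in> V\<close>. As \<open>H\<close> is finite-dimensional, \<open>t = \<Sum>\<^sub>b ev\<^sub>b(t) \<otimes> b\<^sup>*\<close> for a basis with its
  dual basis, so the evaluations determine \<open>t\<close> (\<open>ev_eqI\<close>, \<open>ev3_eqI\<close>). An equation in
  \<open>H \<otimes> X \<otimes> D\<close> is therefore the same as a family of equations in \<open>H \<otimes> X\<close> indexed by \<open>h\<close>, and the
  theorem says that the family belonging to the left-right condition is the left-left condition.

  Three facts identify the family. By definition of the induced action,
  \<open>ev\<^sub>h(\<beta>(x)) = h \<rhd> x\<close>. The multiplication of \<open>D\<close> is dual to the comultiplication of \<open>H\<close>, so that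
  evaluation turns products into convolutions, \<open>ev\<^sub>h(s t) = ev\<^sub>h\<^sub>(\<^sub>1\<^sub>)(s) ev\<^sub>h\<^sub>(\<^sub>2\<^sub>)(t)\<close> (\<open>ev_mult\<close>,
  \<open>ev3_mult\<close>). Finally the canonical element evaluates to the identity of \<open>H\<close>: \<open>U\<^sub>1\<^sub>3\<close> becomes
  \<open>h \<otimes> 1\<close> (\<open>canon\<close>). Consequently \<open>U\<^sub>1\<^sub>3\<close> is invertible, its inverse being the element that
  evaluates to \<open>S(h) \<otimes> 1\<close>, because \<open>h\<^sub>(\<^sub>1\<^sub>) S(h\<^sub>(\<^sub>2\<^sub>)) = \<epsilon>(h) 1\<close> (\<open>canon_mult\<close>). The left-right condition
  can thus be rewritten as
  \<open>(\<alpha> \<otimes> id)\<beta>(x) \<cdot> U\<^sub>1\<^sub>3 = U\<^sub>1\<^sub>3 \<cdot> (id \<otimes> \<beta>)\<alpha>(x)\<close> (\<open>canonical_conjugate_iff\<close>), and its evaluation at \<open>h\<close> is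
  \<open>\<alpha>(h\<^sub>(\<^sub>1\<^sub>) \<rhd> x) (h\<^sub>(\<^sub>2\<^sub>) \<otimes> 1) = (h\<^sub>(\<^sub>1\<^sub>) \<otimes> 1) (id \<otimes> h\<^sub>(\<^sub>2\<^sub>) \<rhd> \<cdot>)\<alpha>(x)\<close>, which is the left-left condition
  (\<open>yetter_drinfeld_condition_iff\<close>).

  The left-left notion also asks that \<open>\<rhd>\<close> be an action, which holds for every right coaction
  \<open>\<beta>\<close> (\<open>induced_left_action\<close>): the module law is the coassociativity of \<open>\<beta>\<close> evaluated at a pair of
  elements, and the compatibility with products is multiplicativity of \<open>\<beta>\<close> under evaluation.

  All of this rests on the universal property of the tensor product (\<open>tensor_lift_hom\<close>,
  \<open>tensor_lift_elem\<close>) and on the principle that linear maps on it may be compared on elementary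
  tensors (\<open>tensor_hom_ext\<close>). In particular, a Sweedler expression is linear in everything it
  depends on (\<open>hom_lift_arg\<close>, \<open>hom_lift_param\<close>), linear maps can be pulled inside it
  (\<open>hom_tensor_lift\<close>), and threefold expressions can be rebracketed (\<open>tensor_lift_assoc\<close>).\<close>

section \<open>Linear and bilinear maps\<close>

text \<open>Linearity in each argument is expressed through \<open>module_hom\<close>, so that the same closure rules
  serve linear and bilinear maps.\<close>

definition bilinear ::
    "'k ring \<Rightarrow> ('k, 'v, 'm) module_scheme \<Rightarrow> ('k, 'w, 'n) module_scheme \<Rightarrow>
     ('k, 'z, 'l) module_scheme \<Rightarrow> ('v \<Rightarrow> 'w \<Rightarrow> 'z) \<Rightarrow> bool" where
  "bilinear K V W Z f \<longleftrightarrow>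
     (\<forall>v\<in>carrier V. f v \<in> module_hom K W Z) \<and>
     (\<forall>w\<in>carrier W. (\<lambda>v. f v w) \<in> module_hom K V Z)"

locale base_field = field K for K :: "'k ring"
begin

abbreviation Hom :: "('k, 'v, 'm) module_scheme \<Rightarrow> ('k, 'w, 'n) module_scheme \<Rightarrow> ('v \<Rightarrow> 'w) set"
  where "Hom V W \<equiv> module_hom K V W"

abbreviation tensor_space :: "('k, 'v, 'm) module_scheme \<Rightarrow> ('k, 'w, 'n) module_scheme \<Rightarrow>
     ('k, ('v \<times> 'w) list set) module" (infixr "\<boxtimes>" 72)
  where "V \<boxtimes> W \<equiv> tensor K V W"

text \<open>In a locale for an algebra over \<open>K\<close> the usual names of these laws denote the laws of the
  algebra; the names given here keep those of the scalars apart.\<close>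

lemmas scalar_cring = is_cring
lemmas scalar_m_closed = m_closed
lemmas scalar_m_assoc = m_assoc
lemmas scalar_m_comm = m_comm
lemmas scalar_m_ac = m_ac
lemmas scalar_a_ac = a_ac
lemmas scalar_distr = l_distr r_distr

lemma scalar_neg: "a \<in> carrier K \<Longrightarrow> (\<ominus>\<^bsub>K\<^esub> \<one>\<^bsub>K\<^esub>) \<otimes>\<^bsub>K\<^esub> a \<oplus>\<^bsub>K\<^esub> a = \<zero>\<^bsub>K\<^esub>"
  by (simp add: l_minus l_neg)

lemma vectorspace_of_module:
  assumes "module K V"
  shows "vectorspace K V"
  using assms field_axioms by (simp add: vectorspace_def)

lemma vs_module: "vectorspace K V \<Longrightarrow> module K V"
  by (simp add: vectorspace_def)

lemma vs_group: "vectorspace K V \<Longrightarrow> abelian_group V"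
  by (simp add: vectorspace_def module_def)

lemma vs_monoid: "vectorspace K V \<Longrightarrow> abelian_monoid V"
  by (simp add: vs_group abelian_group.axioms(1))

lemma vs_closed [simp]:
  assumes "vectorspace K V"
  shows "\<zero>\<^bsub>V\<^esub> \<in> carrier V"
    and "v \<in> carrier V \<Longrightarrow> v' \<in> carrier V \<Longrightarrow> v \<oplus>\<^bsub>V\<^esub> v' \<in> carrier V"
    and "a \<in> carrier K \<Longrightarrow> v \<in> carrier V \<Longrightarrow> a \<odot>\<^bsub>V\<^esub> v \<in> carrier V"
  using vs_monoid[OF assms] vs_module[OF assms]
  by (simp_all add: abelian_monoid.zero_closed abelian_monoid.a_closed module.smult_closed)

lemma vs_zero [simp]:
  assumes "vectorspace K V" and "v \<in> carrier V"
  shows "\<zero>\<^bsub>V\<^esub> \<oplus>\<^bsub>V\<^esub> v = v" and "v \<oplus>\<^bsub>V\<^esub> \<zero>\<^bsub>V\<^esub> = v"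
  using vs_monoid[OF assms(1)] assms(2)
  by (simp_all add: abelian_monoid.l_zero abelian_monoid.r_zero)

lemma hom_closed: "f \<in> Hom V W \<Longrightarrow> v \<in> carrier V \<Longrightarrow> f v \<in> carrier W"
  by (auto simp: module_hom_def)

lemma hom_add:
  "f \<in> Hom V W \<Longrightarrow> v \<in> carrier V \<Longrightarrow> v' \<in> carrier V \<Longrightarrow> f (v \<oplus>\<^bsub>V\<^esub> v') = f v \<oplus>\<^bsub>W\<^esub> f v'"
  by (auto simp: module_hom_def)

lemma hom_smult:
  "f \<in> Hom V W \<Longrightarrow> a \<in> carrier K \<Longrightarrow> v \<in> carrier V \<Longrightarrow> f (a \<odot>\<^bsub>V\<^esub> v) = a \<odot>\<^bsub>W\<^esub> f v"
  by (auto simp: module_hom_def)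

lemma hom_zero:
  assumes "vectorspace K V" "vectorspace K W" "f \<in> Hom V W"
  shows "f \<zero>\<^bsub>V\<^esub> = \<zero>\<^bsub>W\<^esub>"
proof -
  have "f \<zero>\<^bsub>V\<^esub> = f (\<zero>\<^bsub>K\<^esub> \<odot>\<^bsub>V\<^esub> \<zero>\<^bsub>V\<^esub>)"
    using module.smult_l_null[OF vs_module[OF assms(1)] vs_closed(1)[OF assms(1)]] by simp
  also have "\<dots> = \<zero>\<^bsub>K\<^esub> \<odot>\<^bsub>W\<^esub> f \<zero>\<^bsub>V\<^esub>"
    using assms by (simp add: hom_smult)
  also have "\<dots> = \<zero>\<^bsub>W\<^esub>"
    using module.smult_l_null[OF vs_module[OF assms(2)]] hom_closed[OF assms(3)] assms(1) by simp
  finally show ?thesis .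
qed

lemma homI:
  assumes "\<And>v. v \<in> carrier V \<Longrightarrow> f v \<in> carrier W"
    and "\<And>v v'. v \<in> carrier V \<Longrightarrow> v' \<in> carrier V \<Longrightarrow> f (v \<oplus>\<^bsub>V\<^esub> v') = f v \<oplus>\<^bsub>W\<^esub> f v'"
    and "\<And>a v. a \<in> carrier K \<Longrightarrow> v \<in> carrier V \<Longrightarrow> f (a \<odot>\<^bsub>V\<^esub> v) = a \<odot>\<^bsub>W\<^esub> f v"
  shows "f \<in> Hom V W"
  using assms by (auto simp: module_hom_def)

lemma hom_id: "(\<lambda>v. v) \<in> Hom V V"
  by (auto intro: homI)

lemma hom_comp:
  assumes g: "g \<in> Hom U V" and f: "f \<in> Hom V W"
  shows "(\<lambda>u. f (g u)) \<in> Hom U W"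
  by (rule homI) (simp_all add: hom_closed[OF f] hom_closed[OF g] hom_add[OF g] hom_add[OF f]
      hom_smult[OF g] hom_smult[OF f])

lemma hom_plus:
  assumes "vectorspace K V" "vectorspace K W" "f \<in> Hom V W" "g \<in> Hom V W"
  shows "(\<lambda>v. f v \<oplus>\<^bsub>W\<^esub> g v) \<in> Hom V W"
proof -
  interpret W: abelian_monoid W using assms(2) by (rule vs_monoid)
  interpret W: module K W using assms(2) by (rule vs_module)
  show ?thesis
    using assms by (auto intro!: homI simp: hom_add hom_smult W.smult_r_distr W.a_ac hom_closed[OF assms(3)] hom_closed[OF assms(4)])
qed

lemma hom_zero_map:
  assumes "vectorspace K V" "vectorspace K W"
  shows "(\<lambda>v. \<zero>\<^bsub>W\<^esub>) \<in> Hom V W"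
  using assms by (auto intro!: homI simp: module.smult_r_null[OF vs_module])

lemma hom_finsum:
  assumes "vectorspace K V" "vectorspace K W" "f \<in> Hom V W" "finite B" "g \<in> B \<rightarrow> carrier V"
  shows "f (\<Oplus>\<^bsub>V\<^esub>b\<in>B. g b) = (\<Oplus>\<^bsub>W\<^esub>b\<in>B. f (g b))"
  using assms(4,5)
proof induction
  case empty
  then show ?case
    using assms by (simp add: abelian_monoid.finsum_empty[OF vs_monoid] hom_zero)
next
  case (insert b B)
  interpret V: abelian_monoid V using assms(1) by (rule vs_monoid)
  interpret W: abelian_monoid W using assms(2) by (rule vs_monoid)
  have "(\<lambda>b. f (g b)) \<in> B \<rightarrow> carrier W" "g \<in> B \<rightarrow> carrier V" "g b \<in> carrier V"
    using insert.prems hom_closed[OF assms(3)] by (auto simp: Pi_iff)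
  then show ?case
    using insert assms(3) hom_closed[OF assms(3)] by (simp add: hom_add V.finsum_closed)
qed

lemma finsum_hom:
  assumes "vectorspace K V" "vectorspace K W" "finite B" "\<And>b. b \<in> B \<Longrightarrow> f b \<in> Hom V W"
  shows "(\<lambda>v. \<Oplus>\<^bsub>W\<^esub>b\<in>B. f b v) \<in> Hom V W"
proof -
  interpret W: abelian_monoid W using assms(2) by (rule vs_monoid)
  interpret WM: module K W using assms(2) by (rule vs_module)
  have cl: "(\<lambda>b. f b v) \<in> B \<rightarrow> carrier W" if "v \<in> carrier V" for v
    using that hom_closed[OF assms(4)] by auto
  show ?thesis
  proof (rule homI)
    fix v v' assume v: "v \<in> carrier V" "v' \<in> carrier V"
    have "(\<Oplus>\<^bsub>W\<^esub>b\<in>B. f b (v \<oplus>\<^bsub>V\<^esub> v')) = (\<Oplus>\<^bsub>W\<^esub>b\<in>B. f b v \<oplus>\<^bsub>W\<^esub> f b v')"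
      using v cl assms(4) by (intro W.finsum_cong') (auto simp: hom_add)
    then show "(\<Oplus>\<^bsub>W\<^esub>b\<in>B. f b (v \<oplus>\<^bsub>V\<^esub> v')) = (\<Oplus>\<^bsub>W\<^esub>b\<in>B. f b v) \<oplus>\<^bsub>W\<^esub> (\<Oplus>\<^bsub>W\<^esub>b\<in>B. f b v')"
      using W.finsum_addf[OF cl[OF v(1)] cl[OF v(2)]] by simp
  next
    fix a v assume v: "a \<in> carrier K" "v \<in> carrier V"
    have "(\<Oplus>\<^bsub>W\<^esub>b\<in>B. f b (a \<odot>\<^bsub>V\<^esub> v)) = (\<Oplus>\<^bsub>W\<^esub>b\<in>B. a \<odot>\<^bsub>W\<^esub> f b v)"
      using v cl assms(4) by (intro W.finsum_cong') (auto simp: hom_smult)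
    moreover have "(\<lambda>w. a \<odot>\<^bsub>W\<^esub> w) \<in> Hom W W"
      using v m_comm by (auto intro!: homI simp: WM.smult_r_distr WM.smult_assoc1[symmetric])
    ultimately show "(\<Oplus>\<^bsub>W\<^esub>b\<in>B. f b (a \<odot>\<^bsub>V\<^esub> v)) = a \<odot>\<^bsub>W\<^esub> (\<Oplus>\<^bsub>W\<^esub>b\<in>B. f b v)"
      using hom_finsum[OF assms(2,2) _ assms(3) cl[OF v(2)]] by simp
  next
    fix v assume "v \<in> carrier V"
    then show "(\<Oplus>\<^bsub>W\<^esub>b\<in>B. f b v) \<in> carrier W"
      using cl by (intro W.finsum_closed)
  qed
qed

lemma bilinearI:
  assumes "\<And>v. v \<in> carrier V \<Longrightarrow> f v \<in> Hom W Z"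
    and "\<And>w. w \<in> carrier W \<Longrightarrow> (\<lambda>v. f v w) \<in> Hom V Z"
  shows "bilinear K V W Z f"
  using assms by (simp add: bilinear_def)

lemma bilinearD:
  assumes "bilinear K V W Z f"
  shows "v \<in> carrier V \<Longrightarrow> f v \<in> Hom W Z"
    and "w \<in> carrier W \<Longrightarrow> (\<lambda>v. f v w) \<in> Hom V Z"
  using assms by (auto simp: bilinear_def)

lemma bilinear_closed:
  "bilinear K V W Z f \<Longrightarrow> v \<in> carrier V \<Longrightarrow> w \<in> carrier W \<Longrightarrow> f v w \<in> carrier Z"
  by (rule hom_closed[OF bilinearD(1)])

section \<open>The tensor product as a vector space\<close>

lemma tensor_eq_carrier:
  assumes "vectorspace K V" "vectorspace K W" "tensor_eq K V W s t"
  shows "set s \<subseteq> carrier V \<times> carrier W \<and> set t \<subseteq> carrier V \<times> carrier W"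
  using assms(3,1,2) by induction auto

text \<open>The comultiplication of the dual is described inside the tensor square of the dual as an
  algebra, whereas it is used inside the tensor square of the dual as a Hopf algebra. The two records
  share their linear structure, and the congruence depends on nothing else.\<close>

lemma tensor_eq_cong:
  assumes "tensor_eq K V W s t"
    and [simp]: "carrier V' = carrier V" "zero V' = zero V" "add V' = add V" "smult V' = smult V"
      "carrier W' = carrier W" "add W' = add W" "smult W' = smult W"
  shows "tensor_eq K V' W' s t"
  using assms(1)
proof induction
  case (refl s)
  then show ?case by (simp add: tensor_eq.refl)
next
  case (commute s t)
  then show ?case by (simp add: tensor_eq.commute)
next
  case (zero w)
  then show ?case using tensor_eq.zero[of w W' K V'] by simp
next
  case (add_left v v' w)
  then show ?case using tensor_eq.add_left[of v V' v' w W' K] by simp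
next
  case (add_right v w w')
  then show ?case using tensor_eq.add_right[of v V' w W' w' K] by simp
next
  case (smult a v w)
  then show ?case using tensor_eq.smult[of a K v V' w W'] by simp
qed (auto intro: tensor_eq.intros)

lemma tensor_class_eq_iff:
  assumes "set s \<subseteq> carrier V \<times> carrier W"
  shows "tensor_class K V W s = tensor_class K V W t \<longleftrightarrow> tensor_eq K V W s t"
proof
  assume "tensor_class K V W s = tensor_class K V W t"
  then have "tensor_eq K V W t s"
    using tensor_eq.refl[OF assms] by (auto simp: tensor_class_def)
  then show "tensor_eq K V W s t" by (rule tensor_eq.sym)
next
  assume "tensor_eq K V W s t"
  then show "tensor_class K V W s = tensor_class K V W t"
    by (auto simp: tensor_class_def intro: tensor_eq.sym tensor_eq.trans)
qed

lemma tensor_rep_eq: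
  assumes "set s \<subseteq> carrier V \<times> carrier W"
  shows "tensor_eq K V W s (tensor_rep (tensor_class K V W s))"
  using tensor_eq.refl[OF assms] by (auto simp: tensor_rep_def tensor_class_def intro: someI2)

lemma tensor_carrierE:
  assumes "t \<in> carrier (V \<boxtimes> W)"
  obtains s where "set s \<subseteq> carrier V \<times> carrier W" "t = tensor_class K V W s"
  using assms by (auto simp: tensor_def)

lemma tensor_rep_class:
  assumes "vectorspace K V" "vectorspace K W" "t \<in> carrier (V \<boxtimes> W)"
  shows "set (tensor_rep t) \<subseteq> carrier V \<times> carrier W" "tensor_class K V W (tensor_rep t) = t"
proof -
  obtain s where s: "set s \<subseteq> carrier V \<times> carrier W" "t = tensor_class K V W s"
    using assms(3) by (rule tensor_carrierE)
  note eq = tensor_rep_eq[OF s(1), folded s(2)]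
  show "set (tensor_rep t) \<subseteq> carrier V \<times> carrier W"
    using tensor_eq_carrier[OF assms(1,2) eq] by simp
  show "tensor_class K V W (tensor_rep t) = t"
    using s eq by (simp add: tensor_class_eq_iff[symmetric])
qed

lemma tensor_class_closed:
  "set s \<subseteq> carrier V \<times> carrier W \<Longrightarrow> tensor_class K V W s \<in> carrier (V \<boxtimes> W)"
  by (auto simp: tensor_def)

lemma tensor_elem_closed [simp]:
  "v \<in> carrier V \<Longrightarrow> w \<in> carrier W \<Longrightarrow> tensor_elem K V W v w \<in> carrier (V \<boxtimes> W)"
  by (simp add: tensor_elem_def tensor_class_closed)

lemma tensor_zero: "\<zero>\<^bsub>V \<boxtimes> W\<^esub> = tensor_class K V W []"
  by (simp add: tensor_def)

lemma tensor_class_append: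
  assumes "vectorspace K V" "vectorspace K W"
    and s: "set s \<subseteq> carrier V \<times> carrier W" and t: "set t \<subseteq> carrier V \<times> carrier W"
  shows "tensor_class K V W s \<oplus>\<^bsub>V \<boxtimes> W\<^esub> tensor_class K V W t = tensor_class K V W (s @ t)"
proof -
  have "tensor_eq K V W (s @ t)
      (tensor_rep (tensor_class K V W s) @ tensor_rep (tensor_class K V W t))"
    by (intro tensor_eq.append tensor_rep_eq s t)
  then show ?thesis
    using s t by (simp add: tensor_def tensor_class_eq_iff[symmetric])
qed

lemma tensor_class_Cons:
  assumes "vectorspace K V" "vectorspace K W" "v \<in> carrier V" "w \<in> carrier W"
    and "set s \<subseteq> carrier V \<times> carrier W"
  shows "tensor_class K V W ((v, w) # s) =
    tensor_elem K V W v w \<oplus>\<^bsub>V \<boxtimes> W\<^esub> tensor_class K V W s"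
  using assms by (simp add: tensor_elem_def tensor_class_append)

lemma tensor_abelian_monoid:
  assumes V: "vectorspace K V" and W: "vectorspace K W"
  shows "abelian_monoid (V \<boxtimes> W)"
proof (rule abelian_monoidI)
  fix x y z
  assume "x \<in> carrier (V \<boxtimes> W)" "y \<in> carrier (V \<boxtimes> W)" "z \<in> carrier (V \<boxtimes> W)"
  then obtain s t u where s: "set s \<subseteq> carrier V \<times> carrier W" "x = tensor_class K V W s"
    and t: "set t \<subseteq> carrier V \<times> carrier W" "y = tensor_class K V W t"
    and u: "set u \<subseteq> carrier V \<times> carrier W" "z = tensor_class K V W u"
    by (metis tensor_carrierE)
  then show "x \<oplus>\<^bsub>V \<boxtimes> W\<^esub> y \<oplus>\<^bsub>V \<boxtimes> W\<^esub> z = x \<oplus>\<^bsub>V \<boxtimes> W\<^esub> (y \<oplus>\<^bsub>V \<boxtimes> W\<^esub> z)"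
    by (simp add: tensor_class_append[OF V W])
next
  fix x y assume "x \<in> carrier (V \<boxtimes> W)" "y \<in> carrier (V \<boxtimes> W)"
  then obtain s t where s: "set s \<subseteq> carrier V \<times> carrier W" "x = tensor_class K V W s"
    and t: "set t \<subseteq> carrier V \<times> carrier W" "y = tensor_class K V W t"
    by (metis tensor_carrierE)
  then show "x \<oplus>\<^bsub>V \<boxtimes> W\<^esub> y = y \<oplus>\<^bsub>V \<boxtimes> W\<^esub> x"
    by (simp add: tensor_class_append[OF V W] tensor_class_eq_iff tensor_eq.commute)
  from s t show "x \<oplus>\<^bsub>V \<boxtimes> W\<^esub> y \<in> carrier (V \<boxtimes> W)"
    by (simp add: tensor_class_append[OF V W] tensor_class_closed)
next
  fix x assume "x \<in> carrier (V \<boxtimes> W)"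
  then obtain s where s: "set s \<subseteq> carrier V \<times> carrier W" "x = tensor_class K V W s"
    by (metis tensor_carrierE)
  then show "\<zero>\<^bsub>V \<boxtimes> W\<^esub> \<oplus>\<^bsub>V \<boxtimes> W\<^esub> x = x"
    by (simp add: tensor_class_append[OF V W] tensor_zero)
qed (auto simp: tensor_zero intro: tensor_class_closed)

text \<open>A formal sum is built from elementary tensors by concatenation, which is the addition of the
  tensor product.\<close>

lemma tensor_induct [consumes 3, case_names zero elem add]:
  assumes V: "vectorspace K V" and W: "vectorspace K W" and t: "t \<in> carrier (V \<boxtimes> W)"
    and zero: "P \<zero>\<^bsub>V \<boxtimes> W\<^esub>"
    and elem: "\<And>v w. v \<in> carrier V \<Longrightarrow> w \<in> carrier W \<Longrightarrow> P (tensor_elem K V W v w)"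
    and add: "\<And>s t. s \<in> carrier (V \<boxtimes> W) \<Longrightarrow> t \<in> carrier (V \<boxtimes> W) \<Longrightarrow> P s \<Longrightarrow> P t \<Longrightarrow>
      P (s \<oplus>\<^bsub>V \<boxtimes> W\<^esub> t)"
  shows "P t"
proof -
  obtain s where s: "set s \<subseteq> carrier V \<times> carrier W" "t = tensor_class K V W s"
    using t by (rule tensor_carrierE)
  from s(1) have "P (tensor_class K V W s)"
  proof (induction s)
    case Nil
    then show ?case using zero by (simp add: tensor_zero)
  next
    case (Cons p s)
    obtain v w where p: "p = (v, w)" by (cases p)
    with Cons show ?case
      by (auto simp: tensor_class_Cons[OF V W] intro!: add elem tensor_class_closed)
  qed
  with s(2) show ?thesis by simp
qed

lemma tensor_elem_add_left:
  assumes "vectorspace K V" "vectorspace K W"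
    and "v \<in> carrier V" "v' \<in> carrier V" "w \<in> carrier W"
  shows "tensor_elem K V W (v \<oplus>\<^bsub>V\<^esub> v') w = tensor_elem K V W v w \<oplus>\<^bsub>V \<boxtimes> W\<^esub> tensor_elem K V W v' w"
  using assms
  by (simp add: tensor_elem_def tensor_class_append tensor_class_eq_iff tensor_eq.add_left)

lemma tensor_elem_add_right:
  assumes "vectorspace K V" "vectorspace K W"
    and "v \<in> carrier V" "w \<in> carrier W" "w' \<in> carrier W"
  shows "tensor_elem K V W v (w \<oplus>\<^bsub>W\<^esub> w') = tensor_elem K V W v w \<oplus>\<^bsub>V \<boxtimes> W\<^esub> tensor_elem K V W v w'"
  using assms
  by (simp add: tensor_elem_def tensor_class_append tensor_class_eq_iff tensor_eq.add_right)

lemma tensor_elem_smult_right: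
  assumes "vectorspace K V" "vectorspace K W"
    and "a \<in> carrier K" "v \<in> carrier V" "w \<in> carrier W"
  shows "tensor_elem K V W v (a \<odot>\<^bsub>W\<^esub> w) = tensor_elem K V W (a \<odot>\<^bsub>V\<^esub> v) w"
  using assms
  by (simp add: tensor_elem_def tensor_class_eq_iff tensor_eq.smult[THEN tensor_eq.sym])

lemma tensor_elem_zero_left:
  assumes "vectorspace K V" "w \<in> carrier W"
  shows "tensor_elem K V W \<zero>\<^bsub>V\<^esub> w = \<zero>\<^bsub>V \<boxtimes> W\<^esub>"
  using assms
  by (simp add: tensor_elem_def tensor_zero tensor_class_eq_iff tensor_eq.zero)

text \<open>Scaling all left entries of a formal sum respects every generating relation of the
  congruence; hence the scalar multiplication can be computed on any representative, not only on
  the chosen one.\<close>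

lemma tensor_smult_class:
  assumes V: "vectorspace K V" and W: "vectorspace K W" and a: "a \<in> carrier K"
    and s: "set s \<subseteq> carrier V \<times> carrier W"
  shows "a \<odot>\<^bsub>V \<boxtimes> W\<^esub> tensor_class K V W s = tensor_class K V W (map (\<lambda>(v, w). (a \<odot>\<^bsub>V\<^esub> v, w)) s)"
proof -
  let ?g = "\<lambda>(v, w). (a \<odot>\<^bsub>V\<^esub> v, w)"
  interpret module K V using V by (rule vs_module)
  have "tensor_eq K V W (map ?g s) (map ?g t)" if "tensor_eq K V W s t" for s t
    using that
  proof induction
    case (smult b v w)
    have "a \<odot>\<^bsub>V\<^esub> (b \<odot>\<^bsub>V\<^esub> v) = b \<odot>\<^bsub>V\<^esub> (a \<odot>\<^bsub>V\<^esub> v)"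
      using smult a by (simp add: smult_assoc1[symmetric] m_comm)
    then show ?case using smult a V W by (simp add: tensor_eq.smult)
  next
    case (zero w)
    then show ?case using a V by (simp add: tensor_eq.zero)
  next
    case (add_left v v' w)
    then show ?case using a V by (simp add: smult_r_distr tensor_eq.add_left)
  next
    case (refl s)
    then show ?case using a V by (intro tensor_eq.refl) auto
  next
    case (commute s t)
    have "tensor_eq K V W (map ?g s @ map ?g t) (map ?g t @ map ?g s)"
      using commute a V by (intro tensor_eq.commute) auto
    then show ?case by simp
  qed (auto intro: tensor_eq.intros simp: a V)
  then have "tensor_eq K V W (map ?g s) (map ?g (tensor_rep (tensor_class K V W s)))"
    using tensor_rep_eq[OF s] .
  moreover have "set (map ?g s) \<subseteq> carrier V \<times> carrier W"
    using s a V by auto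
  ultimately have "tensor_class K V W (map ?g s) =
      tensor_class K V W (map ?g (tensor_rep (tensor_class K V W s)))"
    by (simp only: tensor_class_eq_iff)
  then show ?thesis by (simp add: tensor_def)
qed

lemma tensor_smult_elem:
  assumes "vectorspace K V" "vectorspace K W" "a \<in> carrier K" "v \<in> carrier V" "w \<in> carrier W"
  shows "a \<odot>\<^bsub>V \<boxtimes> W\<^esub> tensor_elem K V W v w = tensor_elem K V W (a \<odot>\<^bsub>V\<^esub> v) w"
  using assms by (simp add: tensor_elem_def tensor_smult_class)

lemma tensor_smult_add:
  assumes V: "vectorspace K V" and W: "vectorspace K W" and a: "a \<in> carrier K"
    and "x \<in> carrier (V \<boxtimes> W)" "y \<in> carrier (V \<boxtimes> W)"
  shows "a \<odot>\<^bsub>V \<boxtimes> W\<^esub> (x \<oplus>\<^bsub>V \<boxtimes> W\<^esub> y) = a \<odot>\<^bsub>V \<boxtimes> W\<^esub> x \<oplus>\<^bsub>V \<boxtimes> W\<^esub> a \<odot>\<^bsub>V \<boxtimes> W\<^esub> y"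
proof -
  obtain s t where s: "set s \<subseteq> carrier V \<times> carrier W" "x = tensor_class K V W s"
    and t: "set t \<subseteq> carrier V \<times> carrier W" "y = tensor_class K V W t"
    using assms(4,5) by (metis tensor_carrierE)
  have "set (map (\<lambda>(v, w). (a \<odot>\<^bsub>V\<^esub> v, w)) s) \<subseteq> carrier V \<times> carrier W"
    "set (map (\<lambda>(v, w). (a \<odot>\<^bsub>V\<^esub> v, w)) t) \<subseteq> carrier V \<times> carrier W"
    using s t a V by auto
  with s t a V W show ?thesis
    by (simp add: tensor_class_append tensor_smult_class del: set_map)
qed

lemma tensor_smult_zero:
  assumes "vectorspace K V" "vectorspace K W" "a \<in> carrier K"
  shows "a \<odot>\<^bsub>V \<boxtimes> W\<^esub> \<zero>\<^bsub>V \<boxtimes> W\<^esub> = \<zero>\<^bsub>V \<boxtimes> W\<^esub>"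
  using tensor_smult_class[OF assms, of "[]"] by (simp add: tensor_zero)

lemma tensor_smult_closed:
  assumes "vectorspace K V" "vectorspace K W" "a \<in> carrier K" "t \<in> carrier (V \<boxtimes> W)"
  shows "a \<odot>\<^bsub>V \<boxtimes> W\<^esub> t \<in> carrier (V \<boxtimes> W)"
proof -
  obtain s where s: "set s \<subseteq> carrier V \<times> carrier W" "t = tensor_class K V W s"
    using assms(4) by (rule tensor_carrierE)
  have "set (map (\<lambda>(v, w). (a \<odot>\<^bsub>V\<^esub> v, w)) s) \<subseteq> carrier V \<times> carrier W"
    using s assms by auto
  with s assms show ?thesis
    by (simp add: tensor_class_closed tensor_smult_class del: set_map)
qed

text \<open>The laws of the scalar multiplication are additive in the tensor, so they need checking on
  elementary tensors only; a negative exists for \<open>v \<otimes> w\<close>, namely \<open>(-v) \<otimes> w\<close>, hence for all sums.\<close>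

lemma tensor_vectorspace [simp]:
  assumes V: "vectorspace K V" and W: "vectorspace K W"
  shows "vectorspace K (V \<boxtimes> W)"
proof -
  let ?T = "V \<boxtimes> W"
  interpret V: module K V using V by (rule vs_module)
  interpret T: abelian_monoid ?T using V W by (rule tensor_abelian_monoid)
  note sm = tensor_smult_add[OF V W] tensor_smult_zero[OF V W] tensor_smult_elem[OF V W]
    tensor_smult_closed[OF V W]
  have "\<exists>y\<in>carrier ?T. y \<oplus>\<^bsub>?T\<^esub> x = \<zero>\<^bsub>?T\<^esub>" if "x \<in> carrier ?T" for x
    using V W that
  proof (induction rule: tensor_induct)
    case zero
    show ?case by (rule bexI[of _ "\<zero>\<^bsub>?T\<^esub>"]) auto
  next
    case (elem v w)
    have "tensor_elem K V W (\<ominus>\<^bsub>V\<^esub> v) w \<oplus>\<^bsub>?T\<^esub> tensor_elem K V W v w =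
        tensor_elem K V W (\<ominus>\<^bsub>V\<^esub> v \<oplus>\<^bsub>V\<^esub> v) w"
      using elem by (simp add: tensor_elem_add_left[OF V W])
    also have "\<dots> = \<zero>\<^bsub>?T\<^esub>"
      using elem by (simp add: V.M.l_neg tensor_elem_zero_left[OF V])
    finally show ?case
      using elem by (intro bexI[of _ "tensor_elem K V W (\<ominus>\<^bsub>V\<^esub> v) w"]) auto
  next
    case (add s t)
    then obtain s' t' where st: "s' \<in> carrier ?T" "t' \<in> carrier ?T"
      "s' \<oplus>\<^bsub>?T\<^esub> s = \<zero>\<^bsub>?T\<^esub>" "t' \<oplus>\<^bsub>?T\<^esub> t = \<zero>\<^bsub>?T\<^esub>" by blast
    have "(s' \<oplus>\<^bsub>?T\<^esub> t') \<oplus>\<^bsub>?T\<^esub> (s \<oplus>\<^bsub>?T\<^esub> t) = (s' \<oplus>\<^bsub>?T\<^esub> s) \<oplus>\<^bsub>?T\<^esub> (t' \<oplus>\<^bsub>?T\<^esub> t)"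
      using st(1,2) add(1,2) by (simp add: T.a_ac)
    then show ?case
      using st by (intro bexI[of _ "s' \<oplus>\<^bsub>?T\<^esub> t'"]) auto
  qed
  then have "abelian_group ?T"
    by (intro abelian_groupI) (auto simp: T.a_ac)
  moreover have "(a \<oplus>\<^bsub>K\<^esub> b) \<odot>\<^bsub>?T\<^esub> x = a \<odot>\<^bsub>?T\<^esub> x \<oplus>\<^bsub>?T\<^esub> b \<odot>\<^bsub>?T\<^esub> x"
    if "a \<in> carrier K" "b \<in> carrier K" "x \<in> carrier ?T" for a b x
    using V W that(3)
  proof (induction rule: tensor_induct)
    case (elem v w)
    with that show ?case
      by (simp add: sm V.smult_l_distr tensor_elem_add_left[OF V W] V)
  next
    case (add s t)
    with that show ?case by (simp add: sm T.a_ac)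
  qed (simp_all add: sm that)
  moreover have "(a \<otimes>\<^bsub>K\<^esub> b) \<odot>\<^bsub>?T\<^esub> x = a \<odot>\<^bsub>?T\<^esub> (b \<odot>\<^bsub>?T\<^esub> x)"
    if "a \<in> carrier K" "b \<in> carrier K" "x \<in> carrier ?T" for a b x
    using V W that(3)
    by (induction rule: tensor_induct) (simp_all add: sm that V.smult_assoc1)
  moreover have "\<one>\<^bsub>K\<^esub> \<odot>\<^bsub>?T\<^esub> x = x" if "x \<in> carrier ?T" for x
    using V W that by (induction rule: tensor_induct) (simp_all add: sm)
  ultimately have "module K ?T"
    by (intro moduleI) (auto simp: sm is_cring)
  then show ?thesis by (rule vectorspace_of_module)
qed

lemma bilinear_tensor_elem:
  assumes V: "vectorspace K V" and W: "vectorspace K W"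
  shows "bilinear K V W (V \<boxtimes> W) (tensor_elem K V W)"
  by (intro bilinearI homI) (simp_all add: assms tensor_elem_add_left tensor_elem_add_right
      tensor_elem_smult_right tensor_smult_elem)

subsection \<open>The universal property\<close>

text \<open>Every bilinear map satisfies the generating relations of the congruence, so summing the values of a bilinear map is constant on congruence classes.\<close>

lemma foldr_tensor_eq:
  assumes V: "vectorspace K V" and W: "vectorspace K W" and Z: "vectorspace K Z"
    and f: "bilinear K V W Z f" and eq: "tensor_eq K V W s t"
  shows "foldr (\<lambda>(v, w) z. f v w \<oplus>\<^bsub>Z\<^esub> z) s \<zero>\<^bsub>Z\<^esub> = foldr (\<lambda>(v, w) z. f v w \<oplus>\<^bsub>Z\<^esub> z) t \<zero>\<^bsub>Z\<^esub>"
    (is "?S s = ?S t")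
proof -
  interpret Z: abelian_monoid Z using Z by (rule vs_monoid)
  have cl: "?S s \<in> carrier Z" if "set s \<subseteq> carrier V \<times> carrier W" for s
    using that by (induction s) (auto simp: bilinear_closed[OF f])
  have app: "?S (s @ t) = ?S s \<oplus>\<^bsub>Z\<^esub> ?S t"
    if "set s \<subseteq> carrier V \<times> carrier W" "set t \<subseteq> carrier V \<times> carrier W" for s t
    using that
  proof (induction s)
    case (Cons p s)
    then show ?case
      using cl by (cases p) (auto simp: bilinear_closed[OF f] Z.a_assoc)
  qed (simp add: cl)
  note fc = bilinear_closed[OF f]
  note l = bilinearD(2)[OF f] and r = bilinearD(1)[OF f]
  from eq show ?thesis
  proof induction
    case (append s t s' t')
    then show ?case using tensor_eq_carrier[OF V W] by (simp add: app del: foldr_append)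
  next
    case (commute s t)
    then show ?case by (simp add: app cl Z.a_comm del: foldr_append)
  next
    case (zero w)
    then show ?case using hom_zero[OF V Z l[OF zero]] by simp
  next
    case (add_left v v' w)
    then show ?case using hom_add[OF l[OF add_left(3)] add_left(1,2)] by (simp add: fc Z.a_assoc V)
  next
    case (add_right v w w')
    then show ?case using hom_add[OF r[OF add_right(1)] add_right(2,3)] by (simp add: fc Z.a_assoc W)
  next
    case (smult a v w)
    then show ?case
      using hom_smult[OF r[OF smult(2)] smult(1,3)] hom_smult[OF l[OF smult(3)] smult(1,2)] by simp
  qed auto
qed

lemma tensor_lift_class:
  assumes "vectorspace K V" "vectorspace K W" "vectorspace K Z"
    and "bilinear K V W Z f" "set s \<subseteq> carrier V \<times> carrier W"
  shows "tensor_lift Z f (tensor_class K V W s) = foldr (\<lambda>(v, w) z. f v w \<oplus>\<^bsub>Z\<^esub> z) s \<zero>\<^bsub>Z\<^esub>"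
  unfolding tensor_lift_def
  by (rule foldr_tensor_eq[OF assms(1-4), symmetric]) (rule tensor_rep_eq[OF assms(5)])

lemma tensor_lift_elem:
  assumes "vectorspace K V" "vectorspace K W" "vectorspace K Z"
    and "bilinear K V W Z f" "v \<in> carrier V" "w \<in> carrier W"
  shows "tensor_lift Z f (tensor_elem K V W v w) = f v w"
  using assms bilinear_closed[OF assms(4,5,6)] by (simp add: tensor_elem_def tensor_lift_class)

lemma tensor_lift_hom:
  assumes V: "vectorspace K V" and W: "vectorspace K W" and Z: "vectorspace K Z"
    and f: "bilinear K V W Z f"
  shows "tensor_lift Z f \<in> Hom (V \<boxtimes> W) Z"
proof -
  interpret Z: abelian_monoid Z using Z by (rule vs_monoid)
  interpret ZM: module K Z using Z by (rule vs_module)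
  let ?L = "tensor_lift Z f"
  have lift_Cons: "?L (tensor_class K V W ((v, w) # s)) = f v w \<oplus>\<^bsub>Z\<^esub> ?L (tensor_class K V W s)"
    if "v \<in> carrier V" "w \<in> carrier W" "set s \<subseteq> carrier V \<times> carrier W" for v w s
    using that by (simp add: tensor_lift_class[OF V W Z f])
  have zero: "?L \<zero>\<^bsub>V \<boxtimes> W\<^esub> = \<zero>\<^bsub>Z\<^esub>"
    by (simp add: tensor_zero tensor_lift_class[OF V W Z f])
  have cl: "?L t \<in> carrier Z" if t: "t \<in> carrier (V \<boxtimes> W)" for t
  proof -
    obtain s where s: "set s \<subseteq> carrier V \<times> carrier W" "t = tensor_class K V W s"
      using t by (rule tensor_carrierE)
    from s(1) have "?L (tensor_class K V W s) \<in> carrier Z"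
      by (induction s) (auto simp: lift_Cons bilinear_closed[OF f] zero[unfolded tensor_zero])
    with s show ?thesis by simp
  qed
  have lift_add: "?L (x \<oplus>\<^bsub>V \<boxtimes> W\<^esub> y) = ?L x \<oplus>\<^bsub>Z\<^esub> ?L y"
    if x: "x \<in> carrier (V \<boxtimes> W)" and y: "y \<in> carrier (V \<boxtimes> W)" for x y
  proof -
    obtain s t where s: "set s \<subseteq> carrier V \<times> carrier W" "x = tensor_class K V W s"
      and t: "set t \<subseteq> carrier V \<times> carrier W" "y = tensor_class K V W t"
      using x y by (metis tensor_carrierE)
    from s(1) have "?L (tensor_class K V W s \<oplus>\<^bsub>V \<boxtimes> W\<^esub> y) = ?L (tensor_class K V W s) \<oplus>\<^bsub>Z\<^esub> ?L y"
    proof (induction s)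
      case Nil
      then show ?case using y cl[OF y] zero V W by (simp add: tensor_zero[symmetric])
    next
      case (Cons p s)
      obtain v w where p: "p = (v, w)" by (cases p)
      with Cons.prems have vw: "v \<in> carrier V" "w \<in> carrier W" "set s \<subseteq> carrier V \<times> carrier W" by auto
      have "tensor_class K V W (p # s) \<oplus>\<^bsub>V \<boxtimes> W\<^esub> y = tensor_class K V W ((v, w) # (s @ t))"
        using vw t by (simp add: p tensor_class_append[OF V W])
      then have "?L (tensor_class K V W (p # s) \<oplus>\<^bsub>V \<boxtimes> W\<^esub> y) =
          f v w \<oplus>\<^bsub>Z\<^esub> ?L (tensor_class K V W s \<oplus>\<^bsub>V \<boxtimes> W\<^esub> y)"
        using vw t by (simp add: lift_Cons tensor_class_append[OF V W])
      then show ?case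
        using vw Cons.IH
        by (simp add: p lift_Cons Z.a_assoc bilinear_closed[OF f] cl y tensor_class_closed)
    qed
    then show ?thesis using s by simp
  qed
  note smz = tensor_smult_add[OF V W] tensor_smult_zero[OF V W] tensor_smult_elem[OF V W]
    tensor_lift_elem[OF V W Z f]
  show ?thesis
  proof (rule homI)
    fix a t assume a: "a \<in> carrier K" and t: "t \<in> carrier (V \<boxtimes> W)"
    show "?L (a \<odot>\<^bsub>V \<boxtimes> W\<^esub> t) = a \<odot>\<^bsub>Z\<^esub> ?L t"
      using V W t
    proof (induction rule: tensor_induct)
      case (elem v w)
      then show ?case
        using a hom_smult[OF bilinearD(2)[OF f elem(2)] a elem(1)] by (simp add: smz V)
    next
      case (add s t)
      then show ?case using a by (simp add: smz lift_add cl ZM.smult_r_distr tensor_smult_closed[OF V W])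
    qed (use a in \<open>simp add: smz zero\<close>)
  qed (auto simp: lift_add cl)
qed

text \<open>Elementary tensors generate the tensor product additively. Most identities below are proved
  by this lemma, applied to the two sides as functions of one tensor at a time.\<close>

lemma tensor_hom_ext:
  assumes "vectorspace K V" "vectorspace K W" "vectorspace K Z"
    and f: "f \<in> Hom (V \<boxtimes> W) Z" and g: "g \<in> Hom (V \<boxtimes> W) Z" and t: "t \<in> carrier (V \<boxtimes> W)"
    and eq: "\<And>v w. v \<in> carrier V \<Longrightarrow> w \<in> carrier W \<Longrightarrow>
      f (tensor_elem K V W v w) = g (tensor_elem K V W v w)"
  shows "f t = g t"
  using assms(1,2) t
proof (induction rule: tensor_induct)
  case zero
  then show ?case using assms by (simp add: hom_zero[OF tensor_vectorspace])
next
  case (add s t)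
  then show ?case using f g by (simp add: hom_add)
qed (rule eq)

subsection \<open>Rules for multilinear expressions\<close>

abbreviation KK :: "('k, 'k) module" where "KK \<equiv> base_algebra K"

lemma base_algebra_simps [simp]:
  "carrier KK = carrier K" "mult KK = mult K" "one KK = one K" "zero KK = zero K"
  "add KK = add K" "smult KK = mult K"
  by (simp_all add: base_algebra_def)

lemma unital_algebra_base [simp]: "unital_algebra K KK"
proof -
  have "ring KK"
    by (intro ringI abelian_groupI monoidI)
      (auto simp: a_ac m_assoc l_distr r_distr intro: l_neg)
  moreover have "module K KK"
    using calculation
    by (intro moduleI) (auto simp: l_distr r_distr m_assoc is_cring ring_def)
  ultimately show ?thesis
    by (intro unital_algebra.intro vectorspace_of_module unital_algebra_axioms.intro)
      (auto simp: m_ac)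
qed

lemma unital_algebra_vectorspace [simp]: "unital_algebra K A \<Longrightarrow> vectorspace K A"
  by (simp add: unital_algebra_def)

lemma unital_algebra_ring: "unital_algebra K A \<Longrightarrow> ring A"
  by (simp add: unital_algebra_def)

lemma vectorspace_base [simp]: "vectorspace K KK"
  by simp

lemma smult_smult:
  assumes "vectorspace K V" "a \<in> carrier K" "b \<in> carrier K" "v \<in> carrier V"
  shows "a \<odot>\<^bsub>V\<^esub> (b \<odot>\<^bsub>V\<^esub> v) = (a \<otimes>\<^bsub>K\<^esub> b) \<odot>\<^bsub>V\<^esub> v"
  using module.smult_assoc1[OF vs_module[OF assms(1)] assms(2-4)] by simp

lemma hom_scale:
  assumes W: "vectorspace K W" and f: "f \<in> Hom V W" and a: "a \<in> carrier K"
  shows "(\<lambda>v. a \<odot>\<^bsub>W\<^esub> f v) \<in> Hom V W"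
proof -
  interpret module K W using W by (rule vs_module)
  show ?thesis
    using a by (intro homI) (simp_all add: hom_closed[OF f] hom_add[OF f] hom_smult[OF f]
      smult_r_distr smult_assoc1[symmetric] m_comm)
qed

lemma bilinear_hom_left:
  "bilinear K V W Z f \<Longrightarrow> g \<in> Hom U V \<Longrightarrow> w \<in> carrier W \<Longrightarrow> (\<lambda>u. f (g u) w) \<in> Hom U Z"
  by (rule hom_comp[OF _ bilinearD(2)])

lemma bilinear_hom_right:
  "bilinear K V W Z f \<Longrightarrow> g \<in> Hom U W \<Longrightarrow> v \<in> carrier V \<Longrightarrow> (\<lambda>u. f v (g u)) \<in> Hom U Z"
  by (rule hom_comp[OF _ bilinearD(1)])

lemma bilinear_comp:
  assumes f: "bilinear K V W Z f" and g: "g \<in> Hom A V" and k: "k \<in> Hom B W"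
  shows "bilinear K A B Z (\<lambda>a b. f (g a) (k b))"
  by (rule bilinearI)
    (rule bilinear_hom_right[OF f k hom_closed[OF g]] bilinear_hom_left[OF f g hom_closed[OF k]];
      assumption)+

lemma bilinear_swap: "bilinear K V W Z f \<Longrightarrow> bilinear K W V Z (\<lambda>w v. f v w)"
  by (simp add: bilinear_def)

lemma bilinear_hom:
  assumes f: "bilinear K V W Z f" and g: "g \<in> Hom Z Z'"
  shows "bilinear K V W Z' (\<lambda>v w. g (f v w))"
  using hom_comp[OF bilinearD(1)[OF f] g] hom_comp[OF bilinearD(2)[OF f] g]
  by (simp add: bilinear_def)

lemma bilinear_smult:
  assumes "vectorspace K V"
  shows "bilinear K KK V V (smult V)"
proof -
  interpret module K V using assms by (rule vs_module)
  show ?thesis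
    by (intro bilinearI homI)
      (auto simp: smult_l_distr smult_r_distr smult_assoc1[symmetric] m_comm)
qed

lemma bilinear_mult:
  assumes "unital_algebra K A"
  shows "bilinear K A A A (mult A)"
proof -
  interpret unital_algebra K A by fact
  show ?thesis
    by (intro bilinearI homI)
      (auto simp: A_ring.l_distr A_ring.r_distr smult_mult_left smult_mult_right)
qed

lemma hom_lift_arg:
  assumes "vectorspace K V" "vectorspace K W" "vectorspace K Z"
    and "bilinear K V W Z f" "g \<in> Hom U (V \<boxtimes> W)"
  shows "(\<lambda>u. tensor_lift Z f (g u)) \<in> Hom U Z"
  by (rule hom_comp[OF assms(5) tensor_lift_hom[OF assms(1-4)]])

text \<open>Varying the bilinear map instead of the tensor: each value is a finite sum of values
  \<open>f u v w\<close>, all of which are linear in \<open>u\<close>.\<close>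

lemma hom_lift_param:
  assumes V: "vectorspace K V" and W: "vectorspace K W" and Z: "vectorspace K Z"
    and U: "vectorspace K U" and t: "t \<in> carrier (V \<boxtimes> W)"
    and b: "\<And>u. u \<in> carrier U \<Longrightarrow> bilinear K V W Z (f u)"
    and h: "\<And>v w. v \<in> carrier V \<Longrightarrow> w \<in> carrier W \<Longrightarrow> (\<lambda>u. f u v w) \<in> Hom U Z"
  shows "(\<lambda>u. tensor_lift Z (f u) t) \<in> Hom U Z"
proof (rule homI)
  note l = tensor_lift_hom[OF V W Z b] and le = tensor_lift_elem[OF V W Z b]
  show "tensor_lift Z (f u) t \<in> carrier Z" if "u \<in> carrier U" for u
    using t by (rule hom_closed[OF l[OF that]])
  show "tensor_lift Z (f (u \<oplus>\<^bsub>U\<^esub> u')) t = tensor_lift Z (f u) t \<oplus>\<^bsub>Z\<^esub> tensor_lift Z (f u') t"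
    if u: "u \<in> carrier U" "u' \<in> carrier U" for u u'
    by (rule tensor_hom_ext[OF V W Z l hom_plus[OF tensor_vectorspace[OF V W] Z l[OF u(1)] l[OF u(2)]] t])
      (simp_all add: u U le hom_add[OF h])
  show "tensor_lift Z (f (a \<odot>\<^bsub>U\<^esub> u)) t = a \<odot>\<^bsub>Z\<^esub> tensor_lift Z (f u) t"
    if u: "a \<in> carrier K" "u \<in> carrier U" for a u
    by (rule tensor_hom_ext[OF V W Z l hom_scale[OF Z l[OF u(2)] u(1)] t])
      (simp_all add: u U le hom_smult[OF h])
qed

lemma hom_tensor_lift:
  assumes V: "vectorspace K V" and W: "vectorspace K W" and Z: "vectorspace K Z"
    and Z': "vectorspace K Z'" and f: "bilinear K V W Z f" and g: "g \<in> Hom Z Z'"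
    and t: "t \<in> carrier (V \<boxtimes> W)"
  shows "g (tensor_lift Z f t) = tensor_lift Z' (\<lambda>v w. g (f v w)) t"
proof -
  note gf = bilinear_hom[OF f g]
  show ?thesis
    using hom_comp[OF tensor_lift_hom[OF V W Z f] g] tensor_lift_hom[OF V W Z' gf] t
    by (rule tensor_hom_ext[OF V W Z'])
      (simp add: tensor_lift_elem[OF V W Z f] tensor_lift_elem[OF V W Z' gf])
qed

lemma tensor_lift_cong:
  assumes V: "vectorspace K V" and W: "vectorspace K W" and t: "t \<in> carrier (V \<boxtimes> W)"
    and eq: "\<And>v w. v \<in> carrier V \<Longrightarrow> w \<in> carrier W \<Longrightarrow> f v w = g v w"
  shows "tensor_lift Z f t = tensor_lift Z g t"
  unfolding tensor_lift_def
  by (rule foldr_cong) (use tensor_rep_class(1)[OF V W t] eq in auto)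

lemma tensor_map_hom:
  assumes "vectorspace K A" "vectorspace K B" "vectorspace K V" "vectorspace K W"
    and "g \<in> Hom A V" "k \<in> Hom B W"
  shows "tensor_map K V W g k \<in> Hom (A \<boxtimes> B) (V \<boxtimes> W)"
  unfolding tensor_map_def
  by (intro tensor_lift_hom bilinear_comp[OF bilinear_tensor_elem] tensor_vectorspace assms)

lemma tensor_map_elem:
  assumes "vectorspace K A" "vectorspace K B" "vectorspace K V" "vectorspace K W"
    and "g \<in> Hom A V" "k \<in> Hom B W" "a \<in> carrier A" "b \<in> carrier B"
  shows "tensor_map K V W g k (tensor_elem K A B a b) = tensor_elem K V W (g a) (k b)"
  unfolding tensor_map_def
  by (intro tensor_lift_elem bilinear_comp[OF bilinear_tensor_elem] tensor_vectorspace assms)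

text \<open>Substituting \<open>g \<otimes> k\<close> into a Sweedler expression. Together with \<open>tensor_lift_assoc\<close> this turns the
  coassociativity axioms, stated with \<open>tensor_map\<close> and \<open>tensor_assoc\<close>, into equations between nested
  Sweedler expressions.\<close>

lemma tensor_lift_map:
  assumes A: "vectorspace K A" and B: "vectorspace K B" and V: "vectorspace K V"
    and W: "vectorspace K W" and Z: "vectorspace K Z"
    and g: "g \<in> Hom A V" and k: "k \<in> Hom B W" and f: "bilinear K V W Z f"
    and t: "t \<in> carrier (A \<boxtimes> B)"
  shows "tensor_lift Z f (tensor_map K V W g k t) = tensor_lift Z (\<lambda>a b. f (g a) (k b)) t"
proof -
  have "tensor_lift Z f (tensor_map K V W g k t) =
      tensor_lift Z (\<lambda>a b. tensor_lift Z f (tensor_elem K V W (g a) (k b))) t"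
    unfolding tensor_map_def
    by (rule hom_tensor_lift[OF A B tensor_vectorspace[OF V W] Z
          bilinear_comp[OF bilinear_tensor_elem[OF V W] g k] tensor_lift_hom[OF V W Z f] t])
  also have "\<dots> = tensor_lift Z (\<lambda>a b. f (g a) (k b)) t"
    by (rule tensor_lift_cong[OF A B t])
      (simp add: tensor_lift_elem[OF V W Z f] hom_closed[OF g] hom_closed[OF k])
  finally show ?thesis .
qed

subsection \<open>Associativity\<close>

definition trilinear ::
    "('k, 'u, 'l) module_scheme \<Rightarrow> ('k, 'v, 'm) module_scheme \<Rightarrow> ('k, 'w, 'n) module_scheme \<Rightarrow>
     ('k, 'z, 'p) module_scheme \<Rightarrow> ('u \<Rightarrow> 'v \<Rightarrow> 'w \<Rightarrow> 'z) \<Rightarrow> bool" where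
  "trilinear U V W Z f \<longleftrightarrow>
     (\<forall>u\<in>carrier U. bilinear K V W Z (f u)) \<and>
     (\<forall>v\<in>carrier V. \<forall>w\<in>carrier W. (\<lambda>u. f u v w) \<in> Hom U Z)"

lemma trilinearI:
  assumes "\<And>u v. u \<in> carrier U \<Longrightarrow> v \<in> carrier V \<Longrightarrow> (\<lambda>w. f u v w) \<in> Hom W Z"
    and "\<And>u w. u \<in> carrier U \<Longrightarrow> w \<in> carrier W \<Longrightarrow> (\<lambda>v. f u v w) \<in> Hom V Z"
    and "\<And>v w. v \<in> carrier V \<Longrightarrow> w \<in> carrier W \<Longrightarrow> (\<lambda>u. f u v w) \<in> Hom U Z"
  shows "trilinear U V W Z f"
  using assms by (simp add: trilinear_def bilinear_def)

lemma trilinearD: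
  assumes "trilinear U V W Z f"
  shows "u \<in> carrier U \<Longrightarrow> v \<in> carrier V \<Longrightarrow> (\<lambda>w. f u v w) \<in> Hom W Z"
    and "u \<in> carrier U \<Longrightarrow> w \<in> carrier W \<Longrightarrow> (\<lambda>v. f u v w) \<in> Hom V Z"
    and "v \<in> carrier V \<Longrightarrow> w \<in> carrier W \<Longrightarrow> (\<lambda>u. f u v w) \<in> Hom U Z"
    and "u \<in> carrier U \<Longrightarrow> bilinear K V W Z (f u)"
    and "w \<in> carrier W \<Longrightarrow> bilinear K U V Z (\<lambda>u v. f u v w)"
  using assms by (simp_all add: trilinear_def bilinear_def)

lemma trilinear_lift_right:
  assumes "vectorspace K U" "vectorspace K V" "vectorspace K W" "vectorspace K Z"
    and f: "trilinear U V W Z f"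
  shows "bilinear K U (V \<boxtimes> W) Z (\<lambda>u t. tensor_lift Z (f u) t)"
  by (rule bilinearI)
    (auto intro!: tensor_lift_hom hom_lift_param[OF assms(2-4,1)] trilinearD[OF f] assms(1-4))

lemma trilinear_lift_left:
  assumes "vectorspace K U" "vectorspace K V" "vectorspace K W" "vectorspace K Z"
    and f: "trilinear U V W Z f"
  shows "bilinear K (U \<boxtimes> V) W Z (\<lambda>t w. tensor_lift Z (\<lambda>u v. f u v w) t)"
  by (rule bilinearI)
    (auto intro!: tensor_lift_hom hom_lift_param[OF assms(1,2,4,3)] trilinearD[OF f] assms(1-4))

lemma tensor3_hom_ext_left:
  assumes U: "vectorspace K U" and V: "vectorspace K V" and W: "vectorspace K W"
    and Z: "vectorspace K Z"
    and f: "f \<in> Hom ((U \<boxtimes> V) \<boxtimes> W) Z" and g: "g \<in> Hom ((U \<boxtimes> V) \<boxtimes> W) Z"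
    and t: "t \<in> carrier ((U \<boxtimes> V) \<boxtimes> W)"
    and eq: "\<And>u v w. u \<in> carrier U \<Longrightarrow> v \<in> carrier V \<Longrightarrow> w \<in> carrier W \<Longrightarrow>
      f (tensor_elem K (U \<boxtimes> V) W (tensor_elem K U V u v) w) =
      g (tensor_elem K (U \<boxtimes> V) W (tensor_elem K U V u v) w)"
  shows "f t = g t"
proof (rule tensor_hom_ext[OF tensor_vectorspace[OF U V] W Z f g t])
  fix s w assume s: "s \<in> carrier (U \<boxtimes> V)" and w: "w \<in> carrier W"
  have b: "(\<lambda>s. tensor_elem K (U \<boxtimes> V) W s w) \<in> Hom (U \<boxtimes> V) ((U \<boxtimes> V) \<boxtimes> W)"
    using w by (intro bilinear_hom_left[OF bilinear_tensor_elem] hom_id tensor_vectorspace U V W)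
  show "f (tensor_elem K (U \<boxtimes> V) W s w) = g (tensor_elem K (U \<boxtimes> V) W s w)"
    by (rule tensor_hom_ext[OF U V Z hom_comp[OF b f] hom_comp[OF b g] s]) (rule eq[OF _ _ w])
qed

context
  fixes U :: "('k, 'u, 'l) module_scheme" and V :: "('k, 'v, 'm) module_scheme"
    and W :: "('k, 'w, 'n) module_scheme"
  assumes U: "vectorspace K U" and V: "vectorspace K V" and W: "vectorspace K W"
begin

lemma trilinear_tensor_elem:
  "trilinear U V W (U \<boxtimes> V \<boxtimes> W) (\<lambda>u v w. tensor_elem K U (V \<boxtimes> W) u (tensor_elem K V W v w))"
  by (intro trilinearI bilinear_hom_left[OF bilinear_tensor_elem] hom_id
      bilinear_hom_right[OF bilinear_tensor_elem] tensor_vectorspace tensor_elem_closed U V W)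

lemma tensor_assoc_hom: "tensor_assoc K U V W \<in> Hom ((U \<boxtimes> V) \<boxtimes> W) (U \<boxtimes> V \<boxtimes> W)"
  unfolding tensor_assoc_def Let_def
  by (intro tensor_lift_hom tensor_vectorspace U V W trilinear_lift_left trilinear_tensor_elem)

lemma tensor_assoc_elem:
  assumes "u \<in> carrier U" "v \<in> carrier V" "w \<in> carrier W"
  shows "tensor_assoc K U V W (tensor_elem K (U \<boxtimes> V) W (tensor_elem K U V u v) w) =
    tensor_elem K U (V \<boxtimes> W) u (tensor_elem K V W v w)"
proof -
  have UV: "vectorspace K (U \<boxtimes> V)" and UVW: "vectorspace K (U \<boxtimes> V \<boxtimes> W)"
    by (simp_all add: U V W)
  note t = trilinear_tensor_elem
  show ?thesis
    unfolding tensor_assoc_def Let_def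
    using assms tensor_lift_elem[OF UV W UVW trilinear_lift_left[OF U V W UVW t]]
    by (simp add: tensor_lift_elem[OF U V UVW trilinearD(5)[OF t]])
qed

lemma tensor_lift_assoc:
  assumes Z: "vectorspace K Z" and f: "trilinear U V W Z f"
    and s: "s \<in> carrier ((U \<boxtimes> V) \<boxtimes> W)"
  shows "tensor_lift Z (\<lambda>u t. tensor_lift Z (f u) t) (tensor_assoc K U V W s) =
    tensor_lift Z (\<lambda>t w. tensor_lift Z (\<lambda>u v. f u v w) t) s"
proof -
  note L = trilinear_lift_left[OF U V W Z f] and R = trilinear_lift_right[OF U V W Z f]
  note UV = tensor_vectorspace[OF U V] and VW = tensor_vectorspace[OF V W]
  show ?thesis
    by (rule tensor3_hom_ext_left[OF U V W Z hom_comp[OF tensor_assoc_hom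
        tensor_lift_hom[OF U VW Z R]] tensor_lift_hom[OF UV W Z L] s])
      (simp add: tensor_assoc_elem tensor_lift_elem[OF U VW Z R] tensor_lift_elem[OF UV W Z L]
        tensor_lift_elem[OF V W Z trilinearD(4)[OF f]]
        tensor_lift_elem[OF U V Z trilinearD(5)[OF f]])
qed

end

section \<open>Tensor products of algebras\<close>

lemma tensor_class_concat:
  assumes V: "vectorspace K V" and W: "vectorspace K W"
    and "\<And>p. p \<in> set s \<Longrightarrow> set (g p) \<subseteq> carrier V \<times> carrier W"
  shows "tensor_class K V W (concat (map g s)) =
    foldr (\<lambda>p z. tensor_class K V W (g p) \<oplus>\<^bsub>V \<boxtimes> W\<^esub> z) s \<zero>\<^bsub>V \<boxtimes> W\<^esub>"
  using assms(3)
proof (induction s)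
  case (Cons p s)
  have "set (concat (map g s)) \<subseteq> carrier V \<times> carrier W"
    using Cons.prems by auto
  then show ?case
    using Cons tensor_class_append[OF V W, of "g p" "concat (map g s)"] by simp
qed (simp add: tensor_zero)

context
  fixes A :: "('k, 'a, 'm) module_scheme" and B :: "('k, 'b, 'n) module_scheme"
  assumes A: "unital_algebra K A" and B: "unital_algebra K B"
begin

interpretation A: ring A using A by (rule unital_algebra_ring)
interpretation B: ring B using B by (rule unital_algebra_ring)

text \<open>The multiplication is defined by choosing representatives. Written as a nested lift it no
  longer refers to them, and bilinearity and the value on elementary tensors follow from the
  universal property.\<close>

lemma tensor_mult_eq_lift:
  assumes s: "s \<in> carrier (A \<boxtimes> B)" and t: "t \<in> carrier (A \<boxtimes> B)"
  shows "s \<otimes>\<^bsub>A \<boxtimes> B\<^esub> t = tensor_lift (A \<boxtimes> B) (\<lambda>a b. tensor_lift (A \<boxtimes> B)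
    (\<lambda>a' b'. tensor_elem K A B (a \<otimes>\<^bsub>A\<^esub> a') (b \<otimes>\<^bsub>B\<^esub> b')) t) s"
proof -
  note VA = unital_algebra_vectorspace[OF A] and VB = unital_algebra_vectorspace[OF B]
  note vs = VA VB
  note S = tensor_rep_class(1)[OF vs s] and T = tensor_rep_class(1)[OF vs t]
  have inner: "tensor_class K A B (concat (map (\<lambda>(a', b'). [(a \<otimes>\<^bsub>A\<^esub> a', b \<otimes>\<^bsub>B\<^esub> b')]) (tensor_rep t))) =
      tensor_lift (A \<boxtimes> B) (\<lambda>a' b'. tensor_elem K A B (a \<otimes>\<^bsub>A\<^esub> a') (b \<otimes>\<^bsub>B\<^esub> b')) t"
    if "a \<in> carrier A" "b \<in> carrier B" for a b
  proof (subst tensor_class_concat[OF vs])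
    show "set ((\<lambda>(a', b'). [(a \<otimes>\<^bsub>A\<^esub> a', b \<otimes>\<^bsub>B\<^esub> b')]) p) \<subseteq> carrier A \<times> carrier B"
      if "p \<in> set (tensor_rep t)" for p
      using that T \<open>a \<in> carrier A\<close> \<open>b \<in> carrier B\<close> by auto
  qed (simp add: tensor_lift_def tensor_elem_def case_prod_unfold)
  have "s \<otimes>\<^bsub>A \<boxtimes> B\<^esub> t = tensor_class K A B (concat (map (\<lambda>(a, b).
      concat (map (\<lambda>(a', b'). [(a \<otimes>\<^bsub>A\<^esub> a', b \<otimes>\<^bsub>B\<^esub> b')]) (tensor_rep t))) (tensor_rep s)))"
    by (simp add: tensor_def case_prod_unfold)
  also have "\<dots> = foldr (\<lambda>p z. tensor_class K A B (case p of (a, b) \<Rightarrow>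
      concat (map (\<lambda>(a', b'). [(a \<otimes>\<^bsub>A\<^esub> a', b \<otimes>\<^bsub>B\<^esub> b')]) (tensor_rep t))) \<oplus>\<^bsub>A \<boxtimes> B\<^esub> z)
      (tensor_rep s) \<zero>\<^bsub>A \<boxtimes> B\<^esub>"
    by (rule tensor_class_concat[OF vs]) (use S T in fastforce)
  also have "\<dots> = tensor_lift (A \<boxtimes> B) (\<lambda>a b. tensor_lift (A \<boxtimes> B)
    (\<lambda>a' b'. tensor_elem K A B (a \<otimes>\<^bsub>A\<^esub> a') (b \<otimes>\<^bsub>B\<^esub> b')) t) s"
    unfolding tensor_lift_def[of "A \<boxtimes> B" _ s]
    by (rule foldr_cong) (use S in \<open>auto simp: inner\<close>)
  finally show ?thesis .
qed

lemma bilinear_tensor_mult_elem: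
  assumes "a \<in> carrier A" "b \<in> carrier B"
  shows "bilinear K A B (A \<boxtimes> B) (\<lambda>a' b'. tensor_elem K A B (a \<otimes>\<^bsub>A\<^esub> a') (b \<otimes>\<^bsub>B\<^esub> b'))"
  using assms
  by (intro bilinear_comp[OF bilinear_tensor_elem] bilinearD(1)[OF bilinear_mult] unital_algebra_vectorspace A B)

lemma bilinear_tensor_mult: "bilinear K (A \<boxtimes> B) (A \<boxtimes> B) (A \<boxtimes> B) (mult (A \<boxtimes> B))"
proof -
  let ?T = "A \<boxtimes> B"
  let ?f = "\<lambda>a b a' b'. tensor_elem K A B (a \<otimes>\<^bsub>A\<^esub> a') (b \<otimes>\<^bsub>B\<^esub> b')"
  note vs = unital_algebra_vectorspace[OF A] unital_algebra_vectorspace[OF B]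
  note vst = tensor_vectorspace[OF vs]
  note m = bilinear_hom_left[OF bilinear_tensor_elem[OF vs]]
    bilinear_hom_right[OF bilinear_tensor_elem[OF vs]]
  have f1: "(\<lambda>a. ?f a b a' b') \<in> Hom A ?T" "(\<lambda>b. ?f a b a' b') \<in> Hom B ?T"
    if "a \<in> carrier A" "b \<in> carrier B" "a' \<in> carrier A" "b' \<in> carrier B" for a b a' b'
    using that by (intro m bilinearD[OF bilinear_mult] A B A.m_closed B.m_closed; simp)+
  have outer: "bilinear K A B ?T (\<lambda>a b. tensor_lift ?T (?f a b) t)" if "t \<in> carrier ?T" for t
    by (rule bilinearI)
      (auto intro!: hom_lift_param[OF vs vst _ that] bilinear_tensor_mult_elem f1 vs)
  have "bilinear K ?T ?T ?T (\<lambda>s t. tensor_lift ?T (\<lambda>a b. tensor_lift ?T (?f a b) t) s)"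
    by (rule bilinearI)
      (auto intro!: tensor_lift_hom hom_lift_param[OF vs vst vst] outer bilinear_tensor_mult_elem vs vst)
  then show ?thesis
    by (simp add: bilinear_def module_hom_def tensor_mult_eq_lift Pi_iff vs)
qed

lemma tensor_mult_elem:
  assumes "a \<in> carrier A" "b \<in> carrier B" "a' \<in> carrier A" "b' \<in> carrier B"
  shows "tensor_elem K A B a b \<otimes>\<^bsub>A \<boxtimes> B\<^esub> tensor_elem K A B a' b' =
    tensor_elem K A B (a \<otimes>\<^bsub>A\<^esub> a') (b \<otimes>\<^bsub>B\<^esub> b')"
proof -
  let ?T = "A \<boxtimes> B"
  let ?f = "\<lambda>a b a' b'. tensor_elem K A B (a \<otimes>\<^bsub>A\<^esub> a') (b \<otimes>\<^bsub>B\<^esub> b')"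
  let ?t = "tensor_elem K A B a' b'"
  note vs = unital_algebra_vectorspace[OF A] unital_algebra_vectorspace[OF B]
  note vst = tensor_vectorspace[OF vs]
  have le: "tensor_lift ?T (?f a b) ?t = ?f a b a' b'" if "a \<in> carrier A" "b \<in> carrier B" for a b
    using that assms by (intro tensor_lift_elem[OF vs vst] bilinear_tensor_mult_elem)
  have t: "?t \<in> carrier ?T" using assms by simp
  have "tensor_elem K A B a b \<otimes>\<^bsub>?T\<^esub> ?t =
      tensor_lift ?T (\<lambda>a b. tensor_lift ?T (?f a b) ?t) (tensor_elem K A B a b)"
    using assms by (intro tensor_mult_eq_lift) auto
  also have "\<dots> = tensor_lift ?T (\<lambda>a b. ?f a b a' b') (tensor_elem K A B a b)"
    using assms by (intro tensor_lift_cong[OF vs]) (simp_all add: le)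
  also have "\<dots> = ?f a b a' b'"
    using assms
    by (intro tensor_lift_elem[OF vs vst] bilinear_comp[OF bilinear_tensor_elem] vs bilinearD(2)[OF bilinear_mult] A B)
  finally show ?thesis .
qed

text \<open>Both sides of each law are linear in every variable, so the laws reduce, one variable at a
  time, to those of the two factors.\<close>

lemma tensor_unital_algebra [simp]: "unital_algebra K (A \<boxtimes> B)"
proof -
  let ?T = "A \<boxtimes> B"
  note vs = unital_algebra_vectorspace[OF A] unital_algebra_vectorspace[OF B]
  note vst = tensor_vectorspace[OF vs]
  note m = bilinear_tensor_mult
  note mc = bilinear_closed[OF m]
  note ml = bilinear_hom_left[OF m] and mr = bilinear_hom_right[OF m]
  note ext = tensor_hom_ext[OF vs vst]
  have one: "\<one>\<^bsub>?T\<^esub> = tensor_elem K A B \<one>\<^bsub>A\<^esub> \<one>\<^bsub>B\<^esub>" by (simp add: tensor_def)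
  then have onec: "\<one>\<^bsub>?T\<^esub> \<in> carrier ?T" by simp
  have assoc: "x \<otimes>\<^bsub>?T\<^esub> y \<otimes>\<^bsub>?T\<^esub> z = x \<otimes>\<^bsub>?T\<^esub> (y \<otimes>\<^bsub>?T\<^esub> z)"
    if x: "x \<in> carrier ?T" and y: "y \<in> carrier ?T" and z: "z \<in> carrier ?T" for x y z
  proof (rule ext[OF _ _ x])
    show "(\<lambda>x. x \<otimes>\<^bsub>?T\<^esub> y \<otimes>\<^bsub>?T\<^esub> z) \<in> Hom ?T ?T"
      by (rule ml[OF ml[OF hom_id y] z])
    show "(\<lambda>x. x \<otimes>\<^bsub>?T\<^esub> (y \<otimes>\<^bsub>?T\<^esub> z)) \<in> Hom ?T ?T"
      by (rule ml[OF hom_id mc[OF y z]])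
    fix a b assume ab: "a \<in> carrier A" "b \<in> carrier B"
    let ?x = "tensor_elem K A B a b"
    have xc: "?x \<in> carrier ?T" using ab by simp
    show "?x \<otimes>\<^bsub>?T\<^esub> y \<otimes>\<^bsub>?T\<^esub> z = ?x \<otimes>\<^bsub>?T\<^esub> (y \<otimes>\<^bsub>?T\<^esub> z)"
    proof (rule ext[OF _ _ y])
      show "(\<lambda>y. ?x \<otimes>\<^bsub>?T\<^esub> y \<otimes>\<^bsub>?T\<^esub> z) \<in> Hom ?T ?T"
        by (rule ml[OF _ z], rule mr[OF _ xc], rule hom_id)
      show "(\<lambda>y. ?x \<otimes>\<^bsub>?T\<^esub> (y \<otimes>\<^bsub>?T\<^esub> z)) \<in> Hom ?T ?T"
        by (rule mr[OF _ xc], rule ml[OF _ z], rule hom_id)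
      fix a' b' assume ab': "a' \<in> carrier A" "b' \<in> carrier B"
      let ?y = "tensor_elem K A B a' b'"
      have yc: "?y \<in> carrier ?T" using ab' by simp
      show "?x \<otimes>\<^bsub>?T\<^esub> ?y \<otimes>\<^bsub>?T\<^esub> z = ?x \<otimes>\<^bsub>?T\<^esub> (?y \<otimes>\<^bsub>?T\<^esub> z)"
      proof (rule ext[OF _ _ z])
        show "(\<lambda>z. ?x \<otimes>\<^bsub>?T\<^esub> ?y \<otimes>\<^bsub>?T\<^esub> z) \<in> Hom ?T ?T"
          by (rule mr[OF hom_id mc[OF xc yc]])
        show "(\<lambda>z. ?x \<otimes>\<^bsub>?T\<^esub> (?y \<otimes>\<^bsub>?T\<^esub> z)) \<in> Hom ?T ?T"
          by (rule mr[OF _ xc], rule mr[OF _ yc], rule hom_id)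
      qed (use ab ab' in \<open>simp add: tensor_mult_elem A.m_assoc B.m_assoc\<close>)
    qed
  qed
  have l_one: "\<one>\<^bsub>?T\<^esub> \<otimes>\<^bsub>?T\<^esub> x = x" if "x \<in> carrier ?T" for x
    by (rule ext[OF mr[OF hom_id onec] hom_id that]) (simp add: one tensor_mult_elem)
  have r_one: "x \<otimes>\<^bsub>?T\<^esub> \<one>\<^bsub>?T\<^esub> = x" if "x \<in> carrier ?T" for x
    by (rule ext[OF ml[OF hom_id onec] hom_id that]) (simp add: one tensor_mult_elem)
  have "ring ?T"
    using vs_group[OF vst]
    by (intro ringI monoidI) (simp_all add: mc onec assoc l_one r_one
        hom_add[OF bilinearD(1)[OF m]] hom_add[OF bilinearD(2)[OF m]])
  then show ?thesis
    using vst by (intro unital_algebra.intro unital_algebra_axioms.intro)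
      (simp_all add: hom_smult[OF bilinearD(1)[OF m]] hom_smult[OF bilinearD(2)[OF m]])
qed

end

lemma tensor_one: "\<one>\<^bsub>A \<boxtimes> B\<^esub> = tensor_elem K A B \<one>\<^bsub>A\<^esub> \<one>\<^bsub>B\<^esub>"
  by (simp add: tensor_def)

end

section \<open>Finite-dimensional Hopf algebras and their duals\<close>

locale fin_dim_hopf = hopf_algebra K H for K :: "'k ring" and H :: "('k, 'h) hopf" +
  assumes fin_dim: "fin_dim"

sublocale fin_dim_hopf \<subseteq> base: base_field K
  by unfold_locales

context fin_dim_hopf
begin

abbreviation D :: "('k, 'h \<Rightarrow> 'k) hopf" where "D \<equiv> dual_hopf K H"

notation base.tensor_space (infixr "\<boxtimes>" 72)

abbreviation Hom :: "('k, 'v, 'm) module_scheme \<Rightarrow> ('k, 'w, 'n) module_scheme \<Rightarrow> ('v \<Rightarrow> 'w) set"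
  where "Hom V W \<equiv> module_hom K V W"

abbreviation KK :: "('k, 'k) module" where "KK \<equiv> base_algebra K"

lemma vectorspace_H [simp]: "vectorspace K H"
  by (rule vectorspace_axioms)

lemma unital_algebra_H [simp]: "unital_algebra K H"
  by (rule unital_algebra_axioms)

lemma comult_Hom: "comult H \<in> Hom H (H \<boxtimes> H)"
  using comult_hom by (simp add: algebra_hom_def)

lemma comult_closed: "h \<in> carrier H \<Longrightarrow> comult H h \<in> carrier (H \<boxtimes> H)"
  by (rule base.hom_closed[OF comult_Hom])

lemma counit_Hom: "counit H \<in> Hom H KK"
  using counit_hom by (simp add: algebra_hom_def)

text \<open>The coassociativity axiom with an arbitrary trilinear expression applied to both sides:
  \<open>f(h\<^sub>(\<^sub>1\<^sub>), h\<^sub>(\<^sub>2\<^sub>)\<^sub>(\<^sub>1\<^sub>), h\<^sub>(\<^sub>2\<^sub>)\<^sub>(\<^sub>2\<^sub>)) = f(h\<^sub>(\<^sub>1\<^sub>)\<^sub>(\<^sub>1\<^sub>), h\<^sub>(\<^sub>1\<^sub>)\<^sub>(\<^sub>2\<^sub>), h\<^sub>(\<^sub>2\<^sub>))\<close>.\<close>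

lemma coassoc_sweedler:
  assumes Z: "vectorspace K Z" and f: "base.trilinear H H H Z f" and h: "h \<in> carrier H"
  shows "tensor_lift Z (\<lambda>a t. tensor_lift Z (f a) (comult H t)) (comult H h) =
    tensor_lift Z (\<lambda>t c. tensor_lift Z (\<lambda>a b. f a b c) (comult H t)) (comult H h)"
proof -
  note HH = base.tensor_vectorspace[OF vectorspace_H vectorspace_H]
  note L = base.trilinear_lift_left[OF vectorspace_H vectorspace_H vectorspace_H Z f]
  note R = base.trilinear_lift_right[OF vectorspace_H vectorspace_H vectorspace_H Z f]
  let ?R = "\<lambda>a t. tensor_lift Z (f a) t" and ?L = "\<lambda>t c. tensor_lift Z (\<lambda>a b. f a b c) t"
  have id: "id \<in> Hom H H" using base.hom_id by (simp add: id_def)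
  have "tensor_lift Z (\<lambda>a t. ?R (id a) (comult H t)) (comult H h) =
      tensor_lift Z ?R (tensor_map K H (H \<boxtimes> H) id (comult H) (comult H h))"
    by (rule base.tensor_lift_map[OF vectorspace_H vectorspace_H vectorspace_H HH Z id comult_Hom R
          comult_closed[OF h], symmetric])
  also have "\<dots> = tensor_lift Z ?R (tensor_assoc K H H H
      (tensor_map K (H \<boxtimes> H) H (comult H) id (comult H h)))"
    by (simp add: coassoc[OF h])
  also have "\<dots> = tensor_lift Z ?L (tensor_map K (H \<boxtimes> H) H (comult H) id (comult H h))"
    by (rule base.tensor_lift_assoc[OF vectorspace_H vectorspace_H vectorspace_H Z f])
      (rule base.hom_closed[OF base.tensor_map_hom[OF vectorspace_H vectorspace_H HH vectorspace_H
        comult_Hom id] comult_closed[OF h]])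
  also have "\<dots> = tensor_lift Z (\<lambda>t c. ?L (comult H t) (id c)) (comult H h)"
    by (rule base.tensor_lift_map[OF vectorspace_H vectorspace_H HH vectorspace_H Z comult_Hom id L
          comult_closed[OF h]])
  finally show ?thesis by simp
qed

subsection \<open>The dual space\<close>

lemma dual_carrier: "carrier D = Hom H KK \<inter> extensional (carrier H)"
  by (simp add: dual_hopf_def dual_algebra_def module.defs hopf.defs)

lemma dual_simps [simp]:
  "\<zero>\<^bsub>D\<^esub> = (\<lambda>h\<in>carrier H. \<zero>\<^bsub>K\<^esub>)"
  "\<one>\<^bsub>D\<^esub> = (\<lambda>h\<in>carrier H. counit H h)"
  "\<theta> \<oplus>\<^bsub>D\<^esub> \<phi> = (\<lambda>h\<in>carrier H. \<theta> h \<oplus>\<^bsub>K\<^esub> \<phi> h)"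
  "a \<odot>\<^bsub>D\<^esub> \<theta> = (\<lambda>h\<in>carrier H. a \<otimes>\<^bsub>K\<^esub> \<theta> h)"
  "\<theta> \<otimes>\<^bsub>D\<^esub> \<phi> = (\<lambda>h\<in>carrier H. tensor_lift KK (\<lambda>a b. \<theta> a \<otimes>\<^bsub>K\<^esub> \<phi> b) (comult H h))"
  "comult D = dual_comult K H"
  "counit D \<theta> = \<theta> \<one>\<^bsub>H\<^esub>"
  by (simp_all add: dual_hopf_def dual_algebra_def module.defs hopf.defs pairing_def)

lemma dualD: "\<theta> \<in> carrier D \<Longrightarrow> \<theta> \<in> Hom H KK"
  by (simp add: dual_carrier)

lemma dual_eval_closed: "\<theta> \<in> carrier D \<Longrightarrow> h \<in> carrier H \<Longrightarrow> \<theta> h \<in> carrier K"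
  using base.hom_closed[OF dualD] by simp

lemma dualI: "f \<in> Hom H KK \<Longrightarrow> restrict f (carrier H) \<in> carrier D"
  by (auto simp: dual_carrier module_hom_def)

lemma dual_eqI:
  assumes "\<theta> \<in> carrier D" "\<phi> \<in> carrier D" "\<And>h. h \<in> carrier H \<Longrightarrow> \<theta> h = \<phi> h"
  shows "\<theta> = \<phi>"
  using assms by (auto simp: dual_carrier intro: extensionalityI)

lemma vectorspace_D [simp]: "vectorspace K D"
proof -
  have cl: "\<theta> \<oplus>\<^bsub>D\<^esub> \<phi> \<in> carrier D" if "\<theta> \<in> carrier D" "\<phi> \<in> carrier D" for \<theta> \<phi>
    using base.hom_plus[OF vectorspace_H base.vectorspace_base dualD[OF that(1)] dualD[OF that(2)]]
    unfolding dual_simps(3) by (intro dualI) simp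
  have sc: "a \<odot>\<^bsub>D\<^esub> \<theta> \<in> carrier D" if "a \<in> carrier K" "\<theta> \<in> carrier D" for a \<theta>
    using base.hom_scale[OF base.vectorspace_base dualD[OF that(2)] that(1)]
    unfolding dual_simps(4) by (intro dualI) simp
  have z: "\<zero>\<^bsub>D\<^esub> \<in> carrier D"
    using base.hom_zero_map[OF vectorspace_H base.vectorspace_base]
    unfolding dual_simps(1) by (intro dualI) simp
  note ev = dual_eval_closed
  have "abelian_group D"
  proof (rule abelian_groupI)
    fix \<theta> assume \<theta>: "\<theta> \<in> carrier D"
    show "\<exists>\<phi>\<in>carrier D. \<phi> \<oplus>\<^bsub>D\<^esub> \<theta> = \<zero>\<^bsub>D\<^esub>"
    proof (rule bexI[OF _ sc[OF _ \<theta>]])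
      show "(\<ominus>\<^bsub>K\<^esub> \<one>\<^bsub>K\<^esub>) \<odot>\<^bsub>D\<^esub> \<theta> \<oplus>\<^bsub>D\<^esub> \<theta> = \<zero>\<^bsub>D\<^esub>"
        using ev[OF \<theta>] by (intro ext) (simp add: base.scalar_neg)
    qed simp
  next
    fix \<theta> assume \<theta>: "\<theta> \<in> carrier D"
    show "\<zero>\<^bsub>D\<^esub> \<oplus>\<^bsub>D\<^esub> \<theta> = \<theta>"
      using cl[OF z \<theta>] \<theta> by (rule dual_eqI) (simp add: ev[OF \<theta>])
  next
    fix \<theta> \<phi> \<psi> assume a: "\<theta> \<in> carrier D" "\<phi> \<in> carrier D" "\<psi> \<in> carrier D"
    show "\<theta> \<oplus>\<^bsub>D\<^esub> \<phi> \<oplus>\<^bsub>D\<^esub> \<psi> = \<theta> \<oplus>\<^bsub>D\<^esub> (\<phi> \<oplus>\<^bsub>D\<^esub> \<psi>)"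
      using ev[OF a(1)] ev[OF a(2)] ev[OF a(3)] by (intro ext) (simp add: base.scalar_a_ac)
  next
    fix \<theta> \<phi> assume a: "\<theta> \<in> carrier D" "\<phi> \<in> carrier D"
    show "\<theta> \<oplus>\<^bsub>D\<^esub> \<phi> = \<phi> \<oplus>\<^bsub>D\<^esub> \<theta>"
      using ev[OF a(1)] ev[OF a(2)] by (intro ext) (simp add: base.scalar_a_ac)
  qed (fact cl z)+
  then have "module K D"
  proof (rule moduleI[OF base.scalar_cring _ sc])
    fix \<theta> assume \<theta>: "\<theta> \<in> carrier D"
    show "\<one>\<^bsub>K\<^esub> \<odot>\<^bsub>D\<^esub> \<theta> = \<theta>"
      using sc[OF _ \<theta>] \<theta> by (rule dual_eqI) (simp_all add: ev[OF \<theta>])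
  qed (use ev in \<open>auto intro!: ext simp: base.scalar_m_ac base.scalar_distr\<close>)
  then show ?thesis by (rule base.vectorspace_of_module)
qed

lemma dual_eval_hom: "h \<in> carrier H \<Longrightarrow> (\<lambda>\<theta>. \<theta> h) \<in> Hom D KK"
  by (rule base.homI) (auto intro: dual_eval_closed)

subsection \<open>The dual basis\<close>

text \<open>This is literally the basis chosen in the definition of the canonical element, so that
  the latter can be unfolded without an argument on independence of the basis.\<close>

definition B :: "'h set" where "B = (SOME B. basis B)"

abbreviation dual_vec :: "'h \<Rightarrow> 'h \<Rightarrow> 'k" where "dual_vec \<equiv> dual_vector K H B"

lemma basis_B: "basis B" and finite_B: "finite B" and B_subset: "B \<subseteq> carrier H"
proof -
  show b: "basis B"
    unfolding B_def using finite_basis_exists[OF fin_dim] by (blast intro: someI)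
  then show "B \<subseteq> carrier H" "finite B"
    using fin_dim_li_fin[OF fin_dim, of B] by (auto simp: basis_def)
qed

definition coords :: "'h \<Rightarrow> 'h \<Rightarrow> 'k" where
  "coords h = (THE a. a \<in> B \<rightarrow>\<^sub>E carrier K \<and> lincomb a B = h)"

lemma coords:
  assumes "h \<in> carrier H"
  shows "coords h \<in> B \<rightarrow> carrier K" "(\<Oplus>\<^bsub>H\<^esub>b\<in>B. coords h b \<odot>\<^bsub>H\<^esub> b) = h"
proof -
  have "\<exists>!a. a \<in> B \<rightarrow>\<^sub>E carrier K \<and> lincomb a B = h"
    using basis_criterion[OF finite_B B_subset] basis_B assms by blast
  from theI'[OF this] show "coords h \<in> B \<rightarrow> carrier K" "(\<Oplus>\<^bsub>H\<^esub>b\<in>B. coords h b \<odot>\<^bsub>H\<^esub> b) = h"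
    by (auto simp: coords_def lincomb_def)
qed

lemma coords_unique:
  assumes a: "a \<in> B \<rightarrow> carrier K" and h: "(\<Oplus>\<^bsub>H\<^esub>b\<in>B. a b \<odot>\<^bsub>H\<^esub> b) = h" and b: "b \<in> B"
  shows "coords h b = a b"
proof -
  have cl: "a b \<odot>\<^bsub>H\<^esub> b \<in> carrier H" if "b \<in> B" for b
    using a B_subset that by auto
  (* uniqueness of coordinates is available for families that are undefined outside the basis *)
  have "lincomb (restrict a B) B = (\<Oplus>\<^bsub>H\<^esub>b\<in>B. a b \<odot>\<^bsub>H\<^esub> b)"
    unfolding lincomb_def
    by (rule abelian_monoid.finsum_cong'[OF base.vs_monoid[OF vectorspace_H]]) (simp_all add: cl)
  then have 1: "restrict a B \<in> B \<rightarrow>\<^sub>E carrier K \<and> lincomb (restrict a B) B = h"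
    using a h by auto
  have "h \<in> carrier H"
    unfolding h[symmetric]
    by (rule abelian_monoid.finsum_closed[OF base.vs_monoid[OF vectorspace_H]]) (simp add: cl)
  then have "\<exists>!a. a \<in> B \<rightarrow>\<^sub>E carrier K \<and> lincomb a B = h"
    using basis_criterion[OF finite_B B_subset] basis_B by simp
  then have "coords h = restrict a B"
    unfolding coords_def using 1 by (intro the1_equality[of "\<lambda>a. a \<in> B \<rightarrow>\<^sub>E carrier K \<and> lincomb a B = h"])
  with b show ?thesis by simp
qed

text \<open>Coordinates are unique, and the sum or a multiple of the coordinate families represents the
  sum or the multiple of the vectors.\<close>

lemma coords_Hom:
  assumes b: "b \<in> B"
  shows "(\<lambda>h. coords h b) \<in> Hom H KK"
proof (rule base.homI)
  note mon = base.vs_monoid[OF vectorspace_H]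
  have cl: "coords h b \<in> carrier K" if "h \<in> carrier H" "b \<in> B" for h b
    using coords(1)[OF that(1)] that(2) by auto
  have clB: "b \<in> carrier H" if "b \<in> B" for b
    using B_subset that by auto
  show "coords h b \<in> carrier KK" if "h \<in> carrier H" for h
    using cl[OF that b] by simp
  show "coords (h \<oplus>\<^bsub>H\<^esub> h') b = coords h b \<oplus>\<^bsub>KK\<^esub> coords h' b"
    if h: "h \<in> carrier H" "h' \<in> carrier H" for h h'
  proof -
    have "(\<Oplus>\<^bsub>H\<^esub>b\<in>B. (coords h b \<oplus>\<^bsub>K\<^esub> coords h' b) \<odot>\<^bsub>H\<^esub> b) =
        (\<Oplus>\<^bsub>H\<^esub>b\<in>B. coords h b \<odot>\<^bsub>H\<^esub> b \<oplus>\<^bsub>H\<^esub> coords h' b \<odot>\<^bsub>H\<^esub> b)"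
      by (rule abelian_monoid.finsum_cong'[OF mon])
        (simp_all add: Pi_iff cl clB h smult_l_distr)
    also have "\<dots> = h \<oplus>\<^bsub>H\<^esub> h'"
      using abelian_monoid.finsum_addf[OF mon, of "\<lambda>b. coords h b \<odot>\<^bsub>H\<^esub> b" B "\<lambda>b. coords h' b \<odot>\<^bsub>H\<^esub> b"]
      by (simp add: Pi_iff cl clB h coords(2))
    finally show ?thesis
      using coords_unique[of "\<lambda>b. coords h b \<oplus>\<^bsub>K\<^esub> coords h' b", OF _ _ b] cl h by simp
  qed
  show "coords (a \<odot>\<^bsub>H\<^esub> h) b = a \<odot>\<^bsub>KK\<^esub> coords h b"
    if h: "a \<in> carrier K" "h \<in> carrier H" for a h
  proof -
    have "(\<Oplus>\<^bsub>H\<^esub>b\<in>B. (a \<otimes>\<^bsub>K\<^esub> coords h b) \<odot>\<^bsub>H\<^esub> b) =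
        (\<Oplus>\<^bsub>H\<^esub>b\<in>B. a \<odot>\<^bsub>H\<^esub> (coords h b \<odot>\<^bsub>H\<^esub> b))"
      by (rule abelian_monoid.finsum_cong'[OF mon])
        (simp_all add: Pi_iff cl clB h smult_assoc1)
    also have "\<dots> = a \<odot>\<^bsub>H\<^esub> h"
      using base.hom_finsum[OF vectorspace_H vectorspace_H
          base.hom_scale[OF vectorspace_H base.hom_id h(1)] finite_B, of "\<lambda>b. coords h b \<odot>\<^bsub>H\<^esub> b"]
      by (simp add: Pi_iff cl clB h coords(2))
    finally show ?thesis
      using coords_unique[of "\<lambda>b. a \<otimes>\<^bsub>K\<^esub> coords h b", OF _ _ b] cl h by simp
  qed
qed

lemma coords_basis:
  assumes "b \<in> B" "c \<in> B"
  shows "coords c b = (if c = b then \<one>\<^bsub>K\<^esub> else \<zero>\<^bsub>K\<^esub>)"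
proof (rule coords_unique[OF _ _ assms(1)])
  note mon = base.vs_monoid[OF vectorspace_H]
  have "(\<Oplus>\<^bsub>H\<^esub>b\<in>B. (if c = b then \<one>\<^bsub>K\<^esub> else \<zero>\<^bsub>K\<^esub>) \<odot>\<^bsub>H\<^esub> b) =
      (\<Oplus>\<^bsub>H\<^esub>b\<in>B. if c = b then b else \<zero>\<^bsub>H\<^esub>)"
    using B_subset
    by (intro abelian_monoid.finsum_cong'[OF mon]) auto
  also have "\<dots> = c"
    using abelian_monoid.finsum_singleton[OF mon assms(2) finite_B, of "\<lambda>b. b"] B_subset by auto
  finally show "(\<Oplus>\<^bsub>H\<^esub>b\<in>B. (if c = b then \<one>\<^bsub>K\<^esub> else \<zero>\<^bsub>K\<^esub>) \<odot>\<^bsub>H\<^esub> b) = c" .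
qed auto

text \<open>The coordinate functionals take the prescribed values on the basis, and a functional is
  determined by its values there.\<close>

lemma dual_vec_eq_coords:
  assumes b: "b \<in> B"
  shows "dual_vec b = (\<lambda>h\<in>carrier H. coords h b)"
  unfolding dual_vector_def
proof (rule the_equality)
  let ?\<phi> = "\<lambda>h\<in>carrier H. coords h b"
  show "?\<phi> \<in> carrier D \<and> (\<forall>c\<in>B. ?\<phi> c = (if c = b then \<one>\<^bsub>K\<^esub> else \<zero>\<^bsub>K\<^esub>))"
    using dualI[OF coords_Hom[OF b]] B_subset coords_basis[OF b] by auto
  fix \<theta> assume \<theta>: "\<theta> \<in> carrier D \<and> (\<forall>c\<in>B. \<theta> c = (if c = b then \<one>\<^bsub>K\<^esub> else \<zero>\<^bsub>K\<^esub>))"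
  have "\<theta> h = coords h b" if h: "h \<in> carrier H" for h
  proof -
    note monK = base.vs_monoid[OF base.vectorspace_base]
    note \<theta>D = dualD[OF conjunct1[OF \<theta>]]
    have cl: "coords h c \<in> carrier K" "c \<in> carrier H" if "c \<in> B" for c
      using coords(1)[OF h] that B_subset by auto
    have "\<theta> h = \<theta> (\<Oplus>\<^bsub>H\<^esub>c\<in>B. coords h c \<odot>\<^bsub>H\<^esub> c)"
      by (simp add: coords(2)[OF h])
    also have "\<dots> = (\<Oplus>\<^bsub>KK\<^esub>c\<in>B. \<theta> (coords h c \<odot>\<^bsub>H\<^esub> c))"
      using cl by (intro base.hom_finsum[OF vectorspace_H base.vectorspace_base \<theta>D finite_B]) auto
    also have "\<dots> = (\<Oplus>\<^bsub>KK\<^esub>c\<in>B. if b = c then coords h c else \<zero>\<^bsub>KK\<^esub>)"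
      using cl \<theta> by (intro abelian_monoid.finsum_cong'[OF monK]) (auto simp: base.hom_smult[OF \<theta>D])
    also have "\<dots> = coords h b"
      using cl by (intro abelian_monoid.finsum_singleton[OF monK b finite_B]) auto
    finally show ?thesis .
  qed
  then show "\<theta> = ?\<phi>"
    using \<theta> dualI[OF coords_Hom[OF b]] by (intro dual_eqI) auto
qed

lemma dual_vec_props:
  assumes "b \<in> B"
  shows "dual_vec b \<in> carrier D"
  using dualI[OF coords_Hom[OF assms]] by (simp add: dual_vec_eq_coords[OF assms])

lemma dual_basis_expansion:
  assumes h: "h \<in> carrier H"
  shows "(\<Oplus>\<^bsub>H\<^esub>b\<in>B. dual_vec b h \<odot>\<^bsub>H\<^esub> b) = h"
proof -
  have "(\<Oplus>\<^bsub>H\<^esub>b\<in>B. dual_vec b h \<odot>\<^bsub>H\<^esub> b) = (\<Oplus>\<^bsub>H\<^esub>b\<in>B. coords h b \<odot>\<^bsub>H\<^esub> b)"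
    using coords(1)[OF h] B_subset
    by (intro abelian_monoid.finsum_cong'[OF base.vs_monoid[OF vectorspace_H]])
      (auto simp: dual_vec_eq_coords h)
  then show ?thesis by (simp add: coords(2)[OF h])
qed

text \<open>A linear map applied to the expansion \<open>h = \<Sum>\<^sub>b b\<^sup>*(h) b\<close>. It evaluates the
  sums over the dual basis that occur below.\<close>

lemma functional_expansion:
  assumes Z: "vectorspace K Z" and f: "f \<in> Hom H Z" and h: "h \<in> carrier H"
  shows "(\<Oplus>\<^bsub>Z\<^esub>b\<in>B. dual_vec b h \<odot>\<^bsub>Z\<^esub> f b) = f h"
proof -
  interpret Z: abelian_monoid Z using Z by (rule base.vs_monoid)
  have cl: "dual_vec b h \<in> carrier K" "b \<in> carrier H" if "b \<in> B" for b
    using that B_subset dual_eval_closed[OF dual_vec_props[OF that] h] by auto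
  have "f h = f (\<Oplus>\<^bsub>H\<^esub>b\<in>B. dual_vec b h \<odot>\<^bsub>H\<^esub> b)"
    using dual_basis_expansion[OF h] by simp
  also have "\<dots> = (\<Oplus>\<^bsub>Z\<^esub>b\<in>B. f (dual_vec b h \<odot>\<^bsub>H\<^esub> b))"
    by (rule base.hom_finsum[OF vectorspace_H Z f finite_B]) (simp add: cl)
  also have "\<dots> = (\<Oplus>\<^bsub>Z\<^esub>b\<in>B. dual_vec b h \<odot>\<^bsub>Z\<^esub> f b)"
    by (rule Z.finsum_cong') (simp_all add: cl base.hom_smult[OF f] base.hom_closed[OF f] Z)
  finally show ?thesis ..
qed

lemma dual_expansion:
  assumes \<theta>: "\<theta> \<in> carrier D"
  shows "(\<Oplus>\<^bsub>D\<^esub>b\<in>B. \<theta> b \<odot>\<^bsub>D\<^esub> dual_vec b) = \<theta>"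
proof -
  interpret DM: abelian_monoid D using vectorspace_D by (rule base.vs_monoid)
  interpret KK: abelian_monoid KK using base.vectorspace_base by (rule base.vs_monoid)
  have cl: "\<theta> b \<odot>\<^bsub>D\<^esub> dual_vec b \<in> carrier D" "\<theta> b \<in> carrier K" if "b \<in> B" for b
  proof -
    show "\<theta> b \<in> carrier K" using dual_eval_closed[OF \<theta>] that B_subset by auto
    then show "\<theta> b \<odot>\<^bsub>D\<^esub> dual_vec b \<in> carrier D"
      using base.vs_closed(3)[OF vectorspace_D _ dual_vec_props[OF that]] by simp
  qed
  have s: "(\<lambda>b. \<theta> b \<odot>\<^bsub>D\<^esub> dual_vec b) \<in> B \<rightarrow> carrier D" using cl by blast
  show ?thesis
  proof (rule dual_eqI[OF DM.finsum_closed[OF s] \<theta>])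
    fix h assume h: "h \<in> carrier H"
    have "(\<Oplus>\<^bsub>D\<^esub>b\<in>B. \<theta> b \<odot>\<^bsub>D\<^esub> dual_vec b) h = (\<Oplus>\<^bsub>KK\<^esub>b\<in>B. (\<theta> b \<odot>\<^bsub>D\<^esub> dual_vec b) h)"
      by (rule base.hom_finsum[OF vectorspace_D base.vectorspace_base dual_eval_hom[OF h] finite_B s])
    also have "\<dots> = (\<Oplus>\<^bsub>KK\<^esub>b\<in>B. dual_vec b h \<odot>\<^bsub>KK\<^esub> \<theta> b)"
      using cl dual_eval_closed[OF dual_vec_props h]
      by (intro KK.finsum_cong') (auto simp: h base.scalar_m_comm)
    also have "\<dots> = \<theta> h"
      by (rule functional_expansion[OF base.vectorspace_base dualD[OF \<theta>] h])
    finally show "(\<Oplus>\<^bsub>D\<^esub>b\<in>B. \<theta> b \<odot>\<^bsub>D\<^esub> dual_vec b) h = \<theta> h" .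
  qed
qed

subsection \<open>The dual algebra\<close>

lemma bilinear_dual_mult_integrand:
  assumes "\<theta> \<in> carrier D" "\<phi> \<in> carrier D"
  shows "bilinear K H H KK (\<lambda>a b. \<theta> a \<otimes>\<^bsub>K\<^esub> \<phi> b)"
  using base.bilinear_comp[OF base.bilinear_mult[OF base.unital_algebra_base] dualD[OF assms(1)]
    dualD[OF assms(2)]] by simp

lemma dual_mult_closed:
  assumes "\<theta> \<in> carrier D" "\<phi> \<in> carrier D"
  shows "\<theta> \<otimes>\<^bsub>D\<^esub> \<phi> \<in> carrier D"
  unfolding dual_simps(5)
  by (intro dualI base.hom_lift_arg[OF _ _ _ bilinear_dual_mult_integrand[OF assms] comult_Hom])
    simp_all

text \<open>Linearity of a map into the dual can be tested after evaluation at each point, where the product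
  is a Sweedler expression with \<open>\<theta>\<close> as a parameter.\<close>

lemma bilinear_dual_mult: "bilinear K D D D (mult D)"
proof -
  have 1: "(\<lambda>\<theta>. (\<theta> \<otimes>\<^bsub>D\<^esub> \<phi>) h) \<in> Hom D KK" "(\<lambda>\<theta>. (\<phi> \<otimes>\<^bsub>D\<^esub> \<theta>) h) \<in> Hom D KK"
    if \<phi>: "\<phi> \<in> carrier D" and h: "h \<in> carrier H" for \<phi> h
  proof -
    note mK = base.bilinear_mult[OF base.unital_algebra_base, simplified]
    note p = base.hom_lift_param[OF vectorspace_H vectorspace_H base.vectorspace_base vectorspace_D
        comult_closed[OF h]]
    show "(\<lambda>\<theta>. (\<theta> \<otimes>\<^bsub>D\<^esub> \<phi>) h) \<in> Hom D KK"
      using p[of "\<lambda>\<theta> a b. \<theta> a \<otimes>\<^bsub>K\<^esub> \<phi> b"] bilinear_dual_mult_integrand[OF _ \<phi>]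
        base.bilinear_hom_left[OF mK dual_eval_hom] dual_eval_closed[OF \<phi>] h by simp
    show "(\<lambda>\<theta>. (\<phi> \<otimes>\<^bsub>D\<^esub> \<theta>) h) \<in> Hom D KK"
      using p[of "\<lambda>\<theta> a b. \<phi> a \<otimes>\<^bsub>K\<^esub> \<theta> b"] bilinear_dual_mult_integrand[OF \<phi>]
        base.bilinear_hom_right[OF mK dual_eval_hom] dual_eval_closed[OF \<phi>] h by simp
  qed
  have 2: "f \<in> Hom D D"
    if c: "\<And>\<theta>. \<theta> \<in> carrier D \<Longrightarrow> f \<theta> \<in> carrier D"
      and f: "\<And>h. h \<in> carrier H \<Longrightarrow> (\<lambda>\<theta>. f \<theta> h) \<in> Hom D KK" for f
  proof (rule base.homI[OF c])
    note add = base.vs_closed(2)[OF vectorspace_D] and sm = base.vs_closed(3)[OF vectorspace_D]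
    show "f (\<theta> \<oplus>\<^bsub>D\<^esub> \<theta>') = f \<theta> \<oplus>\<^bsub>D\<^esub> f \<theta>'" if "\<theta> \<in> carrier D" "\<theta>' \<in> carrier D" for \<theta> \<theta>'
      by (rule dual_eqI[OF c[OF add[OF that]] add[OF c[OF that(1)] c[OF that(2)]]])
        (use base.hom_add[OF f that] in simp)
    show "f (a \<odot>\<^bsub>D\<^esub> \<theta>) = a \<odot>\<^bsub>D\<^esub> f \<theta>" if "a \<in> carrier K" "\<theta> \<in> carrier D" for a \<theta>
      by (rule dual_eqI[OF c[OF sm[OF that]] sm[OF that(1) c[OF that(2)]]])
        (use base.hom_smult[OF f that] in simp)
  qed
  show ?thesis
    by (rule base.bilinearI; rule 2; (rule dual_mult_closed 1; assumption))
qed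

text \<open>Both sides evaluate to \<open>\<theta>(h\<^sub>(\<^sub>1\<^sub>)) \<phi>(h\<^sub>(\<^sub>2\<^sub>)) \<psi>(h\<^sub>(\<^sub>3\<^sub>))\<close> by coassociativity.\<close>

lemma dual_mult_assoc:
  assumes a: "\<theta> \<in> carrier D" "\<phi> \<in> carrier D" "\<psi> \<in> carrier D"
  shows "\<theta> \<otimes>\<^bsub>D\<^esub> \<phi> \<otimes>\<^bsub>D\<^esub> \<psi> = \<theta> \<otimes>\<^bsub>D\<^esub> (\<phi> \<otimes>\<^bsub>D\<^esub> \<psi>)"
proof (rule dual_eqI)
  note VH = vectorspace_H and VK = base.vectorspace_base
  note e = dual_eval_closed[OF a(1)] dual_eval_closed[OF a(2)] dual_eval_closed[OF a(3)]
  note mK = base.bilinear_mult[OF base.unital_algebra_base, simplified]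
  let ?f = "\<lambda>x y z. \<theta> x \<otimes>\<^bsub>K\<^esub> \<phi> y \<otimes>\<^bsub>K\<^esub> \<psi> z"
  have tri: "base.trilinear H H H KK ?f"
    by (rule base.trilinearI)
      (auto intro!: base.bilinear_hom_left[OF mK] base.bilinear_hom_right[OF mK]
        dualD[OF a(1)] dualD[OF a(2)] dualD[OF a(3)]
        simp: e base.scalar_m_closed)
  fix h assume h: "h \<in> carrier H"
  have "(\<theta> \<otimes>\<^bsub>D\<^esub> \<phi> \<otimes>\<^bsub>D\<^esub> \<psi>) h = tensor_lift KK (\<lambda>t z. (\<theta> \<otimes>\<^bsub>D\<^esub> \<phi>) t \<otimes>\<^bsub>K\<^esub> \<psi> z) (comult H h)"
    by (simp only: dual_simps restrict_apply' h)
  also have "\<dots> = tensor_lift KK (\<lambda>t z. tensor_lift KK (\<lambda>x y. ?f x y z) (comult H t)) (comult H h)"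
  proof (rule base.tensor_lift_cong[OF VH VH comult_closed[OF h]])
    fix t z assume t: "t \<in> carrier H" and z: "z \<in> carrier H"
    have "(\<lambda>c. c \<otimes>\<^bsub>K\<^esub> \<psi> z) \<in> Hom KK KK"
      using base.bilinear_hom_left[OF mK base.hom_id] e z by simp
    from base.hom_tensor_lift[OF VH VH VK VK bilinear_dual_mult_integrand[OF a(1,2)] this
        comult_closed[OF t]]
    show "(\<theta> \<otimes>\<^bsub>D\<^esub> \<phi>) t \<otimes>\<^bsub>K\<^esub> \<psi> z = tensor_lift KK (\<lambda>x y. ?f x y z) (comult H t)"
      using t by simp
  qed
  also have "\<dots> = tensor_lift KK (\<lambda>x t. tensor_lift KK (?f x) (comult H t)) (comult H h)"
    by (rule coassoc_sweedler[OF VK tri h, symmetric])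
  also have "\<dots> = tensor_lift KK (\<lambda>x t. \<theta> x \<otimes>\<^bsub>K\<^esub> (\<phi> \<otimes>\<^bsub>D\<^esub> \<psi>) t) (comult H h)"
  proof (rule base.tensor_lift_cong[OF VH VH comult_closed[OF h]])
    fix x t assume x: "x \<in> carrier H" and t: "t \<in> carrier H"
    have "(\<lambda>c. \<theta> x \<otimes>\<^bsub>K\<^esub> c) \<in> Hom KK KK"
      using base.bilinear_hom_right[OF mK base.hom_id] e x by simp
    from base.hom_tensor_lift[OF VH VH VK VK bilinear_dual_mult_integrand[OF a(2,3)] this
        comult_closed[OF t]]
    have "\<theta> x \<otimes>\<^bsub>K\<^esub> (\<phi> \<otimes>\<^bsub>D\<^esub> \<psi>) t =
        tensor_lift KK (\<lambda>y z. \<theta> x \<otimes>\<^bsub>K\<^esub> (\<phi> y \<otimes>\<^bsub>K\<^esub> \<psi> z)) (comult H t)"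
      using t by simp
    also have "\<dots> = tensor_lift KK (?f x) (comult H t)"
      by (rule base.tensor_lift_cong[OF VH VH comult_closed[OF t]])
        (simp add: base.scalar_m_assoc e x)
    finally show "tensor_lift KK (?f x) (comult H t) = \<theta> x \<otimes>\<^bsub>K\<^esub> (\<phi> \<otimes>\<^bsub>D\<^esub> \<psi>) t" ..
  qed
  also have "\<dots> = (\<theta> \<otimes>\<^bsub>D\<^esub> (\<phi> \<otimes>\<^bsub>D\<^esub> \<psi>)) h"
    by (simp only: dual_simps restrict_apply' h)
  finally show "(\<theta> \<otimes>\<^bsub>D\<^esub> \<phi> \<otimes>\<^bsub>D\<^esub> \<psi>) h = (\<theta> \<otimes>\<^bsub>D\<^esub> (\<phi> \<otimes>\<^bsub>D\<^esub> \<psi>)) h" .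
qed (intro dual_mult_closed a)+

lemma dual_one_closed: "\<one>\<^bsub>D\<^esub> \<in> carrier D"
  unfolding dual_simps(2) by (rule dualI[OF counit_Hom])

text \<open>The counit axioms with the functional \<open>\<theta>\<close> applied to them.\<close>

lemma dual_mult_one:
  assumes \<theta>: "\<theta> \<in> carrier D"
  shows "\<one>\<^bsub>D\<^esub> \<otimes>\<^bsub>D\<^esub> \<theta> = \<theta>" and "\<theta> \<otimes>\<^bsub>D\<^esub> \<one>\<^bsub>D\<^esub> = \<theta>"
proof -
  note VH = vectorspace_H and VK = base.vectorspace_base
  note \<epsilon> = base.hom_closed[OF counit_Hom, simplified]
  have trans: "tensor_lift KK g (comult H h) = \<theta> (tensor_lift H f (comult H h))"
    if f: "bilinear K H H H f" and h: "h \<in> carrier H"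
      and eq: "\<And>a b. a \<in> carrier H \<Longrightarrow> b \<in> carrier H \<Longrightarrow> g a b = \<theta> (f a b)" for f g h
    using base.hom_tensor_lift[OF VH VH VH VK f dualD[OF \<theta>] comult_closed[OF h]]
      base.tensor_lift_cong[OF VH VH comult_closed[OF h], of g "\<lambda>a b. \<theta> (f a b)" KK] eq by simp
  have l: "bilinear K H H H (\<lambda>a b. counit H a \<odot>\<^bsub>H\<^esub> b)"
    by (rule base.bilinear_comp[OF base.bilinear_smult[OF VH] counit_Hom base.hom_id])
  note sm = base.hom_smult[OF dualD[OF \<theta>] \<epsilon>] and ev = dual_eval_closed[OF \<theta>]
  show "\<one>\<^bsub>D\<^esub> \<otimes>\<^bsub>D\<^esub> \<theta> = \<theta>"
    using dual_mult_closed[OF dual_one_closed \<theta>] \<theta>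
    by (rule dual_eqI) (simp add: trans[OF l] sm counit_left)
  show "\<theta> \<otimes>\<^bsub>D\<^esub> \<one>\<^bsub>D\<^esub> = \<theta>"
    using dual_mult_closed[OF \<theta> dual_one_closed] \<theta>
    by (rule dual_eqI)
      (simp add: trans[OF base.bilinear_swap[OF l]] sm counit_right base.scalar_m_comm \<epsilon> ev)
qed

lemma unital_algebra_D [simp]: "unital_algebra K D"
proof -
  note m = bilinear_dual_mult
  have "ring D"
    using base.vs_group[OF vectorspace_D]
    by (intro ringI monoidI) (simp_all del: dual_simps add: dual_mult_closed dual_one_closed
        dual_mult_assoc dual_mult_one base.hom_add[OF base.bilinearD(1)[OF m]]
        base.hom_add[OF base.bilinearD(2)[OF m]])
  then show ?thesis
    using vectorspace_D
    by (intro unital_algebra.intro unital_algebra_axioms.intro)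
      (simp_all del: dual_simps add: base.hom_smult[OF base.bilinearD(1)[OF m]]
        base.hom_smult[OF base.bilinearD(2)[OF m]])
qed

section \<open>Evaluation of the dual leg\<close>

definition ev :: "('k, 'v, 'm) module_scheme \<Rightarrow> 'h \<Rightarrow> ('v \<times> ('h \<Rightarrow> 'k)) list set \<Rightarrow> 'v" where
  "ev V h = tensor_lift V (\<lambda>v \<theta>. \<theta> h \<odot>\<^bsub>V\<^esub> v)"

context
  fixes V :: "('k, 'v, 'm) module_scheme"
  assumes V: "vectorspace K V"
begin

lemma bilinear_ev:
  assumes "h \<in> carrier H"
  shows "bilinear K V D V (\<lambda>v \<theta>. \<theta> h \<odot>\<^bsub>V\<^esub> v)"
  by (rule base.bilinear_swap
      [OF base.bilinear_comp[OF base.bilinear_smult[OF V] dual_eval_hom[OF assms] base.hom_id]])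

lemma ev_Hom: "h \<in> carrier H \<Longrightarrow> ev V h \<in> Hom (V \<boxtimes> D) V"
  unfolding ev_def by (intro base.tensor_lift_hom V vectorspace_D bilinear_ev)

lemma ev_elem:
  "h \<in> carrier H \<Longrightarrow> v \<in> carrier V \<Longrightarrow> \<theta> \<in> carrier D \<Longrightarrow>
    ev V h (tensor_elem K V D v \<theta>) = \<theta> h \<odot>\<^bsub>V\<^esub> v"
  unfolding ev_def by (intro base.tensor_lift_elem V vectorspace_D bilinear_ev)

lemma ev_Hom_point:
  assumes "t \<in> carrier (V \<boxtimes> D)"
  shows "(\<lambda>h. ev V h t) \<in> Hom H V"
  unfolding ev_def
  by (rule base.hom_lift_param[OF V vectorspace_D V vectorspace_H assms bilinear_ev])
    (assumption, rule base.bilinear_hom_left[OF base.bilinear_smult[OF V] dualD])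

text \<open>On \<open>v \<otimes> \<theta>\<close> this is the expansion of \<open>\<theta>\<close> in the dual basis, the scalars being moved across the
  tensor sign. Finite dimension enters here, as the sum over the basis has to be finite.\<close>

lemma ev_expansion:
  assumes t: "t \<in> carrier (V \<boxtimes> D)"
  shows "(\<Oplus>\<^bsub>V \<boxtimes> D\<^esub>b\<in>B. tensor_elem K V D (ev V b t) (dual_vec b)) = t"
proof -
  let ?T = "V \<boxtimes> D"
  note T = base.tensor_vectorspace[OF V vectorspace_D]
  note te = base.bilinear_tensor_elem[OF V vectorspace_D]
  have BH: "b \<in> carrier H" if "b \<in> B" for b using B_subset that by blast
  show ?thesis
  proof (rule base.tensor_hom_ext[OF V vectorspace_D T _ base.hom_id t])
    show "(\<lambda>t. \<Oplus>\<^bsub>?T\<^esub>b\<in>B. tensor_elem K V D (ev V b t) (dual_vec b)) \<in> Hom ?T ?T"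
      by (rule base.finsum_hom[OF T T finite_B])
        (rule base.bilinear_hom_left[OF te ev_Hom[OF BH] dual_vec_props])
    fix v \<theta> assume v: "v \<in> carrier V" and \<theta>: "\<theta> \<in> carrier D"
    have cl: "\<theta> b \<in> carrier K" if "b \<in> B" for b using dual_eval_closed[OF \<theta> BH[OF that]] .
    have cl': "\<theta> b \<odot>\<^bsub>D\<^esub> dual_vec b \<in> carrier D" if "b \<in> B" for b
      using base.vs_closed(3)[OF vectorspace_D cl[OF that] dual_vec_props[OF that]] .
    have "(\<Oplus>\<^bsub>?T\<^esub>b\<in>B. tensor_elem K V D (ev V b (tensor_elem K V D v \<theta>)) (dual_vec b)) =
        (\<Oplus>\<^bsub>?T\<^esub>b\<in>B. tensor_elem K V D v (\<theta> b \<odot>\<^bsub>D\<^esub> dual_vec b))"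
      using cl cl' v
      by (intro abelian_monoid.finsum_cong'[OF base.vs_monoid[OF T]])
        (auto simp: ev_elem[OF BH v \<theta>] base.tensor_elem_smult_right[OF V vectorspace_D]
          dual_vec_props V simp del: dual_simps)
    also have "\<dots> = tensor_elem K V D v (\<Oplus>\<^bsub>D\<^esub>b\<in>B. \<theta> b \<odot>\<^bsub>D\<^esub> dual_vec b)"
      using cl' by (intro base.hom_finsum[OF vectorspace_D T base.bilinearD(1)[OF te v] finite_B,
            symmetric]) blast
    finally show "(\<Oplus>\<^bsub>?T\<^esub>b\<in>B. tensor_elem K V D (ev V b (tensor_elem K V D v \<theta>)) (dual_vec b)) =
        tensor_elem K V D v \<theta>"
      by (simp only: dual_expansion[OF \<theta>])
  qed
qed

lemma ev_eqI:
  assumes s: "s \<in> carrier (V \<boxtimes> D)" and t: "t \<in> carrier (V \<boxtimes> D)"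
    and eq: "\<And>h. h \<in> carrier H \<Longrightarrow> ev V h s = ev V h t"
  shows "s = t"
proof -
  note T = base.tensor_vectorspace[OF V vectorspace_D]
  have "(\<Oplus>\<^bsub>V \<boxtimes> D\<^esub>b\<in>B. tensor_elem K V D (ev V b s) (dual_vec b)) =
      (\<Oplus>\<^bsub>V \<boxtimes> D\<^esub>b\<in>B. tensor_elem K V D (ev V b t) (dual_vec b))"
    using eq B_subset base.hom_closed[OF ev_Hom t] dual_vec_props
    by (intro abelian_monoid.finsum_cong'[OF base.vs_monoid[OF T]]) (auto simp: subset_eq)
  then show ?thesis by (simp add: ev_expansion s t)
qed

end

lemma ev_natural:
  assumes V: "vectorspace K V" and W: "vectorspace K W" and f: "f \<in> Hom V W"
    and h: "h \<in> carrier H" and t: "t \<in> carrier (V \<boxtimes> D)"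
  shows "ev W h (tensor_map K W D f id t) = f (ev V h t)"
proof -
  have id: "id \<in> Hom D D" using base.hom_id[of D] by (simp add: id_def)
  note m = base.tensor_map_hom[OF V vectorspace_D W vectorspace_D f id]
  show ?thesis
    by (rule base.tensor_hom_ext[OF V vectorspace_D W base.hom_comp[OF m ev_Hom[OF W h]]
          base.hom_comp[OF ev_Hom[OF V h] f] t])
      (simp add: base.tensor_map_elem[OF V vectorspace_D W vectorspace_D f id] ev_elem V W h
        base.hom_closed[OF f] base.hom_smult[OF f] dual_eval_closed)
qed

text \<open>On elementary tensors both sides equal \<open>\<theta>(h\<^sub>(\<^sub>1\<^sub>)) \<phi>(h\<^sub>(\<^sub>2\<^sub>)) a c\<close>, as the product of functionals is
  convolution.\<close>

lemma ev_mult: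
  assumes A: "unital_algebra K A" and h: "h \<in> carrier H"
    and s: "s \<in> carrier (A \<boxtimes> D)" and t: "t \<in> carrier (A \<boxtimes> D)"
  shows "ev A h (s \<otimes>\<^bsub>A \<boxtimes> D\<^esub> t) =
    tensor_lift A (\<lambda>h1 h2. ev A h1 s \<otimes>\<^bsub>A\<^esub> ev A h2 t) (comult H h)"
proof -
  let ?T = "A \<boxtimes> D"
  let ?R = "\<lambda>s t. tensor_lift A (\<lambda>h1 h2. ev A h1 s \<otimes>\<^bsub>A\<^esub> ev A h2 t) (comult H h)"
  note VA = base.unital_algebra_vectorspace[OF A]
  note T = base.tensor_vectorspace[OF VA vectorspace_D]
  note mA = base.bilinear_mult[OF A] and mT = base.bilinear_tensor_mult[OF A unital_algebra_D]
  note \<Delta> = comult_closed[OF h]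
  have int: "bilinear K H H A (\<lambda>h1 h2. ev A h1 s \<otimes>\<^bsub>A\<^esub> ev A h2 t)"
    if "s \<in> carrier ?T" "t \<in> carrier ?T" for s t
    by (rule base.bilinear_comp[OF mA ev_Hom_point[OF VA that(1)] ev_Hom_point[OF VA that(2)]])
  note evc = base.hom_closed[OF ev_Hom[OF VA]]
  have R1: "(\<lambda>s. ?R s t) \<in> Hom ?T A" if "t \<in> carrier ?T" for t
    by (rule base.hom_lift_param[OF vectorspace_H vectorspace_H VA T \<Delta>])
      (auto intro!: int base.bilinear_hom_left[OF mA] ev_Hom VA evc that)
  have R2: "(\<lambda>t. ?R s t) \<in> Hom ?T A" if "s \<in> carrier ?T" for s
    by (rule base.hom_lift_param[OF vectorspace_H vectorspace_H VA T \<Delta>])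
      (auto intro!: int base.bilinear_hom_right[OF mA] ev_Hom VA evc that)
  have L1: "(\<lambda>s. ev A h (s \<otimes>\<^bsub>?T\<^esub> t)) \<in> Hom ?T A" if "t \<in> carrier ?T" for t
    by (rule base.hom_comp[OF base.bilinearD(2)[OF mT that] ev_Hom[OF VA h]])
  have L2: "(\<lambda>t. ev A h (s \<otimes>\<^bsub>?T\<^esub> t)) \<in> Hom ?T A" if "s \<in> carrier ?T" for s
    by (rule base.hom_comp[OF base.bilinearD(1)[OF mT that] ev_Hom[OF VA h]])
  show ?thesis
  proof (rule base.tensor_hom_ext[OF VA vectorspace_D VA L1[OF t] R1[OF t] s])
    fix a \<theta> assume a: "a \<in> carrier A" and \<theta>: "\<theta> \<in> carrier D"
    let ?s = "tensor_elem K A D a \<theta>"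
    have s: "?s \<in> carrier ?T" using a \<theta> by simp
    show "ev A h (?s \<otimes>\<^bsub>?T\<^esub> t) = ?R ?s t"
    proof (rule base.tensor_hom_ext[OF VA vectorspace_D VA L2[OF s] R2[OF s] t])
      fix c \<phi> assume c: "c \<in> carrier A" and \<phi>: "\<phi> \<in> carrier D"
      have ac: "a \<otimes>\<^bsub>A\<^esub> c \<in> carrier A" using base.bilinear_closed[OF mA a c] .
      interpret A: unital_algebra K A by (rule A)
      have "ev A h (?s \<otimes>\<^bsub>?T\<^esub> tensor_elem K A D c \<phi>) = (\<theta> \<otimes>\<^bsub>D\<^esub> \<phi>) h \<odot>\<^bsub>A\<^esub> (a \<otimes>\<^bsub>A\<^esub> c)"
        using a c \<theta> \<phi> ac h
        by (simp add: base.tensor_mult_elem[OF A unital_algebra_D] ev_elem[OF VA] dual_mult_closed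
            del: dual_simps)
      also have "\<dots> = tensor_lift KK (\<lambda>h1 h2. \<theta> h1 \<otimes>\<^bsub>K\<^esub> \<phi> h2) (comult H h) \<odot>\<^bsub>A\<^esub> (a \<otimes>\<^bsub>A\<^esub> c)"
        using h by simp
      also have "\<dots> = tensor_lift A (\<lambda>h1 h2. (\<theta> h1 \<otimes>\<^bsub>K\<^esub> \<phi> h2) \<odot>\<^bsub>A\<^esub> (a \<otimes>\<^bsub>A\<^esub> c)) (comult H h)"
        using base.bilinearD(2)[OF base.bilinear_smult[OF VA] ac]
        by (intro base.hom_tensor_lift[OF vectorspace_H vectorspace_H base.vectorspace_base VA
              bilinear_dual_mult_integrand[OF \<theta> \<phi>] _ \<Delta>]) simp
      also have "\<dots> = ?R ?s (tensor_elem K A D c \<phi>)"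
      proof (rule base.tensor_lift_cong[OF vectorspace_H vectorspace_H \<Delta>])
        fix h1 h2 assume h12: "h1 \<in> carrier H" "h2 \<in> carrier H"
        note k = dual_eval_closed[OF \<theta> h12(1)] dual_eval_closed[OF \<phi> h12(2)]
        show "(\<theta> h1 \<otimes>\<^bsub>K\<^esub> \<phi> h2) \<odot>\<^bsub>A\<^esub> (a \<otimes>\<^bsub>A\<^esub> c) =
            ev A h1 ?s \<otimes>\<^bsub>A\<^esub> ev A h2 (tensor_elem K A D c \<phi>)"
          using k a c ac
          by (simp add: ev_elem[OF VA] h12 \<theta> \<phi> A.smult_mult_left A.smult_mult_right
              base.smult_smult[OF VA] base.scalar_m_comm VA)
      qed
      finally show "ev A h (?s \<otimes>\<^bsub>?T\<^esub> tensor_elem K A D c \<phi>) = ?R ?s (tensor_elem K A D c \<phi>)" .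
    qed
  qed
qed

subsection \<open>The comultiplication of the dual\<close>

lemma tensor_dual_algebra:
  "tensor K (dual_algebra K H) (dual_algebra K H) = D \<boxtimes> D"
proof -
  have "tensor_eq K (dual_algebra K H) (dual_algebra K H) = tensor_eq K D D"
    by (intro ext iffI; erule base.tensor_eq_cong) (simp_all add: dual_hopf_def module.defs)
  then show ?thesis
    by (simp add: tensor_def tensor_class_def[abs_def] tensor_elem_def dual_hopf_def module.defs)
qed

lemma bilinear_ev2:
  assumes "h \<in> carrier H" "h' \<in> carrier H"
  shows "bilinear K D D KK (\<lambda>\<phi> \<psi>. \<phi> h \<otimes>\<^bsub>K\<^esub> \<psi> h')"
  using base.bilinear_comp[OF base.bilinear_mult[OF base.unital_algebra_base]
    dual_eval_hom[OF assms(1)] dual_eval_hom[OF assms(2)]] by simp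

abbreviation ev2 :: "'h \<Rightarrow> 'h \<Rightarrow> (('h \<Rightarrow> 'k) \<times> ('h \<Rightarrow> 'k)) list set \<Rightarrow> 'k" where
  "ev2 h h' \<equiv> tensor_lift KK (\<lambda>\<phi> \<psi>. \<phi> h \<otimes>\<^bsub>K\<^esub> \<psi> h')"

lemma ev2_Hom: "h \<in> carrier H \<Longrightarrow> h' \<in> carrier H \<Longrightarrow> ev2 h h' \<in> Hom (D \<boxtimes> D) KK"
  by (intro base.tensor_lift_hom vectorspace_D base.vectorspace_base bilinear_ev2)

lemma ev2_elem:
  assumes "h \<in> carrier H" "h' \<in> carrier H" "\<phi> \<in> carrier D" "\<psi> \<in> carrier D"
  shows "ev2 h h' (tensor_elem K D D \<phi> \<psi>) = \<phi> h \<otimes>\<^bsub>K\<^esub> \<psi> h'"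
  using assms by (intro base.tensor_lift_elem vectorspace_D base.vectorspace_base bilinear_ev2)

text \<open>Evaluating first the right and then the left leg separates the elements of \<open>D \<otimes> D\<close>.\<close>

lemma ev2_eqI:
  assumes s: "s \<in> carrier (D \<boxtimes> D)" and t: "t \<in> carrier (D \<boxtimes> D)"
    and eq: "\<And>h h'. h \<in> carrier H \<Longrightarrow> h' \<in> carrier H \<Longrightarrow> ev2 h h' s = ev2 h h' t"
  shows "s = t"
proof (rule ev_eqI[OF vectorspace_D s t])
  fix h' assume h': "h' \<in> carrier H"
  note evc = base.hom_closed[OF ev_Hom[OF vectorspace_D h']]
  have 1: "ev D h' u h = ev2 h h' u" if u: "u \<in> carrier (D \<boxtimes> D)" and h: "h \<in> carrier H" for u h
    by (rule base.tensor_hom_ext[OF vectorspace_D vectorspace_D base.vectorspace_base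
          base.hom_comp[OF ev_Hom[OF vectorspace_D h'] dual_eval_hom[OF h]] ev2_Hom[OF h h'] u])
      (simp add: ev_elem[OF vectorspace_D h'] ev2_elem h h' base.scalar_m_comm dual_eval_closed)
  show "ev D h' s = ev D h' t"
    by (rule dual_eqI[OF evc[OF s] evc[OF t]]) (simp add: 1 s t eq h')
qed

text \<open>The defining description of the comultiplication of the dual is met by exactly one tensor:
  uniqueness is separation by pairs of points, and a witness is
  \<open>\<Sum>\<^sub>b \<theta>(\<cdot> b) \<otimes> b\<^sup>*\<close>, whose value at \<open>(h, h')\<close> is \<open>\<theta>\<close> applied to \<open>h\<close> times the expansion of \<open>h'\<close>.\<close>

lemma dual_comult:
  assumes \<theta>: "\<theta> \<in> carrier D"
  shows "dual_comult K H \<theta> \<in> carrier (D \<boxtimes> D)"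
    and "\<And>h h'. h \<in> carrier H \<Longrightarrow> h' \<in> carrier H \<Longrightarrow>
      ev2 h h' (dual_comult K H \<theta>) = \<theta> (h \<otimes>\<^bsub>H\<^esub> h')"
proof -
  let ?P = "\<lambda>t. t \<in> carrier (D \<boxtimes> D) \<and>
    (\<forall>h\<in>carrier H. \<forall>h'\<in>carrier H. \<theta> (h \<otimes>\<^bsub>H\<^esub> h') = ev2 h h' t)"
  let ?f = "\<lambda>b. \<lambda>h\<in>carrier H. \<theta> (h \<otimes>\<^bsub>H\<^esub> b)"
  let ?g = "\<lambda>b. tensor_elem K D D (?f b) (dual_vec b)"
  let ?t = "\<Oplus>\<^bsub>D \<boxtimes> D\<^esub>b\<in>B. ?g b"
  note mH = base.bilinear_mult[OF unital_algebra_H]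
  note DD = base.tensor_vectorspace[OF vectorspace_D vectorspace_D]
  have BH: "b \<in> carrier H" if "b \<in> B" for b using B_subset that by blast
  have f: "?f b \<in> carrier D" if "b \<in> B" for b
    by (rule dualI) (rule base.hom_comp[OF base.bilinearD(2)[OF mH BH[OF that]] dualD[OF \<theta>]])
  have g: "?g \<in> B \<rightarrow> carrier (D \<boxtimes> D)"
    using f dual_vec_props by (intro Pi_I base.tensor_elem_closed)
  have "?P ?t"
  proof (intro conjI ballI)
    show "?t \<in> carrier (D \<boxtimes> D)"
      by (rule abelian_monoid.finsum_closed[OF base.vs_monoid[OF DD] g])
    fix h h' assume h: "h \<in> carrier H" and h': "h' \<in> carrier H"
    have hom: "(\<lambda>x. \<theta> (h \<otimes>\<^bsub>H\<^esub> x)) \<in> Hom H KK"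
      by (rule base.hom_comp[OF base.bilinearD(1)[OF mH h] dualD[OF \<theta>]])
    have "ev2 h h' ?t = (\<Oplus>\<^bsub>KK\<^esub>b\<in>B. ev2 h h' (?g b))"
      by (rule base.hom_finsum[OF DD base.vectorspace_base ev2_Hom[OF h h'] finite_B g])
    also have "\<dots> = (\<Oplus>\<^bsub>KK\<^esub>b\<in>B. dual_vec b h' \<odot>\<^bsub>KK\<^esub> \<theta> (h \<otimes>\<^bsub>H\<^esub> b))"
      using base.hom_closed[OF hom BH] dual_eval_closed[OF dual_vec_props h']
      by (intro abelian_monoid.finsum_cong'[OF base.vs_monoid[OF base.vectorspace_base]])
        (auto simp: ev2_elem[OF h h' f dual_vec_props] h base.scalar_m_comm)
    also have "\<dots> = \<theta> (h \<otimes>\<^bsub>H\<^esub> h')"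
      by (rule functional_expansion[OF base.vectorspace_base hom h'])
    finally show "\<theta> (h \<otimes>\<^bsub>H\<^esub> h') = ev2 h h' ?t" ..
  qed
  moreover have "t = ?t" if "?P t" for t
    using that \<open>?P ?t\<close> by (intro ev2_eqI) auto
  ultimately have "?P (THE t. ?P t)"
    by (rule theI)
  then have "?P (dual_comult K H \<theta>)"
    unfolding dual_comult_def tensor_dual_algebra pairing_def .
  then show "dual_comult K H \<theta> \<in> carrier (D \<boxtimes> D)"
    and "\<And>h h'. h \<in> carrier H \<Longrightarrow> h' \<in> carrier H \<Longrightarrow>
      ev2 h h' (dual_comult K H \<theta>) = \<theta> (h \<otimes>\<^bsub>H\<^esub> h')" by simp_all
qed

lemma dual_comult_Hom: "dual_comult K H \<in> Hom D (D \<boxtimes> D)"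
proof (rule base.homI[OF dual_comult(1)])
  note DD = base.tensor_vectorspace[OF vectorspace_D vectorspace_D]
  note add = base.vs_closed(2)[OF vectorspace_D] and sm = base.vs_closed(3)[OF vectorspace_D]
  note addD = base.vs_closed(2)[OF DD] and smD = base.vs_closed(3)[OF DD]
  show "dual_comult K H (\<theta> \<oplus>\<^bsub>D\<^esub> \<phi>) = dual_comult K H \<theta> \<oplus>\<^bsub>D \<boxtimes> D\<^esub> dual_comult K H \<phi>"
    if t: "\<theta> \<in> carrier D" "\<phi> \<in> carrier D" for \<theta> \<phi>
    using dual_comult(1)[OF t(1)] dual_comult(1)[OF t(2)]
    by (intro ev2_eqI dual_comult(1) add addD t)
      (simp add: base.hom_add[OF ev2_Hom] dual_comult(2) add t del: dual_simps,
       simp)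
  show "dual_comult K H (a \<odot>\<^bsub>D\<^esub> \<theta>) = a \<odot>\<^bsub>D \<boxtimes> D\<^esub> dual_comult K H \<theta>"
    if t: "a \<in> carrier K" "\<theta> \<in> carrier D" for a \<theta>
    using dual_comult(1)[OF t(2)]
    by (intro ev2_eqI dual_comult(1) sm smD t)
      (simp add: base.hom_smult[OF ev2_Hom] dual_comult(2) sm t del: dual_simps,
       simp)
qed

subsection \<open>The action induced by a coaction of the dual\<close>

lemma induced_action_eq_ev: "induced_action X \<beta> h x = ev X h (\<beta> x)"
  by (simp add: induced_action_def ev_def pairing_def)

text \<open>The clauses of an action are the clauses of a coaction after evaluation: the counit of the
  dual is evaluation at \<open>1\<close>, its unit is the counit of \<open>H\<close>, its comultiplication is dual to the
  product of \<open>H\<close>, and its product is dual to the comultiplication of \<open>H\<close>.\<close>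

lemma induced_left_action:
  fixes X :: "('k, 'x) module"
  assumes X: "unital_algebra K X" and \<beta>: "right_coaction K D X \<beta>"
  shows "left_action K H X (induced_action X \<beta>)"
proof -
  note VX = base.unital_algebra_vectorspace[OF X]
  note XD = base.tensor_vectorspace[OF VX vectorspace_D]
  note DD = base.tensor_vectorspace[OF vectorspace_D vectorspace_D]
  from \<beta> have \<beta>hom: "\<beta> \<in> ring_hom X (X \<boxtimes> D)" and \<beta>Hom: "\<beta> \<in> Hom X (X \<boxtimes> D)"
    and \<beta>assoc: "\<And>x. x \<in> carrier X \<Longrightarrow>
      tensor_assoc K X D D (tensor_map K (X \<boxtimes> D) D \<beta> id (\<beta> x)) =
      tensor_map K X (D \<boxtimes> D) id (dual_comult K H) (\<beta> x)"
    and \<beta>counit: "\<And>x. x \<in> carrier X \<Longrightarrow> tensor_lift X (\<lambda>y \<theta>. \<theta> \<one>\<^bsub>H\<^esub> \<odot>\<^bsub>X\<^esub> y) (\<beta> x) = x"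
    by (simp_all add: right_coaction_def algebra_hom_def)
  note \<beta>c = base.hom_closed[OF \<beta>Hom]
  have act: "ev X (h \<otimes>\<^bsub>H\<^esub> h') (\<beta> x) = ev X h (\<beta> (ev X h' (\<beta> x)))"
    if h: "h \<in> carrier H" and h': "h' \<in> carrier H" and x: "x \<in> carrier X" for h h' x
  proof -
    let ?f = "\<lambda>y \<phi> \<psi>. (\<phi> h \<otimes>\<^bsub>K\<^esub> \<psi> h') \<odot>\<^bsub>X\<^esub> y"
    let ?R = "\<lambda>y t. tensor_lift X (?f y) t" and ?L = "\<lambda>t \<psi>. tensor_lift X (\<lambda>y \<phi>. ?f y \<phi> \<psi>) t"
    note sm = base.bilinear_smult[OF VX]
    note mK = base.bilinear_mult[OF base.unital_algebra_base, simplified]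
    have id: "id \<in> Hom X X" "id \<in> Hom D D"
      using base.hom_id[of X] base.hom_id[of D] by (simp_all add: id_def)
    have tri: "base.trilinear X D D X ?f"
      using h h'
      by (intro base.trilinearI base.bilinear_hom_left[OF sm] base.bilinear_hom_right[OF sm]
          base.bilinear_hom_left[OF mK] base.bilinear_hom_right[OF mK] dual_eval_hom base.hom_id)
        (auto simp: dual_eval_closed base.scalar_m_closed)
    note R = base.trilinear_lift_right[OF VX vectorspace_D vectorspace_D VX tri]
    note L = base.trilinear_lift_left[OF VX vectorspace_D vectorspace_D VX tri]
    have "ev X (h \<otimes>\<^bsub>H\<^esub> h') (\<beta> x) =
        tensor_lift X (\<lambda>y \<theta>. ?R (id y) (dual_comult K H \<theta>)) (\<beta> x)"
      unfolding ev_def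
    proof (rule base.tensor_lift_cong[OF VX vectorspace_D \<beta>c[OF x]])
      fix y \<theta> assume y: "y \<in> carrier X" and \<theta>: "\<theta> \<in> carrier D"
      have "(\<lambda>c. c \<odot>\<^bsub>X\<^esub> y) \<in> Hom KK X" by (rule base.bilinearD(2)[OF sm y])
      from base.hom_tensor_lift[OF vectorspace_D vectorspace_D base.vectorspace_base VX
          bilinear_ev2[OF h h'] this dual_comult(1)[OF \<theta>]]
      show "\<theta> (h \<otimes>\<^bsub>H\<^esub> h') \<odot>\<^bsub>X\<^esub> y = ?R (id y) (dual_comult K H \<theta>)"
        by (simp add: dual_comult(2)[OF \<theta> h h'])
    qed
    also have "\<dots> = tensor_lift X ?R (tensor_map K X (D \<boxtimes> D) id (dual_comult K H) (\<beta> x))"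
      by (rule base.tensor_lift_map[OF VX vectorspace_D VX DD VX id(1) dual_comult_Hom R \<beta>c[OF x],
            symmetric])
    also have "\<dots> = tensor_lift X ?R (tensor_assoc K X D D (tensor_map K (X \<boxtimes> D) D \<beta> id (\<beta> x)))"
      by (simp add: \<beta>assoc[OF x])
    also have "\<dots> = tensor_lift X ?L (tensor_map K (X \<boxtimes> D) D \<beta> id (\<beta> x))"
      by (rule base.tensor_lift_assoc[OF VX vectorspace_D vectorspace_D VX tri])
        (rule base.hom_closed[OF base.tensor_map_hom[OF VX vectorspace_D XD vectorspace_D \<beta>Hom id(2)]
          \<beta>c[OF x]])
    also have "\<dots> = tensor_lift X (\<lambda>y \<psi>. ?L (\<beta> y) (id \<psi>)) (\<beta> x)"
      by (rule base.tensor_lift_map[OF VX vectorspace_D XD vectorspace_D VX \<beta>Hom id(2) L \<beta>c[OF x]])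
    also have "\<dots> = tensor_lift X (\<lambda>y \<psi>. ev X h (\<beta> (\<psi> h' \<odot>\<^bsub>X\<^esub> y))) (\<beta> x)"
    proof (rule base.tensor_lift_cong[OF VX vectorspace_D \<beta>c[OF x]])
      fix y \<psi> assume y: "y \<in> carrier X" and \<psi>: "\<psi> \<in> carrier D"
      have k: "\<psi> h' \<in> carrier K" by (rule dual_eval_closed[OF \<psi> h'])
      have "ev X h (\<beta> (\<psi> h' \<odot>\<^bsub>X\<^esub> y)) = \<psi> h' \<odot>\<^bsub>X\<^esub> ev X h (\<beta> y)"
        using base.hom_smult[OF base.hom_comp[OF \<beta>Hom ev_Hom[OF VX h]] k y] .
      also have "\<dots> = tensor_lift X (\<lambda>z \<phi>. \<psi> h' \<odot>\<^bsub>X\<^esub> (\<phi> h \<odot>\<^bsub>X\<^esub> z)) (\<beta> y)"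
        unfolding ev_def
        by (rule base.hom_tensor_lift[OF VX vectorspace_D VX VX bilinear_ev[OF VX h]
              base.hom_scale[OF VX base.hom_id k] \<beta>c[OF y]])
      also have "\<dots> = ?L (\<beta> y) (id \<psi>)"
        by (rule base.tensor_lift_cong[OF VX vectorspace_D \<beta>c[OF y]])
          (simp add: k dual_eval_closed h base.scalar_m_comm
            base.smult_smult[OF VX])
      finally show "?L (\<beta> y) (id \<psi>) = ev X h (\<beta> (\<psi> h' \<odot>\<^bsub>X\<^esub> y))" ..
    qed
    also have "\<dots> = ev X h (\<beta> (ev X h' (\<beta> x)))"
      unfolding ev_def[of X h']
      by (rule base.hom_tensor_lift[OF VX vectorspace_D VX VX bilinear_ev[OF VX h']
            base.hom_comp[OF \<beta>Hom ev_Hom[OF VX h]] \<beta>c[OF x], symmetric])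
    finally show ?thesis .
  qed
  have one: "ev X h (\<beta> \<one>\<^bsub>X\<^esub>) = counit H h \<odot>\<^bsub>X\<^esub> \<one>\<^bsub>X\<^esub>" if h: "h \<in> carrier H" for h
    using ev_elem[OF VX h _ dual_one_closed, of "\<one>\<^bsub>X\<^esub>"] ring_hom_one[OF \<beta>hom] h
      monoid.one_closed[OF ring.is_monoid[OF base.unital_algebra_ring[OF X]]]
    by (simp add: base.tensor_one)
  show ?thesis
    unfolding left_action_def induced_action_eq_ev[abs_def]
    using base.hom_comp[OF \<beta>Hom ev_Hom[OF VX]] ev_Hom_point[OF VX \<beta>c] act one \<beta>counit
      ring_hom_mult[OF \<beta>hom] ev_mult[OF X _ \<beta>c \<beta>c]
    by (simp add: ev_def[of X "\<one>\<^bsub>H\<^esub>"])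
qed

section \<open>The Yetter--Drinfeld condition\<close>

context
  fixes X :: "('k, 'x) module"
  assumes X: "unital_algebra K X"
begin

abbreviation HX :: "('k, ('h \<times> 'x) list set) module" where "HX \<equiv> H \<boxtimes> X"
abbreviation XD :: "('k, ('x \<times> ('h \<Rightarrow> 'k)) list set) module" where "XD \<equiv> X \<boxtimes> D"
abbreviation HXD :: "('k, ('h \<times> ('x \<times> ('h \<Rightarrow> 'k)) list set) list set) module"
  where "HXD \<equiv> H \<boxtimes> X \<boxtimes> D"

definition ev3 :: "'h \<Rightarrow> ('h \<times> ('x \<times> ('h \<Rightarrow> 'k)) list set) list set \<Rightarrow> ('h \<times> 'x) list set" where
  "ev3 h = tensor_map K H X id (ev X h)"

lemma VX: "vectorspace K X"
  by (rule base.unital_algebra_vectorspace[OF X])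

lemma VHX: "vectorspace K HX" and VXD: "vectorspace K XD" and VHXD: "vectorspace K HXD"
  by (simp_all add: VX)

lemma AHX: "unital_algebra K HX" and AXD: "unital_algebra K XD" and AHXD: "unital_algebra K HXD"
  by (simp_all add: X)

lemma X_one_closed: "\<one>\<^bsub>X\<^esub> \<in> carrier X"
  by (rule monoid.one_closed[OF ring.is_monoid[OF base.unital_algebra_ring[OF X]]])

lemma X_mult_one:
  assumes "x \<in> carrier X"
  shows "\<one>\<^bsub>X\<^esub> \<otimes>\<^bsub>X\<^esub> x = x" "x \<otimes>\<^bsub>X\<^esub> \<one>\<^bsub>X\<^esub> = x"
  using assms ring.is_monoid[OF base.unital_algebra_ring[OF X]]
  by (simp_all add: monoid.l_one monoid.r_one)

lemma id_Hom: "id \<in> Hom V V"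
  using base.hom_id[of V] by (simp add: id_def)

lemma ev3_Hom: "h \<in> carrier H \<Longrightarrow> ev3 h \<in> Hom HXD HX"
  unfolding ev3_def by (intro base.tensor_map_hom vectorspace_H VXD VX id_Hom ev_Hom)

lemma ev3_elem:
  "h \<in> carrier H \<Longrightarrow> a \<in> carrier H \<Longrightarrow> s \<in> carrier XD \<Longrightarrow>
    ev3 h (tensor_elem K H XD a s) = tensor_elem K H X a (ev X h s)"
  unfolding ev3_def
  using base.tensor_map_elem[OF vectorspace_H VXD vectorspace_H VX id_Hom ev_Hom[OF VX]] by simp

lemma ev3_Hom_point:
  assumes t: "t \<in> carrier HXD"
  shows "(\<lambda>h. ev3 h t) \<in> Hom H HX"
  unfolding ev3_def tensor_map_def
proof (rule base.hom_lift_param[OF vectorspace_H VXD VHX vectorspace_H t])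
  note te = base.bilinear_tensor_elem[OF vectorspace_H VX]
  show "bilinear K H XD HX (\<lambda>a s. tensor_elem K H X (id a) (ev X h s))" if "h \<in> carrier H" for h
    by (rule base.bilinear_comp[OF te id_Hom ev_Hom[OF VX that]])
  show "(\<lambda>h. tensor_elem K H X (id a) (ev X h s)) \<in> Hom H HX"
    if "a \<in> carrier H" "s \<in> carrier XD" for a s
    using base.bilinear_hom_right[OF te ev_Hom_point[OF VX that(2)] that(1)] by simp
qed

text \<open>The expansion of \<open>X \<otimes> D\<close> by evaluations, tensored with \<open>H\<close> on the left.\<close>

lemma ev3_expansion:
  assumes t: "t \<in> carrier HXD"
  shows "(\<Oplus>\<^bsub>HXD\<^esub>b\<in>B. tensor_map K H XD id (\<lambda>x. tensor_elem K X D x (dual_vec b)) (ev3 b t)) = t"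
proof -
  let ?i = "\<lambda>b x. tensor_elem K X D x (dual_vec b)"
  have BH: "b \<in> carrier H" if "b \<in> B" for b using B_subset that by blast
  have i: "?i b \<in> Hom X XD" if "b \<in> B" for b
    by (rule base.bilinearD(2)[OF base.bilinear_tensor_elem[OF VX vectorspace_D] dual_vec_props[OF that]])
  note m = base.tensor_map_hom[OF vectorspace_H VX vectorspace_H VXD id_Hom i]
  note me = base.tensor_map_elem[OF vectorspace_H VX vectorspace_H VXD id_Hom i]
  show ?thesis
  proof (rule base.tensor_hom_ext[OF vectorspace_H VXD VHXD _ base.hom_id t])
    show "(\<lambda>t. \<Oplus>\<^bsub>HXD\<^esub>b\<in>B. tensor_map K H XD id (?i b) (ev3 b t)) \<in> Hom HXD HXD"
      by (rule base.finsum_hom[OF VHXD VHXD finite_B]) (rule base.hom_comp[OF ev3_Hom[OF BH] m])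
    fix a s assume a: "a \<in> carrier H" and s: "s \<in> carrier XD"
    note te = base.bilinearD(1)[OF base.bilinear_tensor_elem[OF vectorspace_H VXD] a]
    have cl: "?i b (ev X b s) \<in> carrier XD" "ev X b s \<in> carrier X" if "b \<in> B" for b
      using base.hom_closed[OF ev_Hom[OF VX BH[OF that]] s] base.hom_closed[OF i[OF that]] by auto
    have "(\<Oplus>\<^bsub>HXD\<^esub>b\<in>B. tensor_map K H XD id (?i b) (ev3 b (tensor_elem K H XD a s))) =
        (\<Oplus>\<^bsub>HXD\<^esub>b\<in>B. tensor_elem K H XD a (?i b (ev X b s)))"
      using cl a s
      by (intro abelian_monoid.finsum_cong'[OF base.vs_monoid[OF VHXD]])
        (auto simp: ev3_elem BH me)
    also have "\<dots> = tensor_elem K H XD a (\<Oplus>\<^bsub>XD\<^esub>b\<in>B. ?i b (ev X b s))"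
      using cl by (intro base.hom_finsum[OF VXD VHXD te finite_B, symmetric]) blast
    finally show "(\<Oplus>\<^bsub>HXD\<^esub>b\<in>B. tensor_map K H XD id (?i b) (ev3 b (tensor_elem K H XD a s))) =
        tensor_elem K H XD a s"
      by (simp only: ev_expansion[OF VX s])
  qed
qed

lemma ev3_eqI:
  assumes s: "s \<in> carrier HXD" and t: "t \<in> carrier HXD"
    and eq: "\<And>h. h \<in> carrier H \<Longrightarrow> ev3 h s = ev3 h t"
  shows "s = t"
proof -
  let ?m = "\<lambda>b. tensor_map K H XD id (\<lambda>x. tensor_elem K X D x (dual_vec b))"
  have BH: "b \<in> carrier H" if "b \<in> B" for b using B_subset that by blast
  have m: "?m b \<in> Hom HX HXD" if "b \<in> B" for b
    by (intro base.tensor_map_hom vectorspace_H VX VXD id_Hom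
        base.bilinearD(2)[OF base.bilinear_tensor_elem[OF VX vectorspace_D] dual_vec_props[OF that]])
  have "(\<Oplus>\<^bsub>HXD\<^esub>b\<in>B. ?m b (ev3 b s)) = (\<Oplus>\<^bsub>HXD\<^esub>b\<in>B. ?m b (ev3 b t))"
    using base.hom_closed[OF m base.hom_closed[OF ev3_Hom[OF BH] t]]
    by (intro abelian_monoid.finsum_cong'[OF base.vs_monoid[OF VHXD]]) (auto simp: eq BH)
  then show ?thesis by (simp add: ev3_expansion s t)
qed

text \<open>The first leg multiplies independently of the evaluation; in the other two legs this is
  the convolution formula for \<open>X \<otimes> D\<close>.\<close>

lemma ev3_mult:
  assumes h: "h \<in> carrier H" and s: "s \<in> carrier HXD" and t: "t \<in> carrier HXD"
  shows "ev3 h (s \<otimes>\<^bsub>HXD\<^esub> t) = tensor_lift HX (\<lambda>h1 h2. ev3 h1 s \<otimes>\<^bsub>HX\<^esub> ev3 h2 t) (comult H h)"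
proof -
  let ?R = "\<lambda>s t. tensor_lift HX (\<lambda>h1 h2. ev3 h1 s \<otimes>\<^bsub>HX\<^esub> ev3 h2 t) (comult H h)"
  note mA = base.bilinear_mult[OF AHX] and mT = base.bilinear_mult[OF AHXD]
    and mX = base.bilinear_mult[OF X] and mXD = base.bilinear_mult[OF AXD]
    and mH = base.bilinear_mult[OF unital_algebra_H]
  note \<Delta> = comult_closed[OF h]
  have int: "bilinear K H H HX (\<lambda>h1 h2. ev3 h1 s \<otimes>\<^bsub>HX\<^esub> ev3 h2 t)"
    if "s \<in> carrier HXD" "t \<in> carrier HXD" for s t
    by (rule base.bilinear_comp[OF mA ev3_Hom_point[OF that(1)] ev3_Hom_point[OF that(2)]])
  note ec = base.hom_closed[OF ev3_Hom]
  have R1: "(\<lambda>s. ?R s t) \<in> Hom HXD HX" if "t \<in> carrier HXD" for t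
    by (rule base.hom_lift_param[OF vectorspace_H vectorspace_H VHX VHXD \<Delta>])
      (auto intro!: int base.bilinear_hom_left[OF mA] ev3_Hom ec that)
  have R2: "(\<lambda>t. ?R s t) \<in> Hom HXD HX" if "s \<in> carrier HXD" for s
    by (rule base.hom_lift_param[OF vectorspace_H vectorspace_H VHX VHXD \<Delta>])
      (auto intro!: int base.bilinear_hom_right[OF mA] ev3_Hom ec that)
  have L1: "(\<lambda>s. ev3 h (s \<otimes>\<^bsub>HXD\<^esub> t)) \<in> Hom HXD HX" if "t \<in> carrier HXD" for t
    by (rule base.hom_comp[OF base.bilinearD(2)[OF mT that] ev3_Hom[OF h]])
  have L2: "(\<lambda>t. ev3 h (s \<otimes>\<^bsub>HXD\<^esub> t)) \<in> Hom HXD HX" if "s \<in> carrier HXD" for s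
    by (rule base.hom_comp[OF base.bilinearD(1)[OF mT that] ev3_Hom[OF h]])
  show ?thesis
  proof (rule base.tensor_hom_ext[OF vectorspace_H VXD VHX L1[OF t] R1[OF t] s])
    fix a p assume a: "a \<in> carrier H" and p: "p \<in> carrier XD"
    let ?s = "tensor_elem K H XD a p"
    have s: "?s \<in> carrier HXD" using a p by simp
    show "ev3 h (?s \<otimes>\<^bsub>HXD\<^esub> t) = ?R ?s t"
    proof (rule base.tensor_hom_ext[OF vectorspace_H VXD VHX L2[OF s] R2[OF s] t])
      fix c q assume c: "c \<in> carrier H" and q: "q \<in> carrier XD"
      note ac = base.bilinear_closed[OF mH a c]
      have "ev3 h (?s \<otimes>\<^bsub>HXD\<^esub> tensor_elem K H XD c q) =
          tensor_elem K H X (a \<otimes>\<^bsub>H\<^esub> c) (ev X h (p \<otimes>\<^bsub>XD\<^esub> q))"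
        using a c p q ac h base.bilinear_closed[OF mXD p q]
        by (simp add: base.tensor_mult_elem[OF unital_algebra_H AXD] ev3_elem)
      also have "\<dots> = tensor_elem K H X (a \<otimes>\<^bsub>H\<^esub> c)
          (tensor_lift X (\<lambda>h1 h2. ev X h1 p \<otimes>\<^bsub>X\<^esub> ev X h2 q) (comult H h))"
        by (simp add: ev_mult[OF X h p q])
      also have "\<dots> = tensor_lift HX (\<lambda>h1 h2. tensor_elem K H X (a \<otimes>\<^bsub>H\<^esub> c)
          (ev X h1 p \<otimes>\<^bsub>X\<^esub> ev X h2 q)) (comult H h)"
        by (rule base.hom_tensor_lift[OF vectorspace_H vectorspace_H VX VHX
              base.bilinear_comp[OF mX ev_Hom_point[OF VX p] ev_Hom_point[OF VX q]]
              base.bilinearD(1)[OF base.bilinear_tensor_elem[OF vectorspace_H VX] ac] \<Delta>])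
      also have "\<dots> = ?R ?s (tensor_elem K H XD c q)"
        by (rule base.tensor_lift_cong[OF vectorspace_H vectorspace_H \<Delta>])
          (simp add: ev3_elem a c p q base.tensor_mult_elem[OF unital_algebra_H X]
            base.hom_closed[OF ev_Hom[OF VX]])
      finally show "ev3 h (?s \<otimes>\<^bsub>HXD\<^esub> tensor_elem K H XD c q) = ?R ?s (tensor_elem K H XD c q)" .
    qed
  qed
qed

lemma ev3_assoc:
  assumes h: "h \<in> carrier H" and t: "t \<in> carrier (HX \<boxtimes> D)"
  shows "ev3 h (tensor_assoc K H X D t) = ev HX h t"
  by (rule base.tensor3_hom_ext_left[OF vectorspace_H VX vectorspace_D VHX
        base.hom_comp[OF base.tensor_assoc_hom[OF vectorspace_H VX vectorspace_D] ev3_Hom[OF h]]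
        ev_Hom[OF VHX h] t])
    (simp add: base.tensor_assoc_elem[OF vectorspace_H VX vectorspace_D] ev3_elem ev_elem VX VHX h
      dual_eval_closed base.tensor_smult_elem base.tensor_elem_smult_right)

lemma ev3_one:
  assumes h: "h \<in> carrier H"
  shows "ev3 h \<one>\<^bsub>HXD\<^esub> = counit H h \<odot>\<^bsub>HX\<^esub> tensor_elem K H X \<one>\<^bsub>H\<^esub> \<one>\<^bsub>X\<^esub>"
  using h base.hom_closed[OF counit_Hom h] X_one_closed dual_one_closed
  by (simp add: base.tensor_one ev3_elem ev_elem[OF VX h X_one_closed dual_one_closed]
      base.tensor_smult_elem VX del: dual_simps)
    (simp add: h VX base.tensor_elem_smult_right)

subsection \<open>The canonical element\<close>

text \<open>The element \<open>\<Sum>\<^sub>b f(b) \<otimes> 1 \<otimes> b\<^sup>*\<close>, which represents the map \<open>f\<close> by evaluation. The identity gives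
  \<open>U\<^sub>1\<^sub>3\<close> and the antipode gives its inverse \<open>(S \<otimes> id)(U)\<^sub>1\<^sub>3\<close>.\<close>

definition canon :: "('h \<Rightarrow> 'h) \<Rightarrow> ('h \<times> ('x \<times> ('h \<Rightarrow> 'k)) list set) list set" where
  "canon f = (\<Oplus>\<^bsub>HXD\<^esub>b\<in>B. tensor_elem K H XD (f b) (tensor_elem K X D \<one>\<^bsub>X\<^esub> (dual_vec b)))"

lemma canon:
  assumes f: "f \<in> Hom H H"
  shows "canon f \<in> carrier HXD"
    and "h \<in> carrier H \<Longrightarrow> ev3 h (canon f) = tensor_elem K H X (f h) \<one>\<^bsub>X\<^esub>"
proof -
  let ?g = "\<lambda>b. tensor_elem K H XD (f b) (tensor_elem K X D \<one>\<^bsub>X\<^esub> (dual_vec b))"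
  have fb: "f b \<in> carrier H" if "b \<in> B" for b
    using B_subset that base.hom_closed[OF f] by blast
  have g: "?g \<in> B \<rightarrow> carrier HXD"
    using fb dual_vec_props X_one_closed by (intro Pi_I base.tensor_elem_closed)
  show "canon f \<in> carrier HXD"
    unfolding canon_def by (rule abelian_monoid.finsum_closed[OF base.vs_monoid[OF VHXD] g])
  assume h: "h \<in> carrier H"
  have hom: "(\<lambda>b. tensor_elem K H X (f b) \<one>\<^bsub>X\<^esub>) \<in> Hom H HX"
    by (rule base.bilinear_hom_left[OF base.bilinear_tensor_elem[OF vectorspace_H VX] f X_one_closed])
  have "ev3 h (canon f) = (\<Oplus>\<^bsub>HX\<^esub>b\<in>B. ev3 h (?g b))"
    unfolding canon_def by (rule base.hom_finsum[OF VHXD VHX ev3_Hom[OF h] finite_B g])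
  also have "\<dots> = (\<Oplus>\<^bsub>HX\<^esub>b\<in>B. dual_vec b h \<odot>\<^bsub>HX\<^esub> tensor_elem K H X (f b) \<one>\<^bsub>X\<^esub>)"
    using fb X_one_closed dual_eval_closed[OF dual_vec_props h]
    by (intro abelian_monoid.finsum_cong'[OF base.vs_monoid[OF VHX]])
      (auto simp: ev3_elem h dual_vec_props ev_elem[OF VX] VX VHX base.tensor_smult_elem
        base.tensor_elem_smult_right)
  also have "\<dots> = tensor_elem K H X (f h) \<one>\<^bsub>X\<^esub>"
    by (rule functional_expansion[OF VHX hom h])
  finally show "ev3 h (canon f) = tensor_elem K H X (f h) \<one>\<^bsub>X\<^esub>" .
qed

lemma canonical_element_13_eq: "canonical_element_13 K H X = canon (\<lambda>h. h)"
proof -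
  let ?HD = "H \<boxtimes> D"
  have VHD: "vectorspace K ?HD" by simp
  have f: "bilinear K H D HXD (\<lambda>h \<theta>. tensor_elem K H XD h (tensor_elem K X D \<one>\<^bsub>X\<^esub> \<theta>))"
    by (rule base.bilinear_comp[OF base.bilinear_tensor_elem[OF vectorspace_H VXD] base.hom_id
          base.bilinearD(1)[OF base.bilinear_tensor_elem[OF VX vectorspace_D] X_one_closed]])
  have BH: "b \<in> carrier H" if "b \<in> B" for b using B_subset that by blast
  have g: "(\<lambda>b. tensor_elem K H D b (dual_vec b)) \<in> B \<rightarrow> carrier ?HD"
    using BH dual_vec_props by (intro Pi_I base.tensor_elem_closed)
  show ?thesis
    unfolding canonical_element_13_def canonical_element_def Let_def B_def[symmetric] canon_def
      base.hom_finsum[OF VHD VHXD base.tensor_lift_hom[OF vectorspace_H vectorspace_D VHXD f]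
        finite_B g]
    by (rule abelian_monoid.finsum_cong'[OF base.vs_monoid[OF VHXD]])
      (auto simp: base.tensor_lift_elem[OF vectorspace_H vectorspace_D VHXD f] BH dual_vec_props
        X_one_closed)
qed

text \<open>Under evaluation the product of two such elements represents the convolution of the two maps,
  and \<open>1\<close> represents the unit of convolution, \<open>h \<mapsto> \<epsilon>(h) 1\<close>.\<close>

lemma canon_mult:
  assumes f: "f \<in> Hom H H" and g: "g \<in> Hom H H"
    and conv: "\<And>h. h \<in> carrier H \<Longrightarrow>
      tensor_lift H (\<lambda>a b. f a \<otimes>\<^bsub>H\<^esub> g b) (comult H h) = counit H h \<odot>\<^bsub>H\<^esub> \<one>\<^bsub>H\<^esub>"
  shows "canon f \<otimes>\<^bsub>HXD\<^esub> canon g = \<one>\<^bsub>HXD\<^esub>"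
proof (rule ev3_eqI)
  interpret T: monoid HXD
    by (rule ring.is_monoid[OF base.unital_algebra_ring[OF AHXD]])
  show "canon f \<otimes>\<^bsub>HXD\<^esub> canon g \<in> carrier HXD" "\<one>\<^bsub>HXD\<^esub> \<in> carrier HXD"
    by (simp_all add: canon f g)
  fix h assume h: "h \<in> carrier H"
  note mH = base.bilinear_mult[OF unital_algebra_H]
  let ?e = "\<lambda>a. tensor_elem K H X a \<one>\<^bsub>X\<^esub>"
  have e: "?e \<in> Hom H HX"
    by (rule base.bilinearD(2)[OF base.bilinear_tensor_elem[OF vectorspace_H VX] X_one_closed])
  have "ev3 h (canon f \<otimes>\<^bsub>HXD\<^esub> canon g) =
      tensor_lift HX (\<lambda>a b. ev3 a (canon f) \<otimes>\<^bsub>HX\<^esub> ev3 b (canon g)) (comult H h)"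
    by (rule ev3_mult[OF h canon(1)[OF f] canon(1)[OF g]])
  also have "\<dots> = tensor_lift HX (\<lambda>a b. ?e (f a \<otimes>\<^bsub>H\<^esub> g b)) (comult H h)"
    by (rule base.tensor_lift_cong[OF vectorspace_H vectorspace_H comult_closed[OF h]])
      (simp add: canon f g base.tensor_mult_elem[OF unital_algebra_H X] base.hom_closed[OF f]
        base.hom_closed[OF g] X_one_closed X_mult_one)
  also have "\<dots> = ?e (tensor_lift H (\<lambda>a b. f a \<otimes>\<^bsub>H\<^esub> g b) (comult H h))"
    by (rule base.hom_tensor_lift[OF vectorspace_H vectorspace_H vectorspace_H VHX
          base.bilinear_comp[OF mH f g] e comult_closed[OF h], symmetric])
  also have "\<dots> = ev3 h \<one>\<^bsub>HXD\<^esub>"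
    using base.hom_closed[OF counit_Hom h]
    by (simp add: conv h ev3_one base.hom_smult[OF e])
  finally show "ev3 h (canon f \<otimes>\<^bsub>HXD\<^esub> canon g) = ev3 h \<one>\<^bsub>HXD\<^esub>" .
qed

lemma canonical_conjugate_iff:
  assumes z: "z \<in> carrier HXD" and w: "w \<in> carrier HXD"
  shows "z = Ad HXD (canonical_element_13 K H X) w \<longleftrightarrow>
    z \<otimes>\<^bsub>HXD\<^esub> canon (\<lambda>h. h) = canon (\<lambda>h. h) \<otimes>\<^bsub>HXD\<^esub> w"
proof -
  let ?U = "canon (\<lambda>h. h)" and ?V = "canon (antipode H)"
  interpret T: monoid HXD
    by (rule ring.is_monoid[OF base.unital_algebra_ring[OF AHXD]])
  have UV: "?U \<otimes>\<^bsub>HXD\<^esub> ?V = \<one>\<^bsub>HXD\<^esub>" and VU: "?V \<otimes>\<^bsub>HXD\<^esub> ?U = \<one>\<^bsub>HXD\<^esub>"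
    by (rule canon_mult, simp_all add: base.hom_id antipode_linear antipode_left antipode_right)+
  have U: "?U \<in> carrier HXD" and V: "?V \<in> carrier HXD"
    by (rule canon(1), rule base.hom_id antipode_linear)+
  have inv: "inv\<^bsub>HXD\<^esub> ?U = ?V"
    by (rule T.inv_char[OF U V UV VU])
  have "z = ?U \<otimes>\<^bsub>HXD\<^esub> w \<otimes>\<^bsub>HXD\<^esub> ?V \<longleftrightarrow> z \<otimes>\<^bsub>HXD\<^esub> ?U = ?U \<otimes>\<^bsub>HXD\<^esub> w"
  proof
    assume "z = ?U \<otimes>\<^bsub>HXD\<^esub> w \<otimes>\<^bsub>HXD\<^esub> ?V"
    then show "z \<otimes>\<^bsub>HXD\<^esub> ?U = ?U \<otimes>\<^bsub>HXD\<^esub> w"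
      using U V w VU by (simp add: T.m_assoc)
  next
    assume "z \<otimes>\<^bsub>HXD\<^esub> ?U = ?U \<otimes>\<^bsub>HXD\<^esub> w"
    then have "?U \<otimes>\<^bsub>HXD\<^esub> w \<otimes>\<^bsub>HXD\<^esub> ?V = z \<otimes>\<^bsub>HXD\<^esub> ?U \<otimes>\<^bsub>HXD\<^esub> ?V" by simp
    also have "\<dots> = z" using U V z UV by (simp add: T.m_assoc)
    finally show "z = ?U \<otimes>\<^bsub>HXD\<^esub> w \<otimes>\<^bsub>HXD\<^esub> ?V" ..
  qed
  then show ?thesis by (simp add: Ad_def canonical_element_13_eq inv)
qed

lemma HX_mult_elem_one:
  assumes s: "s \<in> carrier HX" and h: "h \<in> carrier H"
  shows "s \<otimes>\<^bsub>HX\<^esub> tensor_elem K H X h \<one>\<^bsub>X\<^esub> =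
      tensor_lift HX (\<lambda>a y. tensor_elem K H X (a \<otimes>\<^bsub>H\<^esub> h) y) s"
    and "tensor_elem K H X h \<one>\<^bsub>X\<^esub> \<otimes>\<^bsub>HX\<^esub> s =
      tensor_lift HX (\<lambda>a y. tensor_elem K H X (h \<otimes>\<^bsub>H\<^esub> a) y) s"
proof -
  note mA = base.bilinear_mult[OF AHX] and mH = base.bilinear_mult[OF unital_algebra_H]
  note te = base.bilinear_tensor_elem[OF vectorspace_H VX]
  note b1 = base.bilinear_comp[OF te base.bilinearD(2)[OF mH h] base.hom_id]
  note b2 = base.bilinear_comp[OF te base.bilinearD(1)[OF mH h] base.hom_id]
  have h1: "tensor_elem K H X h \<one>\<^bsub>X\<^esub> \<in> carrier HX" using h X_one_closed by simp
  show "s \<otimes>\<^bsub>HX\<^esub> tensor_elem K H X h \<one>\<^bsub>X\<^esub> =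
      tensor_lift HX (\<lambda>a y. tensor_elem K H X (a \<otimes>\<^bsub>H\<^esub> h) y) s"
    by (rule base.tensor_hom_ext[OF vectorspace_H VX VHX base.bilinearD(2)[OF mA h1]
          base.tensor_lift_hom[OF vectorspace_H VX VHX b1] s])
      (simp add: base.tensor_lift_elem[OF vectorspace_H VX VHX b1]
        base.tensor_mult_elem[OF unital_algebra_H X] h X_one_closed X_mult_one)
  show "tensor_elem K H X h \<one>\<^bsub>X\<^esub> \<otimes>\<^bsub>HX\<^esub> s =
      tensor_lift HX (\<lambda>a y. tensor_elem K H X (h \<otimes>\<^bsub>H\<^esub> a) y) s"
    by (rule base.tensor_hom_ext[OF vectorspace_H VX VHX base.bilinearD(1)[OF mA h1]
          base.tensor_lift_hom[OF vectorspace_H VX VHX b2] s])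
      (simp add: base.tensor_lift_elem[OF vectorspace_H VX VHX b2]
        base.tensor_mult_elem[OF unital_algebra_H X] h X_one_closed X_mult_one)
qed

text \<open>After multiplying by \<open>U\<^sub>1\<^sub>3\<close> from the right, the two sides of the left-right condition evaluate at \<open>h\<close>
  to the two sides of the left-left condition, in exchanged order.\<close>

lemma yetter_drinfeld_condition_iff:
  assumes \<alpha>: "\<alpha> \<in> Hom X HX" and \<beta>: "\<beta> \<in> Hom X XD" and x: "x \<in> carrier X"
  defines "act \<equiv> induced_action X \<beta>"
  shows "tensor_assoc K H X D (tensor_map K HX D \<alpha> id (\<beta> x)) =
      Ad HXD (canonical_element_13 K H X) (tensor_map K H XD id \<beta> (\<alpha> x)) \<longleftrightarrow>
    (\<forall>h\<in>carrier H.
      tensor_lift HX (\<lambda>h1 h2. tensor_lift HX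
        (\<lambda>a y. tensor_elem K H X (h1 \<otimes>\<^bsub>H\<^esub> a) (act h2 y)) (\<alpha> x)) (comult H h) =
      tensor_lift HX (\<lambda>h1 h2. tensor_lift HX
        (\<lambda>a y. tensor_elem K H X (a \<otimes>\<^bsub>H\<^esub> h2) y) (\<alpha> (act h1 x))) (comult H h))"
    (is "?z = Ad HXD _ ?w \<longleftrightarrow> (\<forall>h\<in>carrier H. ?L h = ?R h)")
proof -
  let ?U = "canon (\<lambda>h. h)"
  interpret T: monoid HXD
    by (rule ring.is_monoid[OF base.unital_algebra_ring[OF AHXD]])
  note \<alpha>x = base.hom_closed[OF \<alpha> x] and \<beta>x = base.hom_closed[OF \<beta> x]
  have m: "tensor_map K HX D \<alpha> id (\<beta> x) \<in> carrier (HX \<boxtimes> D)"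
    by (rule base.hom_closed[OF base.tensor_map_hom[OF VX vectorspace_D VHX vectorspace_D \<alpha> id_Hom] \<beta>x])
  have z: "?z \<in> carrier HXD"
    by (rule base.hom_closed[OF base.tensor_assoc_hom[OF vectorspace_H VX vectorspace_D] m])
  have w: "?w \<in> carrier HXD"
    by (rule base.hom_closed[OF base.tensor_map_hom[OF vectorspace_H VX vectorspace_H VXD id_Hom \<beta>] \<alpha>x])
  have U: "?U \<in> carrier HXD" by (rule canon(1)[OF base.hom_id])
  have act: "act h y = ev X h (\<beta> y)" for h y by (simp add: act_def induced_action_eq_ev)
  have actc: "act h y \<in> carrier X" if "h \<in> carrier H" "y \<in> carrier X" for h y
    using base.hom_closed[OF ev_Hom[OF VX that(1)] base.hom_closed[OF \<beta> that(2)]] by (simp add: act)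
  have evz: "ev3 h ?z = \<alpha> (act h x)" if h: "h \<in> carrier H" for h
    by (simp add: ev3_assoc[OF h m] ev_natural[OF VX VHX \<alpha> h \<beta>x] act)
  have evw: "ev3 h ?w = tensor_lift HX (\<lambda>a y. tensor_elem K H X a (act h y)) (\<alpha> x)"
    if h: "h \<in> carrier H" for h
    using base.tensor_lift_map[OF vectorspace_H VX vectorspace_H VXD VHX id_Hom \<beta>
        base.bilinear_comp[OF base.bilinear_tensor_elem[OF vectorspace_H VX] id_Hom ev_Hom[OF VX h]] \<alpha>x]
    by (simp add: ev3_def tensor_map_def[of K H X] act)
  have R: "ev3 h (?z \<otimes>\<^bsub>HXD\<^esub> ?U) = ?R h" if h: "h \<in> carrier H" for h
    unfolding ev3_mult[OF h z U]
    by (rule base.tensor_lift_cong[OF vectorspace_H vectorspace_H comult_closed[OF h]])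
      (simp add: evz canon(2)[OF base.hom_id] HX_mult_elem_one(1) base.hom_closed[OF \<alpha>] actc x)
  have L: "ev3 h (?U \<otimes>\<^bsub>HXD\<^esub> ?w) = ?L h" if h: "h \<in> carrier H" for h
    unfolding ev3_mult[OF h U w]
  proof (rule base.tensor_lift_cong[OF vectorspace_H vectorspace_H comult_closed[OF h]])
    fix h1 h2 assume h1: "h1 \<in> carrier H" and h2: "h2 \<in> carrier H"
    let ?e = "tensor_elem K H X h1 \<one>\<^bsub>X\<^esub>"
    have e: "?e \<in> carrier HX" using h1 X_one_closed by simp
    have ah: "act h2 \<in> Hom X X"
      using base.hom_comp[OF \<beta> ev_Hom[OF VX h2]] by (simp add: act[abs_def])
    note b = base.bilinear_comp[OF base.bilinear_tensor_elem[OF vectorspace_H VX] base.hom_id ah]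
    have "ev3 h1 ?U \<otimes>\<^bsub>HX\<^esub> ev3 h2 ?w =
        ?e \<otimes>\<^bsub>HX\<^esub> tensor_lift HX (\<lambda>a y. tensor_elem K H X a (act h2 y)) (\<alpha> x)"
      by (simp add: evw h1 h2 canon(2)[OF base.hom_id])
    also have "\<dots> = tensor_lift HX (\<lambda>a y. ?e \<otimes>\<^bsub>HX\<^esub> tensor_elem K H X a (act h2 y)) (\<alpha> x)"
      by (rule base.hom_tensor_lift[OF vectorspace_H VX VHX VHX b
            base.bilinearD(1)[OF base.bilinear_mult[OF AHX] e] \<alpha>x])
    also have "\<dots> = tensor_lift HX (\<lambda>a y. tensor_elem K H X (h1 \<otimes>\<^bsub>H\<^esub> a) (act h2 y)) (\<alpha> x)"
      by (rule base.tensor_lift_cong[OF vectorspace_H VX \<alpha>x])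
        (simp add: base.tensor_mult_elem[OF unital_algebra_H X] h1 h2 X_one_closed X_mult_one actc)
    finally show "ev3 h1 ?U \<otimes>\<^bsub>HX\<^esub> ev3 h2 ?w =
        tensor_lift HX (\<lambda>a y. tensor_elem K H X (h1 \<otimes>\<^bsub>H\<^esub> a) (act h2 y)) (\<alpha> x)" .
  qed
  have "?z \<otimes>\<^bsub>HXD\<^esub> ?U = ?U \<otimes>\<^bsub>HXD\<^esub> ?w \<longleftrightarrow> (\<forall>h\<in>carrier H. ?L h = ?R h)"
  proof
    assume "?z \<otimes>\<^bsub>HXD\<^esub> ?U = ?U \<otimes>\<^bsub>HXD\<^esub> ?w"
    then show "\<forall>h\<in>carrier H. ?L h = ?R h" by (metis L R)
  next
    assume "\<forall>h\<in>carrier H. ?L h = ?R h"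
    then show "?z \<otimes>\<^bsub>HXD\<^esub> ?U = ?U \<otimes>\<^bsub>HXD\<^esub> ?w"
      using z w U by (intro ev3_eqI) (simp_all add: L R)
  qed
  then show ?thesis using canonical_conjugate_iff[OF z w] by simp
qed

end

end

theorem proposition4p3:
  fixes K :: "'k ring" and H :: "('k, 'h) hopf" and X :: "('k, 'x) module"
    and \<alpha> :: "'x \<Rightarrow> ('h \<times> 'x) list set"
    and \<beta> :: "'x \<Rightarrow> ('x \<times> ('h \<Rightarrow> 'k)) list set"
  assumes "field K"
    and "hopf_algebra K H"
    and "vectorspace.fin_dim K H"
    and "unital_algebra K X"
    and "left_coaction K H X \<alpha>"
    and "right_coaction K (dual_hopf K H) X \<beta>"
  shows "left_right_yetter_drinfeld_algebra K H X \<alpha> \<beta> \<longleftrightarrow>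
    yetter_drinfeld_algebra K H X (induced_action X \<beta>) \<alpha>"
proof -
  interpret fin_dim_hopf K H
    using assms(2,3) by (simp add: fin_dim_hopf_def fin_dim_hopf_axioms_def)
  have "\<alpha> \<in> module_hom K X (tensor K H X)"
    using assms(5) by (simp add: left_coaction_def algebra_hom_def)
  moreover have "\<beta> \<in> module_hom K X (tensor K X (dual_hopf K H))"
    using assms(6) by (simp add: right_coaction_def algebra_hom_def)
  ultimately show ?thesis
    using yetter_drinfeld_condition_iff[OF assms(4)] induced_left_action[OF assms(4,6)] assms(4-6)
    unfolding left_right_yetter_drinfeld_algebra_def yetter_drinfeld_algebra_def Let_def
    by blast
qed

end
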